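(* Let $\mathsf H$, $T$, $V$, $L$, $F=T+V$, $\mathsf S=\{x\in\mathsf H: 0\in F(x)\}$, the stochastic oracle and the RISFBF process $(Z_k,Y_k,X_k)$ be as in the context, and assume: $\mathsf S\neq\emptyset$; the oracle is conditionally unbiased, $\mathbb E_\xi[\hat V(x,\xi)]=V(x)$ for all $x\in\mathsf H$, and has uniformly bounded variance, $\mathbb E_\xi[\|\hat V(x,\xi)-V(x)\|^2]\le\sigma^2$ for some $\sigma>0$ and all $x\in\mathsf H$; the batch sizes $(m_k)_{k\ge1}$ are non-decreasing with $\sum_{k\ge1}1/m_k<\infty$. Let $\bar\alpha,\bar\varepsilon\in(0,1)$ be fixed. Let $(\alpha_k)_{k\in\mathbb N}$ be a non-decreasing (nonnegative) sequence with $\lim_{k\to\infty}\alpha_k=\bar\alpha$. Let $(\lambda_k)_{k\in\mathbb N}$ be a converging sequence in $(0,\frac1{4L})$ with $\lim_{k\to\infty}\lambda_k=\lambda\in(0,\frac1{4L})$. If $$\rho_k=\frac{5(1-\bar\varepsilon)(1-\bar\alpha)^2}{4(2\alpha_k^2-\alpha_k+1)(1+L\lambda_k)}\qquad\text{for all }k\ge1,$$ then: (i) $\lim_{k\to\infty}\mathrm{res}_{\lambda_k}(Z_k)=0$ in $L^2(\mathbb P)$, where $\mathrm{res}_\lambda(x)=\|x-J_{\lambda T}(x-\lambda V(x))\|$; (ii) the process $(X_k)_{k\in\mathbb N}$ converges weakly in $\mathsf H$, $\mathbb P$-almost surely, to an $\mathsf S$-valued random variable $X$; (iii) $\displaystyle\sum_{k=1}^\infty\left[(1-\alpha_k)\left(\frac{5(1-\alpha_k)}{4\rho_k(1+L\lambda_k)}-1\right)-2\alpha_k^2\right]\|X_k-X_{k-1}\|^2<\infty$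 $\mathbb P$-a.s.
   Context: $\mathsf H$ is a real separable Hilbert space with inner product $\langle\cdot,\cdot\rangle$ and norm $\|\cdot\|$. $T:\mathsf H\to2^{\mathsf H}$ is maximally monotone; $V:\mathsf H\to\mathsf H$ is maximally monotone and $L$-Lipschitz continuous ($L>0$) with full domain. $F=T+V$ and $J_{\lambda T}=(\mathrm{Id}+\lambda T)^{-1}$ is the resolvent. Oracle: on a complete probability space $(\Omega,\mathcal F,\mathbb P)$, $\xi$ is a random variable with values in a measurable set $\Xi\subseteq\mathbb R^d$ and law $\mathsf P$; $\hat V:\mathsf H\times\Xi\to\mathsf H$ is a (measurable) random operator estimating $V$. RISFBF algorithm: given initial points $X_0,X_1\in\operatorname{dom}T$, nonnegative sequences $(\alpha_k)$ (inertia), $(\rho_k)$ (relaxation), step sizes $\lambda_k>0$ and batch sizes $m_k\in\mathbb N$, $m_k\geq 1$, for $k\ge1$: $Z_k=X_k+\alpha_k(X_k-X_{k-1})$; $Y_k=J_{\lambda_kT}(Z_k-\lambda_kA_k)$ with $A_k=\frac1{m_k}\sum_{t=1}^{m_k}\hat V(Z_k,\xi_k^{(t)})$; $X_{k+1}=(1-\rho_k)Z_k+\rho_k[Y_k+\lambda_k(A_k-B_k)]$ with $B_k=\frac1{m_k}\sum_{t=1}^{m_k}\hat V(Y_k,\eta_k^{(t)})$; where all samples $\xi_k^{(t)},\eta_k^{(t)}$ ($1\le t\le m_k$, $k\ge1$) are independent draws from $\mathsf P$, independent of the past. *)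

theory Defs
  imports "HOL-Probability.Probability"
begin

definition monotone_op :: "('h::real_inner \<Rightarrow> 'h set) \<Rightarrow> bool" where
  "monotone_op T \<longleftrightarrow> (\<forall>x y. \<forall>u\<in>T x. \<forall>v\<in>T y. 0 \<le> inner (x - y) (u - v))"

text \<open>The order on set-valued operators is pointwise inclusion, that is, inclusion of graphs.\<close>

definition maximally_monotone :: "('h::real_inner \<Rightarrow> 'h set) \<Rightarrow> bool" where
  "maximally_monotone T \<longleftrightarrow> monotone_op T \<and> (\<forall>T'. monotone_op T' \<and> T \<le> T' \<longrightarrow> T' = T)"

definition dom_op :: "('h \<Rightarrow> 'h set) \<Rightarrow> 'h set" where
  "dom_op T = {x. T x \<noteq> {}}"

definition inverse_op :: "('h \<Rightarrow> 'h set) \<Rightarrow> 'h \<Rightarrow> 'h set" where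
  "inverse_op T y = {x. y \<in> T x}"

definition sum_op :: "('h::plus \<Rightarrow> 'h set) \<Rightarrow> ('h \<Rightarrow> 'h set) \<Rightarrow> 'h \<Rightarrow> 'h set" where
  "sum_op S T x = {u + v |u v. u \<in> S x \<and> v \<in> T x}"

definition scale_op :: "real \<Rightarrow> ('h::real_vector \<Rightarrow> 'h set) \<Rightarrow> 'h \<Rightarrow> 'h set" where
  "scale_op c T x = {c *\<^sub>R u |u. u \<in> T x}"

abbreviation single_op :: "('h \<Rightarrow> 'h) \<Rightarrow> 'h \<Rightarrow> 'h set" where
  "single_op f \<equiv> (\<lambda>x. {f x})"

definition zeros_op :: "('h::zero \<Rightarrow> 'h set) \<Rightarrow> 'h set" where
  "zeros_op F = {x. 0 \<in> F x}"

text \<open>The resolvent is the inverse of \<open>Id + c T\<close>. For \<open>c > 0\<close> and maximally monotone \<open>T\<close> on a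
  Hilbert space this inverse is single-valued with full domain (Minty), so that the description
  operator below selects its unique value.\<close>

definition resolvent :: "real \<Rightarrow> ('h::real_vector \<Rightarrow> 'h set) \<Rightarrow> 'h \<Rightarrow> 'h" where
  "resolvent c T x = (THE y. y \<in> inverse_op (sum_op (single_op id) (scale_op c T)) x)"

definition residual :: "('h::real_normed_vector \<Rightarrow> 'h set) \<Rightarrow> ('h \<Rightarrow> 'h) \<Rightarrow> real \<Rightarrow> 'h \<Rightarrow> real" where
  "residual T V c x = norm (x - resolvent c T (x - c *\<^sub>R V x))"

definition weakly_converges :: "(nat \<Rightarrow> 'h::real_inner) \<Rightarrow> 'h \<Rightarrow> bool" where
  "weakly_converges x l \<longleftrightarrow> (\<forall>h. (\<lambda>k. inner (x k) h) \<longlonglongrightarrow> inner l h)"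

definition minibatch ::
  "('h::real_vector \<Rightarrow> 'd \<Rightarrow> 'h) \<Rightarrow> nat \<Rightarrow> (nat \<Rightarrow> 'd) \<Rightarrow> 'h \<Rightarrow> 'h" where
  "minibatch Vhat n s x = (1 / real n) *\<^sub>R (\<Sum>t=1..n. Vhat x (s t))"

text \<open>Indices \<open>(k, t)\<close> of the samples drawn when the batch size in iteration \<open>k\<close> is \<open>m k\<close>.\<close>

definition sample_indices :: "(nat \<Rightarrow> nat) \<Rightarrow> (nat \<times> nat) set" where
  "sample_indices m = (SIGMA k:{1..}. {1..m k})"

text \<open>The starting points are deterministic; hence mutual independence of all the samples, over
  both families and all indices, already makes the samples of each half-step independent
  of the past.\<close>

definition iid_samples ::
  "'w measure \<Rightarrow> 'd measure \<Rightarrow> (nat \<Rightarrow> nat) \<Rightarrow> (nat \<Rightarrow> nat \<Rightarrow> 'w \<Rightarrow> 'd) \<Rightarrow> (nat \<Rightarrow> nat \<Rightarrow> 'w \<Rightarrow> 'd) \<Rightarrow> bool"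
where
  "iid_samples M P m xi eta \<longleftrightarrow>
     prob_space.indep_vars M (\<lambda>_. P) (case_sum (\<lambda>(k, t). xi k t) (\<lambda>(k, t). eta k t))
       (sample_indices m <+> sample_indices m) \<and>
     (\<forall>(k, t) \<in> sample_indices m. distr M P (xi k t) = P \<and> distr M P (eta k t) = P)"

definition risfbf_process ::
  "'w measure \<Rightarrow> ('h::real_vector \<Rightarrow> 'h set) \<Rightarrow> ('h \<Rightarrow> 'd \<Rightarrow> 'h) \<Rightarrow>
   (nat \<Rightarrow> real) \<Rightarrow> (nat \<Rightarrow> real) \<Rightarrow> (nat \<Rightarrow> real) \<Rightarrow> (nat \<Rightarrow> nat) \<Rightarrow>
   (nat \<Rightarrow> nat \<Rightarrow> 'w \<Rightarrow> 'd) \<Rightarrow> (nat \<Rightarrow> nat \<Rightarrow> 'w \<Rightarrow> 'd) \<Rightarrow> 'h \<Rightarrow> 'h \<Rightarrow>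
   (nat \<Rightarrow> 'w \<Rightarrow> 'h) \<Rightarrow> (nat \<Rightarrow> 'w \<Rightarrow> 'h) \<Rightarrow> (nat \<Rightarrow> 'w \<Rightarrow> 'h) \<Rightarrow> bool"
where
  "risfbf_process M T Vhat \<alpha> \<rho> lam m xi eta x0 x1 Z Y X \<longleftrightarrow>
     (\<forall>\<omega>\<in>space M. X 0 \<omega> = x0 \<and> X 1 \<omega> = x1 \<and>
       (\<forall>k\<ge>1.
         let A = minibatch Vhat (m k) (\<lambda>t. xi k t \<omega>) (Z k \<omega>);
             B = minibatch Vhat (m k) (\<lambda>t. eta k t \<omega>) (Y k \<omega>)
         in Z k \<omega> = X k \<omega> + \<alpha> k *\<^sub>R (X k \<omega> - X (k - 1) \<omega>) \<and>
            Y k \<omega> = resolvent (lam k) T (Z k \<omega> - lam k *\<^sub>R A) \<and>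
            X (k + 1) \<omega> = (1 - \<rho> k) *\<^sub>R Z k \<omega> + \<rho> k *\<^sub>R (Y k \<omega> + lam k *\<^sub>R (A - B))))"

end

(*
  Take p in S and put D_k = |X_k - X_(k-1)|^2. Monotonicity of T and V at p gives the almost
  decreasing Lyapunov function
    H_k = |X_k - p|^2 - alpha_k |X_(k-1) - p|^2 + (1 - alpha_k) (kappa_k - 1) D_k,
  with kappa_k = 5 / (4 rho_k (1 + L lambda_k)): up to noise it loses the k-th summand of (iii) and
  a multiple of |Z_k - Y_k|^2 in each step. The noise consists of a part bounded by the squared
  mini-batch errors, which is summable in L^1, and of the martingale difference
  <B_k - V(Y_k), Y_k - p>. Taking expectations first kills the latter, bounds E|X_k - p|^2 and makes
  sum E|Z_k - Y_k|^2 finite, which is (i). With this bound the martingale is bounded in L^2 and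
  converges almost surely, so that H_k converges and (iii) holds pathwise, without
  Robbins-Siegmund. Opial's lemma and demiclosedness of T + V yield (ii).
*)
theory Submission
  imports Defs "HOL-Library.Diagonal_Subsequence"
begin

section \<open>Monotone operators and weak convergence in Hilbert spaces\<close>

text \<open>Written for the corrected point \<open>y + lam (A - B)\<close>, the monotonicity
  inequality at p contains \<open>B\<close> but not \<open>A\<close>. So only the error of
  \<open>B\<close> is tested linearly, against Y_k - p, which is known before \<open>B\<close> is
  sampled; the error of \<open>A\<close>, on which Y_k itself depends, enters only through squares.
  This is why a single martingale suffices and why the filtration has to separate the two
  half-steps.

  The order "means first, paths second" is forced: the variance of the martingale difference is
  bounded by a multiple of E|Y_k - p|^2 / m_k, which is summable only once these moments are known
  to be bounded.

  The choice of rho_k cancels 1 + L lambda_k from kappa_k and leaves (2 a^2 - a + 1) / c with a =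
  alpha_k and c = (1 - epsbar) (1 - alphabar)^2. The coefficient in (iii) then factors as (2 a^2 - a
  + 1) ((1 - a)^2 / c - 1). As a never exceeds alphabar, this stays above a positive constant, and
  the monotonicity in k of the Lyapunov coefficient becomes an inequality about a alone.\<close>

text \<open>\<open>E\<close> plays the role of the epigraph of a closed convex function f. Strong
  convexity of f + |.|^2 / 2 makes minimising sequences Cauchy, so no weak compactness is needed.
  The conclusion is the optimality condition: - z0 is a subgradient of f at z0. Both Minty's theorem
  and the Riesz representation are drawn from it.\<close>

lemma strongly_convex_minimizer:
  fixes E :: "('a::{real_inner, complete_space} \<times> real) set"
  assumes "closed E" "convex E" "E \<noteq> {}"
    and bound: "\<And>z r. (z, r) \<in> E \<Longrightarrow> B \<le> r + (norm z)\<^sup>2 / 2"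
  shows "\<exists>z0 r0. (z0, r0) \<in> E \<and> (\<forall>z r. (z, r) \<in> E \<longrightarrow> r0 + inner z0 (z0 - z) \<le> r)"
proof -
  define \<phi> where "\<phi> = (\<lambda>e::'a \<times> real. snd e + (norm (fst e))\<^sup>2 / 2)"
  define I where "I = Inf (\<phi> ` E)"
  have bdd: "bdd_below (\<phi> ` E)"
    using bound by (auto simp: \<phi>_def intro!: bdd_belowI[of _ B])
  have I_le: "I \<le> \<phi> e" if "e \<in> E" for e
    unfolding I_def using bdd that by (intro cInf_lower) auto
  have "\<exists>e\<in>E. \<phi> e < I + inverse (real (Suc n))" for n
  proof -
    have "Inf (\<phi> ` E) < I + inverse (real (Suc n))"
      by (simp add: I_def)
    then show ?thesis
      using cInf_lessD[of "\<phi> ` E"] \<open>E \<noteq> {}\<close> by auto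
  qed
  then obtain e where e: "\<And>n. e n \<in> E" "\<And>n. \<phi> (e n) < I + inverse (real (Suc n))"
    by metis
  \<comment> \<open>Parallelogram law, with the value at the midpoint bounded below by the infimum
    \<open>I\<close>.\<close>
  have mid: "(norm (fst a - fst b))\<^sup>2 \<le> 4 * (\<phi> a - I) + 4 * (\<phi> b - I)" if "a \<in> E" "b \<in> E" for a b
  proof -
    have "(1 / 2) *\<^sub>R a + (1 / 2) *\<^sub>R b \<in> E"
      using \<open>convex E\<close> that by (intro convexD) auto
    from I_le[OF this] have "8 * I \<le> 4 * snd a + 4 * snd b + (norm (fst a + fst b))\<^sup>2"
      by (simp add: \<phi>_def power2_norm_eq_inner inner_add_left inner_add_right field_simps)
    then show ?thesis
      by (simp add: \<phi>_def power2_norm_eq_inner inner_add_left inner_add_right inner_diff_left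
          inner_diff_right inner_commute[of "fst b" "fst a"])
  qed
  have "Cauchy (\<lambda>n. fst (e n))"
  proof (rule metric_CauchyI)
    fix d :: real assume d: "d > 0"
    obtain N where N: "inverse (real (Suc N)) < d\<^sup>2 / 8"
      using reals_Archimedean[of "d\<^sup>2 / 8"] d by auto
    have "dist (fst (e m)) (fst (e n)) < d" if "m \<ge> N" "n \<ge> N" for m n
    proof -
      have "inverse (real (Suc i)) \<le> inverse (real (Suc N))" if "i \<ge> N" for i
        using that by (simp add: field_simps)
      from this[OF that(1)] this[OF that(2)] mid[OF e(1)[of m] e(1)[of n]] e(2)[of m] e(2)[of n] N
      have "(norm (fst (e m) - fst (e n)))\<^sup>2 < d\<^sup>2" by argo
      then show ?thesis
        using d by (simp add: dist_norm power_less_imp_less_base)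
    qed
    then show "\<exists>N. \<forall>m\<ge>N. \<forall>n\<ge>N. dist (fst (e m)) (fst (e n)) < d" by blast
  qed
  then obtain z0 where z0: "(\<lambda>n. fst (e n)) \<longlonglongrightarrow> z0"
    using Cauchy_convergent_iff convergent_def by blast
  have "(\<lambda>n. \<phi> (e n)) \<longlonglongrightarrow> I"
  proof (rule tendsto_sandwich[of "\<lambda>_. I" _ _ "\<lambda>n. I + inverse (real (Suc n))"])
    show "(\<lambda>n. I + inverse (real (Suc n))) \<longlonglongrightarrow> I"
      using tendsto_add[OF tendsto_const LIMSEQ_inverse_real_of_nat, of I] by simp
    show "\<forall>\<^sub>F n in sequentially. I \<le> \<phi> (e n)"
      by (intro always_eventually allI I_le e)
    show "\<forall>\<^sub>F n in sequentially. \<phi> (e n) \<le> I + inverse (real (Suc n))"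
      by (intro always_eventually allI less_imp_le e)
  qed (rule tendsto_const)
  then have "(\<lambda>n. \<phi> (e n) - (norm (fst (e n)))\<^sup>2 / 2) \<longlonglongrightarrow> I - (norm z0)\<^sup>2 / 2"
    using z0 by (intro tendsto_intros) auto
  then have "(\<lambda>n. snd (e n)) \<longlonglongrightarrow> I - (norm z0)\<^sup>2 / 2"
    by (simp add: \<phi>_def)
  from tendsto_Pair[OF z0 this] have "e \<longlonglongrightarrow> (z0, I - (norm z0)\<^sup>2 / 2)"
    by simp
  then have E0: "(z0, I - (norm z0)\<^sup>2 / 2) \<in> E"
    using \<open>closed E\<close> e(1) closed_sequentially by blast
  moreover have "I - (norm z0)\<^sup>2 / 2 + inner z0 (z0 - z) \<le> r" if zr: "(z, r) \<in> E" for z r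
  proof -
    define r0 where "r0 = I - (norm z0)\<^sup>2 / 2"
    \<comment> \<open>Minimality against the point with parameter t on the segment to (z, r),
      divided by t; the limit t to 0 removes the quadratic term.\<close>
    have *: "0 \<le> r - r0 + inner z0 (z - z0) + t * ((norm (z - z0))\<^sup>2 / 2)" if t: "0 < t" "t < 1" for t
    proof -
      have "(1 - t) *\<^sub>R (z0, r0) + t *\<^sub>R (z, r) \<in> E"
        using \<open>convex E\<close> E0 zr t by (intro convexD) (auto simp: r0_def)
      from I_le[OF this] have "I \<le> (1 - t) * r0 + t * r + (norm ((1 - t) *\<^sub>R z0 + t *\<^sub>R z))\<^sup>2 / 2"
        by (simp add: \<phi>_def)
      also have "(1 - t) *\<^sub>R z0 + t *\<^sub>R z = z0 + t *\<^sub>R (z - z0)"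
        by (simp add: algebra_simps)
      also have "(norm (z0 + t *\<^sub>R (z - z0)))\<^sup>2 =
          (norm z0)\<^sup>2 + 2 * t * inner z0 (z - z0) + t\<^sup>2 * (norm (z - z0))\<^sup>2"
        by (simp only: power2_norm_eq_inner)
          (simp add: inner_add_left inner_add_right inner_commute power2_eq_square algebra_simps)
      finally have "2 * I \<le> 2 * ((1 - t) * r0 + t * r) + ((norm z0)\<^sup>2 +
          2 * t * inner z0 (z - z0) + t\<^sup>2 * (norm (z - z0))\<^sup>2)"
        by argo
      moreover have "2 * I = 2 * r0 + (norm z0)\<^sup>2" by (simp add: r0_def)
      ultimately have "0 \<le> 2 * (t * r - t * r0) + (2 * t * inner z0 (z - z0) + t\<^sup>2 * (norm (z - z0))\<^sup>2)"
        by (simp add: algebra_simps)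
      then have "0 \<le> t * (r - r0 + inner z0 (z - z0) + t * ((norm (z - z0))\<^sup>2 / 2))"
        by (simp add: field_simps power2_eq_square)
      then show ?thesis
        using t by (simp add: zero_le_mult_iff)
    qed
    have "((\<lambda>t. r - r0 + inner z0 (z - z0) + t * ((norm (z - z0))\<^sup>2 / 2)) \<longlongrightarrow>
        r - r0 + inner z0 (z - z0) + 0 * ((norm (z - z0))\<^sup>2 / 2)) (at_right 0)"
      by (intro tendsto_intros)
    then have "0 \<le> r - r0 + inner z0 (z - z0) + 0 * ((norm (z - z0))\<^sup>2 / 2)"
    proof (rule tendsto_lowerbound)
      show "\<forall>\<^sub>F t in at_right 0. 0 \<le> r - r0 + inner z0 (z - z0) + t * ((norm (z - z0))\<^sup>2 / 2)"
        unfolding eventually_at_right_field using * by (intro exI[of _ 1]) auto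
    qed simp
    then show ?thesis
      by (simp add: r0_def inner_diff_right)
  qed
  ultimately show ?thesis
    by (intro exI conjI allI impI)
qed

section \<open>Maximally monotone operators and their resolvents\<close>

text \<open>Adjoining one monotonically related pair to the graph preserves monotonicity, so
  maximality over all extensions can be tested pair by pair. All later uses of maximality go through
  this form.\<close>

lemma maximally_monotone_iff:
  "maximally_monotone T \<longleftrightarrow> monotone_op T \<and>
     (\<forall>x u. (\<forall>a. \<forall>b\<in>T a. 0 \<le> inner (x - a) (u - b)) \<longrightarrow> u \<in> T x)"
proof (intro iffI conjI allI impI)
  fix x u assume T: "maximally_monotone T" and rel: "\<forall>a. \<forall>b\<in>T a. 0 \<le> inner (x - a) (u - b)"
  define T' where "T' = T(x := insert u (T x))"
  have flip: "inner (a - x) (b - u) = inner (x - a) (u - b)" for a b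
    by (simp add: inner_diff_left inner_diff_right)
  have "monotone_op T'"
    using T rel flip unfolding maximally_monotone_def monotone_op_def T'_def
    by (auto split: if_splits)
  moreover have "T \<le> T'" by (auto simp: T'_def le_fun_def)
  ultimately have "T' = T" using T by (auto simp: maximally_monotone_def)
  then show "u \<in> T x" unfolding T'_def by (metis fun_upd_same insertI1)
next
  assume R: "monotone_op T \<and>
     (\<forall>x u. (\<forall>a. \<forall>b\<in>T a. 0 \<le> inner (x - a) (u - b)) \<longrightarrow> u \<in> T x)"
  show "maximally_monotone T"
    unfolding maximally_monotone_def
  proof (intro conjI allI impI)
    fix T' assume T': "monotone_op T' \<and> T \<le> T'"
    have "T' x \<subseteq> T x" for x
    proof
      fix u assume "u \<in> T' x"
      then have "\<forall>a. \<forall>b\<in>T a. 0 \<le> inner (x - a) (u - b)"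
        using T' unfolding monotone_op_def le_fun_def by blast
      then show "u \<in> T x" using R by blast
    qed
    moreover have "T x \<subseteq> T' x" for x using T' by (simp add: le_fun_def)
    ultimately show "T' = T" by (intro ext equalityI)
  qed (use R in auto)
qed (auto simp: maximally_monotone_def)

lemma maximally_monotoneD:
  assumes "maximally_monotone T"
  shows "\<And>x y u v. u \<in> T x \<Longrightarrow> v \<in> T y \<Longrightarrow> 0 \<le> inner (x - y) (u - v)"
    and "\<And>x u. (\<And>a b. b \<in> T a \<Longrightarrow> 0 \<le> inner (x - a) (u - b)) \<Longrightarrow> u \<in> T x"
proof -
  have *: "\<forall>x y. \<forall>u\<in>T x. \<forall>v\<in>T y. 0 \<le> inner (x - y) (u - v)"
    "\<forall>x u. (\<forall>a. \<forall>b\<in>T a. 0 \<le> inner (x - a) (u - b)) \<longrightarrow> u \<in> T x"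
    using assms[unfolded maximally_monotone_iff monotone_op_def]
    by (rule conjunct1, rule conjunct2)
  show "0 \<le> inner (x - y) (u - v)" if "u \<in> T x" "v \<in> T y" for x y u v
    using *(1) that by blast
  show "u \<in> T x" if "\<And>a b. b \<in> T a \<Longrightarrow> 0 \<le> inner (x - a) (u - b)" for x u
    using *(2) that by blast
qed

text \<open>Minimising the Fitzpatrick function of \<open>T\<close> plus half the squared norm yields \<open>(x, u)\<close> such
  that \<open>(- u, - x)\<close> is monotonically related to the whole graph, hence lies in it, and \<open>u = - x\<close>.\<close>

lemma minty_zero:
  fixes T :: "'a::{real_inner, complete_space} \<Rightarrow> 'a set"
  assumes T: "maximally_monotone T"
  shows "\<exists>x. - x \<in> T x"
proof -
  note mono = maximally_monotoneD(1)[OF T] and maxi = maximally_monotoneD(2)[OF T]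
  \<comment> \<open>The epigraph of the Fitzpatrick function, a supremum over the graph of
    continuous affine functions; hence closed and convex.\<close>
  define E where "E = {e :: ('a \<times> 'a) \<times> real. \<forall>a. \<forall>b\<in>T a.
    inner (fst (fst e)) b + inner a (snd (fst e)) - inner a b \<le> snd e}"
  have "E = (\<Inter>a. \<Inter>b\<in>T a. {e. inner (fst (fst e)) b + inner a (snd (fst e)) - inner a b \<le> snd e})"
    by (auto simp: E_def)
  moreover have "closed {e :: ('a \<times> 'a) \<times> real.
      inner (fst (fst e)) b + inner a (snd (fst e)) - inner a b \<le> snd e}" for a b
    by (intro closed_Collect_le continuous_intros)
  ultimately have "closed E" by auto
  have "convex E"
  proof (rule convexI)
    fix d e :: "('a \<times> 'a) \<times> real" and s t :: real
    assume d: "d \<in> E" and e: "e \<in> E" and st: "0 \<le> s" "0 \<le> t" "s + t = 1"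
    show "s *\<^sub>R d + t *\<^sub>R e \<in> E"
      unfolding E_def
    proof (intro CollectI allI ballI)
      fix a b assume "b \<in> T a"
      then have "s * (inner (fst (fst d)) b + inner a (snd (fst d)) - inner a b) \<le> s * snd d"
        "t * (inner (fst (fst e)) b + inner a (snd (fst e)) - inner a b) \<le> t * snd e"
        using d e st by (auto simp: E_def intro!: mult_left_mono)
      moreover have "inner a b = s * inner a b + t * inner a b"
        using st by (simp flip: distrib_right)
      ultimately show "inner (fst (fst (s *\<^sub>R d + t *\<^sub>R e))) b + inner a (snd (fst (s *\<^sub>R d + t *\<^sub>R e)))
          - inner a b \<le> snd (s *\<^sub>R d + t *\<^sub>R e)"
        by (simp add: inner_add_left inner_add_right algebra_simps)
    qed
  qed
  have gr: "((a, b), inner a b) \<in> E" if "b \<in> T a" for a b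
    unfolding E_def
  proof (intro CollectI allI ballI)
    fix a' b' assume "b' \<in> T a'"
    from mono[OF that this]
    show "inner (fst (fst ((a, b), inner a b))) b' + inner a' (snd (fst ((a, b), inner a b)))
        - inner a' b' \<le> snd ((a, b), inner a b)"
      by (simp add: inner_diff_left inner_diff_right)
  qed
  have "\<exists>a b. b \<in> T a" using maxi[of 0 0] by blast
  with gr have "E \<noteq> {}" by blast
  \<comment> \<open>The Fitzpatrick function dominates the duality pairing. If it failed at (x, u),
    that pair would be related to the whole graph, hence belong to it, and testing with the pair
    itself gives equality.\<close>
  have low: "inner x u \<le> r" if "((x, u), r) \<in> E" for x u r
  proof (rule ccontr)
    assume n: "\<not> inner x u \<le> r"
    have F: "inner x b + inner a u - inner a b \<le> r" if "b \<in> T a" for a b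
      using \<open>((x, u), r) \<in> E\<close> that by (auto simp: E_def)
    have "u \<in> T x"
    proof (rule maxi)
      fix a b assume "b \<in> T a"
      from F[OF this] n show "0 \<le> inner (x - a) (u - b)"
        by (simp add: inner_diff_left inner_diff_right)
    qed
    from F[OF this] n show False by simp
  qed
  have bnd: "0 \<le> r + (norm z)\<^sup>2 / 2" if "(z, r) \<in> E" for z r
  proof -
    obtain x u where z: "z = (x, u)" by fastforce
    have "(norm z)\<^sup>2 = (norm x)\<^sup>2 + (norm u)\<^sup>2"
      by (simp add: z norm_Pair)
    moreover have "0 \<le> (norm (x + u))\<^sup>2" by simp
    then have "0 \<le> (norm x)\<^sup>2 + (norm u)\<^sup>2 + 2 * inner x u"
      by (simp add: power2_norm_eq_inner inner_add_left inner_add_right inner_commute)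
    ultimately show ?thesis
      using low[of x u r] that z by (simp add: field_simps)
  qed
  obtain z0 r0 where z0: "(z0, r0) \<in> E"
    and opt: "\<And>z r. (z, r) \<in> E \<Longrightarrow> r0 + inner z0 (z0 - z) \<le> r"
    using strongly_convex_minimizer[OF \<open>closed E\<close> \<open>convex E\<close> \<open>E \<noteq> {}\<close> bnd] by blast
  obtain x u where z: "z0 = (x, u)" by fastforce
  \<comment> \<open>The optimality condition tested at graph points, where the Fitzpatrick function
    equals the pairing. Once (- u, - x) is known to lie in the graph, the same inequality at that
    pair forces x + u = 0.\<close>
  have rel: "(norm (x + u))\<^sup>2 \<le> inner (- u - a) (- x - b)" if "b \<in> T a" for a b
  proof -
    have "inner (- u - a) (- x - b) = inner x u + inner u b + inner x a + inner a b"
      by (simp add: inner_diff_left inner_diff_right inner_commute)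
    moreover have "(norm (x + u))\<^sup>2 = inner x x + 2 * inner x u + inner u u"
      by (simp add: power2_norm_eq_inner inner_add_left inner_add_right inner_commute)
    moreover have "inner z0 (z0 - (a, b)) = inner x x - inner x a + (inner u u - inner u b)"
      by (simp add: z inner_diff_right)
    moreover have "inner x u \<le> r0" using z0 by (intro low) (simp add: z)
    ultimately show ?thesis using opt[OF gr[OF that]] by argo
  qed
  have "- x \<in> T (- u)"
  proof (rule maxi)
    fix a b assume "b \<in> T a"
    from rel[OF this] show "0 \<le> inner (- u - a) (- x - b)"
      using zero_le_power2[of "norm (x + u)"] by linarith
  qed
  from rel[OF this] have "x + u = 0" by simp
  then have "- u = x" by (simp add: neg_eq_iff_add_eq_0 add.commute)
  with \<open>- x \<in> T (- u)\<close> show ?thesis by auto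
qed

text \<open>Surjectivity of Id + c T reduces to the case already treated, applied to the operator c
  T - x, which inherits maximality from T.\<close>

lemma minty:
  fixes T :: "'a::{real_inner, complete_space} \<Rightarrow> 'a set"
  assumes T: "maximally_monotone T" and c: "c > 0"
  shows "\<exists>y. (1 / c) *\<^sub>R (x - y) \<in> T y"
proof -
  note mono = maximally_monotoneD(1)[OF T] and maxi = maximally_monotoneD(2)[OF T]
  define T' where "T' = (\<lambda>y. (\<lambda>b. c *\<^sub>R b - x) ` T y)"
  have "maximally_monotone T'"
    unfolding maximally_monotone_iff
  proof (intro conjI allI impI)
    show "monotone_op T'"
      using mono c by (auto simp: monotone_op_def T'_def simp flip: scaleR_diff_right)
    fix y u assume rel: "\<forall>a. \<forall>b\<in>T' a. 0 \<le> inner (y - a) (u - b)"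
    have "(1 / c) *\<^sub>R (u + x) \<in> T y"
    proof (rule maxi)
      fix a b assume "b \<in> T a"
      then have "0 \<le> inner (y - a) (u - (c *\<^sub>R b - x))"
        using rel by (auto simp: T'_def)
      also have "u - (c *\<^sub>R b - x) = c *\<^sub>R ((1 / c) *\<^sub>R (u + x) - b)"
        using c by (simp add: algebra_simps)
      finally show "0 \<le> inner (y - a) ((1 / c) *\<^sub>R (u + x) - b)"
        using c by (simp add: zero_le_mult_iff)
    qed
    then show "u \<in> T' y"
      unfolding T'_def using c by (intro image_eqI[of _ _ "(1 / c) *\<^sub>R (u + x)"]) auto
  qed
  then obtain y where "- y \<in> T' y" using minty_zero by blast
  then obtain b where "b \<in> T y" "- y = c *\<^sub>R b - x" by (auto simp: T'_def)
  moreover from this(2) have "c *\<^sub>R b = x - y" by (simp add: algebra_simps)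
  then have "b = (1 / c) *\<^sub>R (x - y)" using c by (metis c divide_self_if less_irrefl
      scaleR_one scaleR_scaleR times_divide_eq_left mult_1)
  ultimately show ?thesis by auto
qed

text \<open>Monotonicity gives firm nonexpansiveness, then Cauchy-Schwarz. It is phrased with
  inclusions because \<open>resolvent\<close> is a description: the case x = x' is the uniqueness
  that makes it well defined, and only afterwards does the general case become nonexpansiveness of
  \<open>resolvent\<close>.\<close>

lemma resolvent_unique:
  fixes T :: "'a::real_inner \<Rightarrow> 'a set"
  assumes T: "maximally_monotone T" and c: "c > 0"
    and y: "(1 / c) *\<^sub>R (x - y) \<in> T y" and z: "(1 / c) *\<^sub>R (x' - z) \<in> T z"
  shows "norm (y - z) \<le> norm (x - x')"
proof -
  have "0 \<le> inner (y - z) ((1 / c) *\<^sub>R (x - y) - (1 / c) *\<^sub>R (x' - z))"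
    using maximally_monotoneD(1)[OF T y z] .
  also have "\<dots> = (1 / c) * (inner (y - z) (x - x') - (norm (y - z))\<^sup>2)"
    by (simp add: power2_norm_eq_inner inner_diff_right flip: scaleR_diff_right)
  finally have "(norm (y - z))\<^sup>2 \<le> inner (y - z) (x - x')"
    using c by (simp add: zero_le_divide_iff)
  also have "\<dots> \<le> norm (y - z) * norm (x - x')" by (rule norm_cauchy_schwarz)
  finally show ?thesis
    by (cases "norm (y - z) = 0") (auto simp: power2_eq_square)
qed

lemma resolvent_eqI:
  fixes T :: "'a::real_inner \<Rightarrow> 'a set"
  assumes T: "maximally_monotone T" and c: "c > 0" and y: "(1 / c) *\<^sub>R (x - y) \<in> T y"
  shows "resolvent c T x = y"
proof -
  have *: "z \<in> inverse_op (sum_op (single_op id) (scale_op c T)) x \<longleftrightarrow> (1 / c) *\<^sub>R (x - z) \<in> T z" for z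
  proof
    assume "z \<in> inverse_op (sum_op (single_op id) (scale_op c T)) x"
    then obtain b where "b \<in> T z" "x = z + c *\<^sub>R b"
      by (auto simp: inverse_op_def sum_op_def scale_op_def)
    then show "(1 / c) *\<^sub>R (x - z) \<in> T z" using c by simp
  next
    assume "(1 / c) *\<^sub>R (x - z) \<in> T z"
    moreover have "x = z + c *\<^sub>R ((1 / c) *\<^sub>R (x - z))" using c by simp
    ultimately show "z \<in> inverse_op (sum_op (single_op id) (scale_op c T)) x"
      unfolding inverse_op_def sum_op_def scale_op_def id_def by blast
  qed
  show ?thesis
    unfolding resolvent_def *
  proof (rule the_equality)
    fix z assume "(1 / c) *\<^sub>R (x - z) \<in> T z"
    from resolvent_unique[OF T c this y] show "z = y" by simp
  qed (rule y)
qed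

lemma resolvent_in:
  fixes T :: "'a::{real_inner, complete_space} \<Rightarrow> 'a set"
  assumes "maximally_monotone T" "c > 0"
  shows "(1 / c) *\<^sub>R (x - resolvent c T x) \<in> T (resolvent c T x)"
proof -
  obtain y where y: "(1 / c) *\<^sub>R (x - y) \<in> T y"
    using minty[OF assms] by blast
  then show ?thesis by (simp only: resolvent_eqI[OF assms y])
qed

lemma resolvent_nonexpansive:
  fixes T :: "'a::{real_inner, complete_space} \<Rightarrow> 'a set"
  assumes "maximally_monotone T" "c > 0"
  shows "norm (resolvent c T x - resolvent c T y) \<le> norm (x - y)"
  by (intro resolvent_unique[OF assms] resolvent_in[OF assms])

section \<open>Weak sequential compactness and Opial's lemma\<close>

text \<open>Minimise |z|^2 / 2 - f z. Optimality bounds the linear functional f - <z0, .> from above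
  by a constant, so it vanishes.\<close>

lemma riesz_representation:
  fixes f :: "'a::{real_inner, complete_space} \<Rightarrow> real"
  assumes f: "bounded_linear f"
  shows "\<exists>y. \<forall>h. f h = inner y h"
proof -
  interpret f: bounded_linear f by fact
  obtain K where K: "\<And>x. norm (f x) \<le> norm x * K" using f.bounded by blast
  define E where "E = {e :: 'a \<times> real. - f (fst e) \<le> snd e}"
  have "closed E" unfolding E_def
    by (intro closed_Collect_le continuous_intros f.continuous_on)
  have "convex E"
  proof (rule convexI)
    fix d e :: "'a \<times> real" and s t :: real
    assume "d \<in> E" and "e \<in> E" and st: "0 \<le> s" "0 \<le> t" "s + t = 1"
    then have "- f (fst d) \<le> snd d" "- f (fst e) \<le> snd e"
      by (simp_all add: E_def)
    from this[THEN mult_left_mono] st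
    have "s * (- f (fst d)) \<le> s * snd d" "t * (- f (fst e)) \<le> t * snd e" by blast+
    then show "s *\<^sub>R d + t *\<^sub>R e \<in> E"
      by (simp add: E_def f.add f.scaleR)
  qed
  have "(0, 0) \<in> E" by (simp add: E_def f.zero)
  then have "E \<noteq> {}" by blast
  have bnd: "- (K\<^sup>2 / 2) \<le> r + (norm z)\<^sup>2 / 2" if "(z, r) \<in> E" for z r
  proof -
    have "- r \<le> norm z * K" using that K[of z] by (auto simp: E_def)
    moreover have "0 \<le> (norm z - K)\<^sup>2" by simp
    ultimately show ?thesis by (simp add: power2_diff)
  qed
  obtain z0 r0 where z0: "(z0, r0) \<in> E"
    and opt: "\<And>z r. (z, r) \<in> E \<Longrightarrow> r0 + inner z0 (z0 - z) \<le> r"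
    using strongly_convex_minimizer[OF \<open>closed E\<close> \<open>convex E\<close> \<open>E \<noteq> {}\<close> bnd] by blast
  define C where "C = - r0 - inner z0 z0"
  have le: "f z - inner z0 z \<le> C" for z
    using opt[of z "- f z"] by (simp add: E_def C_def inner_diff_right)
  have "f h = inner z0 h" for h
  proof (rule ccontr)
    define d where "d = f h - inner z0 h"
    assume "f h \<noteq> inner z0 h"
    then have "d \<noteq> 0" by (simp add: d_def)
    \<comment> \<open>The multiple of h is chosen so that f - <z0, .> takes the value C + 1
      there.\<close>
    have "((C + 1) / d) * d \<le> C"
      using le[of "((C + 1) / d) *\<^sub>R h"] by (simp add: f.scaleR d_def right_diff_distrib)
    with \<open>d \<noteq> 0\<close> show False by simp
  qed
  then show ?thesis by blast
qed

text \<open>A diagonal subsequence makes the inner products with a countable dense set converge.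
  Boundedness extends this to every h, and the limit functional is bounded, so Riesz supplies the
  weak limit.\<close>

lemma bounded_weakly_convergent_subseq:
  fixes x :: "nat \<Rightarrow> 'a::{real_inner, complete_space, second_countable_topology}"
  assumes B: "\<And>n. norm (x n) \<le> B"
  obtains r l where "strict_mono r" "weakly_converges (x \<circ> r) l"
proof -
  obtain D :: "'a set" where D: "countable D" "\<And>X. open X \<Longrightarrow> X \<noteq> {} \<Longrightarrow> \<exists>d\<in>D. d \<in> X"
    by (rule countable_dense_setE) blast
  have "D \<noteq> {}" using D(2)[of UNIV] by auto
  define d where "d = from_nat_into D"
  have rd: "range d = D" unfolding d_def using D \<open>D \<noteq> {}\<close> by (simp add: range_from_nat_into)
  have B0: "0 \<le> B" using B[of 0] norm_ge_zero order_trans by blast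
  have ib: "\<bar>inner (x n) h\<bar> \<le> B * norm h" for n h
    using Cauchy_Schwarz_ineq2[of "x n" h] mult_right_mono[OF B norm_ge_zero[of h]] order_trans by blast
  interpret subseqs "\<lambda>n s. convergent (\<lambda>k. inner (x (s k)) (d n))"
  proof
    fix n and s :: "nat \<Rightarrow> nat"
    have "bounded (range (\<lambda>k. inner (x (s k)) (d n)))"
      using ib by (auto simp: bounded_iff)
    then obtain l r where "strict_mono r" "((\<lambda>k. inner (x (s k)) (d n)) \<circ> r) \<longlonglongrightarrow> l"
      using bounded_imp_convergent_subsequence by blast
    then show "\<exists>r. strict_mono r \<and> convergent (\<lambda>k. inner (x ((s \<circ> r) k)) (d n))"
      by (auto simp: convergent_def o_def)
  qed
  have sm: "strict_mono diagseq" by (rule subseq_diagseq)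
  have conv_d: "convergent (\<lambda>k. inner (x (diagseq k)) (d n))" for n
  proof -
    have "convergent (\<lambda>k. inner (x ((diagseq \<circ> (+) (Suc n)) k)) (d n))"
    proof (rule diagseq_holds)
      fix m and r s :: "nat \<Rightarrow> nat"
      assume "strict_mono r" "convergent (\<lambda>k. inner (x (s k)) (d m))"
      then show "convergent (\<lambda>k. inner (x ((s \<circ> r) k)) (d m))"
        using convergent_subseq_convergent[of "\<lambda>k. inner (x (s k)) (d m)" r] by (simp add: o_def)
    qed
    then show ?thesis
      using convergent_ignore_initial_segment[of "\<lambda>k. inner (x (diagseq k)) (d n)" "Suc n"]
      by (simp add: o_def add.commute)
  qed
  have conv: "convergent (\<lambda>k. inner (x (diagseq k)) h)" for h
  proof -
    have "Cauchy (\<lambda>k. inner (x (diagseq k)) h)"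
    proof (rule metric_CauchyI)
      fix e :: real assume e: "e > 0"
      \<comment> \<open>Chosen so that B \<delta> is at most e / 3; adding 1 to B keeps the quotient
        defined when B = 0.\<close>
      define \<delta> where "\<delta> = e / (3 * (B + 1))"
      have "\<delta> > 0" using e B0 by (simp add: \<delta>_def)
      then obtain n where n: "d n \<in> ball h \<delta>" using D(2)[of "ball h \<delta>"] rd by fastforce
      have "B * \<delta> \<le> e / 3" using e B0 by (simp add: \<delta>_def field_simps)
      then have close: "\<bar>inner (x j) (h - d n)\<bar> \<le> e / 3" for j
        using ib[of j "h - d n"] mult_left_mono[of "norm (h - d n)" \<delta> B] n B0
        by (simp add: dist_norm)
      obtain N where N: "\<forall>j\<ge>N. \<forall>k\<ge>N. dist (inner (x (diagseq j)) (d n)) (inner (x (diagseq k)) (d n)) < e / 3"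
        using convergent_Cauchy[OF conv_d[of n]] e unfolding Cauchy_def by (meson divide_pos_pos zero_less_numeral)
      have "dist (inner (x (diagseq j)) h) (inner (x (diagseq k)) h) < e" if "j \<ge> N" "k \<ge> N" for j k
      proof -
        have "\<bar>inner (x (diagseq j)) (d n) - inner (x (diagseq k)) (d n)\<bar> < e / 3"
          using N that by (simp add: dist_real_def)
        with close[of "diagseq j"] close[of "diagseq k"] show ?thesis
          unfolding dist_real_def inner_diff_right by argo
      qed
      then show "\<exists>N. \<forall>j\<ge>N. \<forall>k\<ge>N. dist (inner (x (diagseq j)) h) (inner (x (diagseq k)) h) < e" by blast
    qed
    then show ?thesis by (simp add: Cauchy_convergent)
  qed
  define f where "f h = lim (\<lambda>k. inner (x (diagseq k)) h)" for h
  have f: "(\<lambda>k. inner (x (diagseq k)) h) \<longlonglongrightarrow> f h" for h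
    using conv[of h] by (simp add: f_def convergent_LIMSEQ_iff)
  have "bounded_linear f"
  proof (rule bounded_linear_intro)
    show "f (a + b) = f a + f b" for a b
      using LIMSEQ_unique[OF f[of "a + b"]] tendsto_add[OF f[of a] f[of b]]
      by (simp add: inner_add_right)
    show "f (c *\<^sub>R a) = c *\<^sub>R f a" for a c
      using LIMSEQ_unique[OF f[of "c *\<^sub>R a"]] tendsto_mult[OF tendsto_const[of c] f[of a]]
      by simp
    show "norm (f a) \<le> norm a * B" for a
      using LIMSEQ_le_const2[OF tendsto_rabs[OF f[of a]]] ib[of _ a] by (auto simp: mult.commute)
  qed
  then obtain l where "\<And>h. f h = inner l h" using riesz_representation by blast
  with f have "weakly_converges (x \<circ> diagseq) l" by (simp add: weakly_converges_def)
  with sm show thesis by (rule that)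
qed

text \<open>Two weak cluster points coincide because the difference of the squared distances to them
  is affine in x k. A failure of weak convergence against some h would leave a bounded subsequence
  staying away from the limit, whose own weak cluster point contradicts this uniqueness.\<close>

lemma opial:
  fixes x :: "nat \<Rightarrow> 'a::{real_inner, complete_space, second_countable_topology}"
  assumes "S \<noteq> {}"
    and conv: "\<And>p. p \<in> S \<Longrightarrow> convergent (\<lambda>k. norm (x k - p))"
    and clus: "\<And>r l. strict_mono r \<Longrightarrow> weakly_converges (x \<circ> r) l \<Longrightarrow> l \<in> S"
  shows "\<exists>l\<in>S. weakly_converges x l"
proof -
  obtain p where p: "p \<in> S" using \<open>S \<noteq> {}\<close> by blast
  obtain C where C: "\<And>k. norm (norm (x k - p)) \<le> C"
    using convergent_imp_Bseq[OF conv[OF p]] by (auto simp: Bseq_def)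
  have B: "norm (x k) \<le> C + norm p" for k
    using C[of k] norm_triangle_ineq[of "x k - p" p] by simp
  obtain r l where r: "strict_mono r" "weakly_converges (x \<circ> r) l"
    by (rule bounded_weakly_convergent_subseq[OF B])
  have l: "l \<in> S" by (rule clus[OF r])
  have uniq: "l' = l" if s: "strict_mono s" "weakly_converges (x \<circ> s) l'" for s l'
  proof -
    have l': "l' \<in> S" by (rule clus[OF s])
    have "convergent (\<lambda>k. (norm (x k - l'))\<^sup>2 - (norm (x k - l))\<^sup>2)"
      unfolding power2_eq_square using l l' conv by (intro convergent_diff convergent_mult) auto
    moreover have "(\<lambda>k. (norm (x k - l'))\<^sup>2 - (norm (x k - l))\<^sup>2) =
        (\<lambda>k. 2 * inner (x k) (l - l') + (inner l' l' - inner l l))"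
      by (auto simp: power2_norm_eq_inner inner_diff_left inner_diff_right inner_commute algebra_simps)
    ultimately have "convergent (\<lambda>k. 2 * inner (x k) (l - l'))"
      by (simp add: convergent_add_const_right_iff)
    then obtain w where w: "(\<lambda>k. 2 * inner (x k) (l - l')) \<longlonglongrightarrow> w" by (auto simp: convergent_def)
    define v where "v = w / 2"
    have v: "(\<lambda>k. inner (x k) (l - l')) \<longlonglongrightarrow> v"
      using tendsto_divide[OF w tendsto_const[of 2]] by (simp add: v_def)
    have "v = inner l (l - l')"
      using LIMSEQ_unique[OF LIMSEQ_subseq_LIMSEQ[OF v r(1)]] r(2)
      by (auto simp: weakly_converges_def o_def)
    moreover have "v = inner l' (l - l')"
      using LIMSEQ_unique[OF LIMSEQ_subseq_LIMSEQ[OF v s(1)]] s(2)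
      by (auto simp: weakly_converges_def o_def)
    ultimately have "inner (l - l') (l - l') = 0" by (simp add: inner_diff_left)
    then show ?thesis by simp
  qed
  have "(\<lambda>k. inner (x k) h) \<longlonglongrightarrow> inner l h" for h
  proof (rule ccontr)
    assume "\<not> (\<lambda>k. inner (x k) h) \<longlonglongrightarrow> inner l h"
    then obtain e where e: "e > 0" "\<exists>\<^sub>\<infinity>k. \<not> dist (inner (x k) h) (inner l h) < e"
      unfolding tendsto_iff not_eventually[symmetric] cofinite_eq_sequentially[symmetric] by blast
    define A where "A = {k. \<not> dist (inner (x k) h) (inner l h) < e}"
    have "infinite A" using e(2) by (simp add: A_def frequently_cofinite)
    then obtain s :: "nat \<Rightarrow> nat" where s: "strict_mono s" "\<And>n. s n \<in> A"
      using infinite_enumerate[of A] by blast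
    have Bs: "norm ((x \<circ> s) k) \<le> C + norm p" for k using B by simp
    obtain r' l' where r': "strict_mono r'" "weakly_converges (x \<circ> s \<circ> r') l'"
      by (rule bounded_weakly_convergent_subseq[OF Bs])
    then have "l' = l" using uniq[of "s \<circ> r'" l'] s(1) by (simp add: strict_mono_o o_assoc)
    with r' have "(\<lambda>k. inner (x (s (r' k))) h) \<longlonglongrightarrow> inner l h"
      by (auto simp: weakly_converges_def o_def)
    with e(1) have "\<forall>\<^sub>F k in sequentially. dist (inner (x (s (r' k))) h) (inner l h) < e"
      by (rule tendstoD[rotated])
    moreover have "\<not> dist (inner (x (s (r' k))) h) (inner l h) < e" for k
      using s(2)[of "r' k"] by (simp add: A_def)
    ultimately show False by simp
  qed
  with l show ?thesis by (auto simp: weakly_converges_def)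
qed

section \<open>Zeros of the sum, demiclosedness, measurability of weak limits\<close>

lemma zeros_op_sum_iff:
  fixes V :: "'a::real_vector \<Rightarrow> 'a"
  shows "x \<in> zeros_op (sum_op T (single_op V)) \<longleftrightarrow> - V x \<in> T x"
proof
  assume "x \<in> zeros_op (sum_op T (single_op V))"
  then obtain u where u: "u \<in> T x" "0 = u + V x"
    unfolding zeros_op_def sum_op_def by blast
  then have "u = - V x" by (simp add: eq_neg_iff_add_eq_0)
  with u show "- V x \<in> T x" by simp
next
  assume "- V x \<in> T x"
  moreover have "0 = - V x + V x" by simp
  ultimately show "x \<in> zeros_op (sum_op T (single_op V))"
    unfolding zeros_op_def sum_op_def by blast
qed

text \<open>Maximality of \<open>T + V\<close>: test the hypothesis at the fixed point of the contraction
  \<open>a \<mapsto> resolvent c T (x - c *\<^sub>R V a)\<close> with \<open>c L < 1\<close>.\<close>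

lemma sum_lipschitz_maximal:
  fixes T :: "'a::{real_inner, complete_space} \<Rightarrow> 'a set"
  assumes T: "maximally_monotone T" and L: "L > 0" "L-lipschitz_on UNIV V"
    and rel: "\<And>a b. b \<in> T a \<Longrightarrow> 0 \<le> inner (x - a) (- V a - b)"
  shows "- V x \<in> T x"
proof -
  define c where "c = 1 / (2 * L)"
  have c: "c > 0" using L by (simp add: c_def)
  define G where "G a = resolvent c T (x - c *\<^sub>R V a)" for a
  have "dist (G a) (G b) \<le> (1 / 2) * dist a b" for a b
  proof -
    have "norm (V a - V b) \<le> L * norm (a - b)"
      using lipschitz_onD[OF L(2), of a b] by (simp add: dist_norm)
    then have "c * norm (V a - V b) \<le> c * (L * norm (a - b))"
      using c by (intro mult_left_mono) auto
    moreover have "c * (L * norm (a - b)) = (1 / 2) * norm (a - b)"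
      using L by (simp add: c_def)
    moreover have "norm ((x - c *\<^sub>R V a) - (x - c *\<^sub>R V b)) = c * norm (V a - V b)"
      using c by (simp add: norm_minus_commute flip: scaleR_diff_right)
    ultimately show ?thesis
      using resolvent_nonexpansive[OF T c, of "x - c *\<^sub>R V a" "x - c *\<^sub>R V b"]
      unfolding G_def dist_norm by argo
  qed
  then have "\<exists>!a. G a = a" by (intro banach_fix_type[of "1 / 2"]) auto
  then obtain a where a: "G a = a" by blast
  define b where "b = (1 / c) *\<^sub>R (x - c *\<^sub>R V a - a)"
  have b: "b \<in> T a" using resolvent_in[OF T c, of "x - c *\<^sub>R V a"] a by (simp add: G_def b_def)
  have "- V a - b = - (1 / c) *\<^sub>R (x - a)"
    using c by (simp add: b_def algebra_simps)
  with rel[OF b] have "0 \<le> - (1 / c) * (norm (x - a))\<^sup>2"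
    by (simp add: power2_norm_eq_inner)
  then have "(norm (x - a))\<^sup>2 \<le> 0"
    using c by (simp add: divide_le_0_iff)
  then have "x = a" by simp
  with b c show ?thesis by (simp add: b_def)
qed

text \<open>Minty's trick: monotonicity moves V from the moving point y k to the fixed test point a,
  so only a fixed vector is paired with the weakly convergent sequence. The other term is bounded
  times strongly null. No weak continuity of V is required.\<close>

lemma demiclosed_sum:
  fixes T :: "'a::{real_inner, complete_space} \<Rightarrow> 'a set"
  assumes T: "maximally_monotone T" and V: "maximally_monotone (single_op V)"
    and L: "L > 0" "L-lipschitz_on UNIV V"
    and u: "\<And>k. u k \<in> T (y k)" and lim: "(\<lambda>k. u k + V (y k)) \<longlonglongrightarrow> 0"
    and y: "weakly_converges y l" and B: "\<And>k. norm (y k) \<le> B"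
  shows "- V l \<in> T l"
proof (rule sum_lipschitz_maximal[OF T L])
  fix a b assume b: "b \<in> T a"
  have "0 \<le> inner (y k - a) (u k + V (y k)) + inner (y k - a) (- V a - b)" for k
  proof -
    have "0 \<le> inner (y k - a) (u k - b)" by (rule maximally_monotoneD(1)[OF T u b])
    moreover have "0 \<le> inner (y k - a) (V (y k) - V a)"
      by (rule maximally_monotoneD(1)[OF V]) auto
    ultimately show ?thesis by (simp add: inner_diff_right inner_add_right)
  qed
  moreover have "(\<lambda>k. inner (y k - a) (u k + V (y k)) + inner (y k - a) (- V a - b))
      \<longlonglongrightarrow> 0 + inner (l - a) (- V a - b)"
  proof (rule tendsto_add)
    show "(\<lambda>k. inner (y k - a) (u k + V (y k))) \<longlonglongrightarrow> 0"
    proof (rule Lim_null_comparison)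
      show "\<forall>\<^sub>F k in sequentially. norm (inner (y k - a) (u k + V (y k)))
          \<le> (B + norm a) * norm (u k + V (y k))"
      proof (intro always_eventually allI)
        fix k
        have "norm (y k - a) \<le> B + norm a"
          using B[of k] norm_triangle_ineq4[of "y k" a] by simp
        then have "norm (y k - a) * norm (u k + V (y k)) \<le> (B + norm a) * norm (u k + V (y k))"
          by (rule mult_right_mono) simp
        with Cauchy_Schwarz_ineq2[of "y k - a" "u k + V (y k)"]
        show "norm (inner (y k - a) (u k + V (y k))) \<le> (B + norm a) * norm (u k + V (y k))"
          by simp
      qed
      show "(\<lambda>k. (B + norm a) * norm (u k + V (y k))) \<longlonglongrightarrow> 0"
        using tendsto_mult[OF tendsto_const[of "B + norm a"] tendsto_norm[OF lim]] by simp
    qed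
    show "(\<lambda>k. inner (y k - a) (- V a - b)) \<longlonglongrightarrow> inner (l - a) (- V a - b)"
      unfolding inner_diff_left using y unfolding weakly_converges_def
      by (intro tendsto_diff tendsto_const) blast
  qed
  ultimately have "0 \<le> 0 + inner (l - a) (- V a - b)"
    by (intro LIMSEQ_le_const) auto
  then show "0 \<le> inner (l - a) (- V a - b)" by simp
qed

text \<open>Pettis' theorem in the separable case: closed balls are countable intersections of
  half-spaces given by a dense set, and open sets are countable unions of closed balls with dense
  centres and rational radii.\<close>

lemma borel_measurable_weakly:
  fixes f :: "'w \<Rightarrow> 'a::{real_inner, second_countable_topology}"
  assumes f: "\<And>h. (\<lambda>\<omega>. inner (f \<omega>) h) \<in> borel_measurable M"
  shows "f \<in> borel_measurable M"
proof (rule borel_measurableI)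
  obtain D :: "'a set" where D: "countable D" "\<And>X. open X \<Longrightarrow> X \<noteq> {} \<Longrightarrow> \<exists>d\<in>D. d \<in> X"
    by (rule countable_dense_setE) blast
  \<comment> \<open>The factor \<open>norm d\<close> on the right spares a dense subset of the unit
    sphere: the condition is closed in d and is then tested at d = v.\<close>
  have norm_le: "norm v \<le> r \<longleftrightarrow> (\<forall>d\<in>D. inner v d \<le> r * norm d)" if "0 \<le> r" for v :: 'a and r
  proof
    assume "norm v \<le> r"
    show "\<forall>d\<in>D. inner v d \<le> r * norm d"
    proof
      fix d
      show "inner v d \<le> r * norm d"
        using norm_cauchy_schwarz[of v d] mult_right_mono[OF \<open>norm v \<le> r\<close>, of "norm d"] by simp
    qed
  next
    assume *: "\<forall>d\<in>D. inner v d \<le> r * norm d"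
    have "v \<in> closure D"
      unfolding closure_iff_nhds_not_empty using D(2) by (metis IntI empty_iff inf.commute
          interior_subset open_interior subsetD)
    moreover have "closed {d. inner v d \<le> r * norm d}"
      by (intro closed_Collect_le continuous_intros)
    ultimately have "inner v v \<le> r * norm v"
      using * closure_minimal[of D "{d. inner v d \<le> r * norm d}"] by auto
    then have "norm v * norm v \<le> r * norm v"
      by (simp add: power2_eq_square flip: power2_norm_eq_inner)
    then show "norm v \<le> r"
      using that by (cases "v = 0") auto
  qed
  have ball: "{\<omega> \<in> space M. norm (f \<omega> - c) \<le> r} \<in> sets M" if "0 \<le> r" for c r
  proof -
    have "D \<noteq> {}" using D(2)[of UNIV] by auto
    define e where "e = from_nat_into D"
    have e: "range e = D" unfolding e_def by (rule range_from_nat_into) fact+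
    have [measurable]: "(\<lambda>\<omega>. inner (f \<omega>) d) \<in> borel_measurable M" for d by (rule f)
    have "{\<omega> \<in> space M. \<forall>n. inner (f \<omega>) (e n) - inner c (e n) \<le> r * norm (e n)} \<in> sets M"
      by measurable
    then show ?thesis by (simp add: norm_le[OF that] inner_diff_left flip: e)
  qed
  fix U :: "'a set" assume U: "open U"
  define J where "J = {(c, q). c \<in> D \<and> q \<in> \<rat> \<and> 0 \<le> q \<and> cball c q \<subseteq> U}"
  have "f -` U \<inter> space M = (\<Union>(c, q)\<in>J. {\<omega> \<in> space M. norm (f \<omega> - c) \<le> q})"
  proof (intro equalityI subsetI)
    fix \<omega> assume \<omega>: "\<omega> \<in> f -` U \<inter> space M"
    then obtain e where e: "e > 0" "ball (f \<omega>) e \<subseteq> U"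
      using U by (auto simp: open_contains_ball)
    \<comment> \<open>A radius above e / 3 reaches \<open>f \<omega>\<close> from the centre c, and
      e / 3 + e / 2 < e keeps the ball inside U.\<close>
    obtain q where q: "q \<in> \<rat>" "e / 3 < q" "q < e / 2" using Rats_dense_in_real[of "e / 3" "e / 2"] e by auto
    obtain c where c: "c \<in> D" "c \<in> ball (f \<omega>) (e / 3)"
      using D(2)[of "ball (f \<omega>) (e / 3)"] e by auto
    have "cball c q \<subseteq> ball (f \<omega>) e"
    proof
      fix y assume "y \<in> cball c q"
      then show "y \<in> ball (f \<omega>) e"
        using c q dist_triangle[of "f \<omega>" y c] e by simp
    qed
    then have "(c, q) \<in> J" using c q e by (auto simp: J_def)
    moreover have "norm (f \<omega> - c) \<le> q" using c q by (simp add: dist_norm)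
    ultimately show "\<omega> \<in> (\<Union>(c, q)\<in>J. {\<omega> \<in> space M. norm (f \<omega> - c) \<le> q})"
      using \<omega> by blast
  qed (auto simp: J_def dist_norm norm_minus_commute)
  moreover have "countable J"
  proof (rule countable_subset)
    show "J \<subseteq> D \<times> \<rat>" by (auto simp: J_def)
    show "countable (D \<times> (\<rat> :: real set))" using D(1) by (intro countable_SIGMA countable_rat)
  qed
  ultimately show "f -` U \<inter> space M \<in> sets M"
    using ball by (auto simp: J_def intro!: sets.countable_UN')
qed

section \<open>One step of the relaxed inertial forward-backward-forward iteration\<close>

lemma norm_add_sq: "(norm (a + b))\<^sup>2 = (norm a)\<^sup>2 + 2 * inner a b + (norm (b::'a::real_inner))\<^sup>2"
  by (simp add: power2_norm_eq_inner inner_add_left inner_add_right inner_commute)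

lemma norm_convex_combination_sq:
  fixes a b :: "'a::real_inner"
  shows "(norm ((1 - t) *\<^sub>R a + t *\<^sub>R b))\<^sup>2 =
    (1 - t) * (norm a)\<^sup>2 + t * (norm b)\<^sup>2 - t * (1 - t) * (norm (b - a))\<^sup>2"
  by (simp add: power2_norm_eq_inner inner_add_left inner_add_right inner_diff_left inner_diff_right
      inner_commute algebra_simps)

lemma inertial_norm_sq:
  fixes x x' p :: "'a::real_inner"
  shows "(norm (x + \<alpha> *\<^sub>R (x - x') - p))\<^sup>2 =
    (1 + \<alpha>) * (norm (x - p))\<^sup>2 - \<alpha> * (norm (x' - p))\<^sup>2 + \<alpha> * (1 + \<alpha>) * (norm (x - x'))\<^sup>2"
  by (simp add: power2_norm_eq_inner inner_add_left inner_add_right inner_diff_left inner_diff_right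
      inner_commute algebra_simps)

text \<open>Young's inequality on the cross term with equal weights. It trades the distance to the
  extrapolated point, which the one-step estimate produces, for distances between consecutive
  iterates, on which the Lyapunov function is built.\<close>

lemma inertial_step_lower:
  fixes x x' y :: "'a::real_inner"
  assumes "0 \<le> \<alpha>"
  shows "(1 - \<alpha>) * (norm (y - x))\<^sup>2 - \<alpha> * (1 - \<alpha>) * (norm (x - x'))\<^sup>2
    \<le> (norm (y - (x + \<alpha> *\<^sub>R (x - x'))))\<^sup>2"
proof -
  define a b where "a = y - x" and "b = x - x'"
  have "0 \<le> \<alpha> * (norm (a - b))\<^sup>2" using assms by simp
  also have "(norm (a - b))\<^sup>2 = (norm a)\<^sup>2 - 2 * inner a b + (norm b)\<^sup>2"
    using norm_add_sq[of a "- b"] by simp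
  finally have "(1 - \<alpha>) * (norm a)\<^sup>2 - \<alpha> * (1 - \<alpha>) * (norm b)\<^sup>2
      \<le> (norm a)\<^sup>2 - 2 * \<alpha> * inner a b + \<alpha>\<^sup>2 * (norm b)\<^sup>2"
    by (simp add: algebra_simps power2_eq_square)
  also have "\<dots> = (norm (a + (- \<alpha>) *\<^sub>R b))\<^sup>2"
    by (simp only: norm_add_sq) (simp add: power_mult_distrib)
  also have "a + (- \<alpha>) *\<^sub>R b = y - (x + \<alpha> *\<^sub>R (x - x'))"
    by (simp add: a_def b_def)
  finally show ?thesis by (simp add: a_def b_def)
qed

text \<open>For exact evaluations the estimate holds with 8 in place of 5; the slack pays for the term in
  \<open>z - y\<close> and for the evaluation errors \<open>A - V z\<close> and \<open>B - V y\<close>.\<close>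

lemma fbf_step:
  fixes T :: "'a::{real_inner, complete_space} \<Rightarrow> 'a set"
  assumes T: "maximally_monotone T" and V: "maximally_monotone (single_op V)"
    and L: "L-lipschitz_on UNIV V" and lam: "0 < lam" "4 * (L * lam) < 1" "0 \<le> L" and \<rho>: "0 < \<rho>"
    and p: "- V p \<in> T p"
    and y: "y = resolvent lam T (z - lam *\<^sub>R A)"
    and x: "x = (1 - \<rho>) *\<^sub>R z + \<rho> *\<^sub>R (y + lam *\<^sub>R (A - B))"
  shows "(norm (x - p))\<^sup>2 \<le> (norm (z - p))\<^sup>2
    - (5 / (4 * \<rho> * (1 + L * lam)) - 1) * (norm (x - z))\<^sup>2
    - 3 / 32 * \<rho> * (norm (z - y))\<^sup>2
    + 5 / 2 * \<rho> * lam\<^sup>2 * (norm ((A - V z) - (B - V y)))\<^sup>2 - 2 * \<rho> * lam * inner (B - V y) (y - p)"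
proof -
  define r where "r = y + lam *\<^sub>R (A - B)"
  define q where "q = norm (z - y)"
  define w where "w = lam * norm ((A - V z) - (B - V y))"
  define \<theta> where "\<theta> = 5 / (4 * (1 + L * lam))"
  define s where "s = L * lam"
  have s: "0 \<le> s" "4 * s < 1" using lam by (auto simp: s_def)
  have \<theta>: "1 < \<theta>" "\<theta> \<le> 5 / 4" using s by (auto simp: \<theta>_def field_simps simp flip: s_def)
  have q0: "0 \<le> q" by (simp add: q_def)
  have yT: "(1 / lam) *\<^sub>R (z - lam *\<^sub>R A - y) \<in> T y"
    unfolding y by (rule resolvent_in[OF T lam(1)])
  have "0 \<le> inner (y - p) ((1 / lam) *\<^sub>R (z - lam *\<^sub>R A - y) - (- V p))"
    by (rule maximally_monotoneD(1)[OF T yT p])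
  then have "0 \<le> lam * inner (y - p) ((1 / lam) *\<^sub>R (z - lam *\<^sub>R A - y) - (- V p))"
    using lam by simp
  also have "\<dots> = inner (y - p) (lam *\<^sub>R ((1 / lam) *\<^sub>R (z - lam *\<^sub>R A - y) - (- V p)))"
    by simp
  \<comment> \<open>Here the correction pays off: expressed with \<open>r\<close>, the inequality
    keeps \<open>B\<close> and loses \<open>A\<close>.\<close>
  also have "lam *\<^sub>R ((1 / lam) *\<^sub>R (z - lam *\<^sub>R A - y) - (- V p)) = (z - r) - lam *\<^sub>R (B - V p)"
    using lam by (simp add: r_def algebra_simps)
  finally have m1: "lam * inner (y - p) (B - V p) \<le> inner (y - p) (z - r)"
    by (simp add: inner_diff_right)
  have "0 \<le> inner (y - p) (V y - V p)"
    by (rule maximally_monotoneD(1)[OF V]) auto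
  then have "0 \<le> lam * inner (y - p) (V y - V p)" using lam by simp
  moreover have "inner (y - p) (B - V p) = inner (B - V y) (y - p) + inner (y - p) (V y - V p)"
    by (simp add: inner_diff_left inner_diff_right inner_commute)
  then have "lam * inner (y - p) (B - V p) =
      lam * inner (B - V y) (y - p) + lam * inner (y - p) (V y - V p)"
    by (simp only: distrib_left)
  ultimately have m: "lam * inner (B - V y) (y - p) \<le> inner (y - p) (z - r)"
    using m1 by linarith
  have "(norm (z - p))\<^sup>2 = (norm (z - y))\<^sup>2 + 2 * inner (z - y) (y - p) + (norm (y - p))\<^sup>2"
    using norm_add_sq[of "z - y" "y - p"] by simp
  moreover have "(norm (r - p))\<^sup>2 = (norm (r - y))\<^sup>2 + 2 * inner (r - y) (y - p) + (norm (y - p))\<^sup>2"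
    using norm_add_sq[of "r - y" "y - p"] by simp
  moreover have "inner (y - p) (z - r) = inner (z - y) (y - p) - inner (r - y) (y - p)"
    by (simp add: inner_diff_left inner_diff_right inner_commute)
  ultimately have rp: "(norm (r - p))\<^sup>2 \<le> (norm (z - p))\<^sup>2 - q\<^sup>2 + (norm (r - y))\<^sup>2
      - 2 * (lam * inner (B - V y) (y - p))"
    using m unfolding q_def by argo
  have "norm (r - y) = lam * norm ((V z - V y) + ((A - V z) - (B - V y)))"
    using lam by (simp add: r_def)
  also have "\<dots> \<le> lam * (norm (V z - V y) + norm ((A - V z) - (B - V y)))"
    using lam by (intro mult_left_mono norm_triangle_ineq) auto
  also have "\<dots> \<le> lam * (L * q + norm ((A - V z) - (B - V y)))"
    using lam lipschitz_onD[OF L, of z y]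
    by (intro mult_left_mono add_right_mono) (auto simp: dist_norm q_def)
  also have "\<dots> = s * q + w" by (simp add: s_def w_def algebra_simps)
  also have "\<dots> \<le> q / 4 + w" using mult_right_mono[of s "1 / 4" q] s q0 by simp
  finally have ry: "norm (r - y) \<le> q / 4 + w" .
  have "norm (r - z) \<le> norm (r - y) + q"
    using norm_triangle_ineq[of "r - y" "y - z"] by (simp add: q_def norm_minus_commute)
  with ry have rz: "norm (r - z) \<le> 5 / 4 * q + w" by argo
  have sq: "(u + v)\<^sup>2 \<le> 2 * u\<^sup>2 + 2 * v\<^sup>2" for u v :: real
    using zero_le_power2[of "u - v"] by (simp add: power2_sum power2_diff)
  have ry2: "(norm (r - y))\<^sup>2 \<le> q\<^sup>2 / 8 + 2 * w\<^sup>2"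
    using power_mono[OF ry norm_ge_zero, of 2] sq[of "q / 4" w] by (simp add: power_divide)
  have "(norm (r - z))\<^sup>2 \<le> 25 / 8 * q\<^sup>2 + 2 * w\<^sup>2"
    using power_mono[OF rz norm_ge_zero, of 2] sq[of "5 / 4 * q" w] by (simp add: power_mult_distrib power_divide)
  moreover have "(\<theta> - 1) * (norm (r - z))\<^sup>2 \<le> 1 / 4 * (norm (r - z))\<^sup>2"
    using \<theta> by (intro mult_right_mono) auto
  \<comment> \<open>With \<theta> - 1 at most 1/4, the coefficient of q^2 is 1/8 + 25/32 = 1 - 3/32
    and that of w^2 is 2 + 1/2 = 5/2.\<close>
  ultimately have "(norm (r - y))\<^sup>2 + (\<theta> - 1) * (norm (r - z))\<^sup>2 \<le> q\<^sup>2 - 3 / 32 * q\<^sup>2 + 5 / 2 * w\<^sup>2"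
    using ry2 by argo
  with rp have "(norm (r - p))\<^sup>2 + (\<theta> - 1) * (norm (r - z))\<^sup>2 \<le>
      (norm (z - p))\<^sup>2 - 3 / 32 * q\<^sup>2 + 5 / 2 * w\<^sup>2 - 2 * (lam * inner (B - V y) (y - p))"
    by argo
  from mult_left_mono[OF this, of \<rho>] \<rho>
  have main: "\<rho> * (norm (r - p))\<^sup>2 + \<rho> * ((\<theta> - 1) * (norm (r - z))\<^sup>2) \<le>
      \<rho> * ((norm (z - p))\<^sup>2 - 3 / 32 * q\<^sup>2 + 5 / 2 * w\<^sup>2 - 2 * (lam * inner (B - V y) (y - p)))"
    by (simp add: distrib_left)
  \<comment> \<open>Relaxation is an affine combination. The norm formula is an identity, so \<rho>
    > 1 is admissible as well.\<close>
  have "x - p = (1 - \<rho>) *\<^sub>R (z - p) + \<rho> *\<^sub>R (r - p)"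
    by (simp add: x r_def algebra_simps)
  then have xp: "(norm (x - p))\<^sup>2 = (1 - \<rho>) * (norm (z - p))\<^sup>2 + \<rho> * (norm (r - p))\<^sup>2
      - \<rho> * (1 - \<rho>) * (norm (r - z))\<^sup>2"
    using norm_convex_combination_sq[of \<rho> "z - p" "r - p"] by simp
  have "x - z = \<rho> *\<^sub>R (r - z)" by (simp add: x r_def algebra_simps)
  then have "(norm (x - z))\<^sup>2 = \<rho>\<^sup>2 * (norm (r - z))\<^sup>2" by (simp add: power_mult_distrib)
  then have "(\<theta> / \<rho> - 1) * (norm (x - z))\<^sup>2 = \<rho> * (\<theta> - \<rho>) * (norm (r - z))\<^sup>2"
    using \<rho> by (simp add: power2_eq_square field_simps)
  moreover have "\<theta> / \<rho> = 5 / (4 * \<rho> * (1 + L * lam))" by (simp add: \<theta>_def)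
  ultimately have xz: "(5 / (4 * \<rho> * (1 + L * lam)) - 1) * (norm (x - z))\<^sup>2 = \<rho> * (\<theta> - \<rho>) * (norm (r - z))\<^sup>2"
    by simp
  have w2: "w\<^sup>2 = lam\<^sup>2 * (norm ((A - V z) - (B - V y)))\<^sup>2" by (simp add: w_def power_mult_distrib)
  have alg: "(1 - \<rho>) * Zp + \<rho> * Rp - \<rho> * (1 - \<rho>) * Rz \<le>
      Zp - \<rho> * (\<theta> - \<rho>) * Rz - 3 / 32 * \<rho> * Q + 5 / 2 * \<rho> * W - 2 * \<rho> * lam * u"
    if "\<rho> * Rp + \<rho> * ((\<theta> - 1) * Rz) \<le> \<rho> * (Zp - 3 / 32 * Q + 5 / 2 * W - 2 * (lam * u))"
    for Rp Rz Zp Q W u :: real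
    using that by (simp add: algebra_simps)
  show ?thesis
    using alg[OF main] unfolding xp xz w2 q_def by (simp only: mult.assoc)
qed

section \<open>Almost decreasing sequences and inertial Lyapunov functions\<close>

text \<open>Subtracting the partial sums of \<open>e\<close> leaves a decreasing sequence bounded
  below. The perturbation may have either sign and its series need only converge, not absolutely;
  this is what lets the martingale differences in.\<close>

lemma almost_decreasing_convergent:
  fixes h r e :: "nat \<Rightarrow> real"
  assumes step: "\<And>n. h (Suc n) \<le> h n - r n + e n"
    and h: "\<And>n. 0 \<le> h n" and r: "\<And>n. 0 \<le> r n" and e: "summable e"
  shows "convergent h" "summable r"
proof -
  define E where "E n = (\<Sum>i<n. e i)" for n
  have "convergent E" using e by (simp add: E_def[abs_def] summable_iff_convergent)
  then obtain B where B: "\<And>n. \<bar>E n\<bar> \<le> B"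
    using convergent_imp_Bseq[OF \<open>convergent E\<close>] by (auto simp: Bseq_def)
  have "h n - E n \<le> h 0 - (\<Sum>i<n. r i)" for n
  proof (induction n)
    case (Suc n)
    with step[of n] show ?case by (simp add: E_def)
  qed (simp add: E_def)
  note sum_le = this
  have "(\<Sum>i<n. r i) \<le> h 0 + B" for n
    using sum_le[of n] h[of n] B[of n] by linarith
  then show "summable r"
    using r by (intro summableI_nonneg_bounded)
  have "decseq (\<lambda>n. h n - E n)"
  proof (rule decseq_SucI)
    show "h (Suc n) - E (Suc n) \<le> h n - E n" for n
      using step[of n] r[of n] by (simp add: E_def)
  qed
  moreover have "- B \<le> h n - E n" for n using h[of n] B[of n] by linarith
  ultimately obtain l where "(\<lambda>n. h n - E n) \<longlonglongrightarrow> l"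
    using decseq_convergent by blast
  then have "convergent (\<lambda>n. (h n - E n) + E n)"
    using \<open>convergent E\<close> by (intro convergent_add) (auto simp: convergent_def)
  then show "convergent h" by simp
qed

text \<open>As consecutive differences vanish, the two distances in the Lyapunov function become
  interchangeable, so it behaves like (1 - \<alpha> n) |x n - p|^2. Division by 1 - \<alpha> n,
  whose limit is positive, isolates the distance. A bound on the distances is needed first, to
  control the difference of their squares.\<close>

lemma inertial_lyapunov_convergent:
  fixes x :: "nat \<Rightarrow> 'a::real_inner"
  assumes d: "(\<lambda>n. norm (x (Suc n) - x n)) \<longlonglongrightarrow> 0"
    and \<alpha>: "\<alpha> \<longlonglongrightarrow> a" "a < 1" and K: "\<And>n. 0 \<le> \<kappa> n" "\<And>n. \<kappa> n \<le> K"
    and low: "\<And>n. c * (norm (x (Suc n) - p))\<^sup>2 \<le> (norm (x (Suc n) - p))\<^sup>2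
      - \<alpha> n * (norm (x n - p))\<^sup>2 + \<kappa> n * (norm (x (Suc n) - x n))\<^sup>2" "0 < c"
    and conv: "convergent (\<lambda>n. (norm (x (Suc n) - p))\<^sup>2 - \<alpha> n * (norm (x n - p))\<^sup>2
      + \<kappa> n * (norm (x (Suc n) - x n))\<^sup>2)"
  shows "convergent (\<lambda>n. norm (x n - p))"
proof -
  define \<phi> where "\<phi> n = norm (x n - p)" for n
  define \<Delta> where "\<Delta> n = norm (x (Suc n) - x n)" for n
  define h where "h n = (\<phi> (Suc n))\<^sup>2 - \<alpha> n * (\<phi> n)\<^sup>2 + \<kappa> n * (\<Delta> n)\<^sup>2" for n
  have conv_h: "convergent h" using conv by (simp add: h_def[abs_def] \<phi>_def \<Delta>_def)
  then obtain H where H: "\<And>n. \<bar>h n\<bar> \<le> H"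
    using convergent_imp_Bseq[OF conv_h] by (auto simp: Bseq_def)
  \<comment> \<open>\<open>low\<close> bounds the squared distances from index 1 on by H / c, and t
    \<le> t^2 + 1 avoids a root; index 0 is not covered by \<open>low\<close> and enters through the
    maximum.\<close>
  define C where "C = max (H / c + 1) (\<phi> 0)"
  have \<phi>0: "0 \<le> \<phi> n" for n by (simp add: \<phi>_def)
  have \<phi>C: "\<phi> n \<le> C" for n
  proof (cases n)
    case (Suc m)
    have "c * (\<phi> (Suc m))\<^sup>2 \<le> h m" using low(1)[of m] by (simp add: h_def \<phi>_def \<Delta>_def)
    also have "\<dots> \<le> H" using H[of m] by simp
    finally have "(\<phi> n)\<^sup>2 \<le> H / c" using low(2) by (simp add: Suc field_simps)
    moreover have "\<phi> n \<le> (\<phi> n)\<^sup>2 + 1"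
      using zero_le_power2[of "\<phi> n - 1"] \<phi>0[of n] by (simp add: power2_diff)
    ultimately show ?thesis by (simp add: C_def)
  qed (simp add: C_def)
  have diff_le: "norm ((\<phi> (Suc n))\<^sup>2 - (\<phi> n)\<^sup>2) \<le> 2 * C * \<Delta> n" for n
  proof -
    have "\<bar>\<phi> (Suc n) - \<phi> n\<bar> \<le> \<Delta> n"
      using norm_triangle_ineq3[of "x (Suc n) - p" "x n - p"] by (simp add: \<phi>_def \<Delta>_def)
    moreover have "\<bar>\<phi> (Suc n) + \<phi> n\<bar> \<le> 2 * C" using \<phi>C[of n] \<phi>C[of "Suc n"] \<phi>0[of n] \<phi>0[of "Suc n"] by simp
    ultimately have "\<bar>\<phi> (Suc n) + \<phi> n\<bar> * \<bar>\<phi> (Suc n) - \<phi> n\<bar> \<le> 2 * C * \<Delta> n"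
      by (intro mult_mono) auto
    also have "\<bar>\<phi> (Suc n) + \<phi> n\<bar> * \<bar>\<phi> (Suc n) - \<phi> n\<bar> = \<bar>(\<phi> (Suc n))\<^sup>2 - (\<phi> n)\<^sup>2\<bar>"
      by (simp add: power2_eq_square square_diff_square_factored flip: abs_mult)
    finally show ?thesis by simp
  qed
  have "(\<lambda>n. 2 * C * \<Delta> n) \<longlonglongrightarrow> 0"
    using tendsto_mult[OF tendsto_const[of "2 * C"] d] by (simp add: \<Delta>_def)
  then have diff: "(\<lambda>n. (\<phi> (Suc n))\<^sup>2 - (\<phi> n)\<^sup>2) \<longlonglongrightarrow> 0"
    by (rule Lim_null_comparison[OF always_eventually[OF allI[OF diff_le]]])
  have "(\<lambda>n. \<kappa> n * (\<Delta> n)\<^sup>2) \<longlonglongrightarrow> 0"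
  proof (rule Lim_null_comparison)
    show "\<forall>\<^sub>F n in sequentially. norm (\<kappa> n * (\<Delta> n)\<^sup>2) \<le> K * (\<Delta> n)\<^sup>2"
      using K by (intro always_eventually allI) (auto simp: abs_mult intro!: mult_right_mono)
    show "(\<lambda>n. K * (\<Delta> n)\<^sup>2) \<longlonglongrightarrow> 0"
      using tendsto_mult[OF tendsto_const[of K] tendsto_power[OF d, of 2]] by (simp add: \<Delta>_def)
  qed
  moreover obtain l where "h \<longlonglongrightarrow> l" using conv_h by (auto simp: convergent_def)
  ultimately have "(\<lambda>n. h n - \<kappa> n * (\<Delta> n)\<^sup>2 - ((\<phi> (Suc n))\<^sup>2 - (\<phi> n)\<^sup>2)) \<longlonglongrightarrow> l - 0 - 0"
    using diff by (intro tendsto_diff)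
  then have "(\<lambda>n. (1 - \<alpha> n) * (\<phi> n)\<^sup>2) \<longlonglongrightarrow> l"
    by (simp add: h_def algebra_simps)
  then have "(\<lambda>n. (1 - \<alpha> n) * (\<phi> n)\<^sup>2 / (1 - \<alpha> n)) \<longlonglongrightarrow> l / (1 - a)"
    using \<alpha> by (intro tendsto_intros) auto
  moreover have "\<forall>\<^sub>F n in sequentially. (1 - \<alpha> n) * (\<phi> n)\<^sup>2 / (1 - \<alpha> n) = (\<phi> n)\<^sup>2"
    using order_tendstoD(2)[OF \<alpha>] by eventually_elim simp
  ultimately have "(\<lambda>n. (\<phi> n)\<^sup>2) \<longlonglongrightarrow> l / (1 - a)"
    by (rule Lim_transform_eventually)
  then have "(\<lambda>n. sqrt ((\<phi> n)\<^sup>2)) \<longlonglongrightarrow> sqrt (l / (1 - a))"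
    by (rule tendsto_real_sqrt)
  then have "\<phi> \<longlonglongrightarrow> sqrt (l / (1 - a))" using \<phi>0 by simp
  then show ?thesis by (auto simp: convergent_def \<phi>_def[abs_def])
qed

section \<open>Inequalities between the inertia and relaxation parameters\<close>

text \<open>Since (1 - a) + 2 a^2 = 2 a^2 - a + 1, the right side factors as (2 a^2 - a + 1) ((1 -
  a)^2 / c - 1); this explains the quadratic in the choice of the relaxation. Its minimum, attained
  at a = 1/4, is 7/8.\<close>

lemma inertia_coeff_lower:
  fixes a c e :: real
  assumes "0 < c" "c \<le> (1 - e) * (1 - a)\<^sup>2" "0 < e" "e < 1"
  shows "7 / 8 * (e / (1 - e)) \<le> (1 - a) * ((1 - a) * ((2 * a\<^sup>2 - a + 1) / c) - 1) - 2 * a\<^sup>2"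
proof -
  have g: "7 / 8 \<le> 2 * a\<^sup>2 - a + 1"
    using zero_le_power2[of "a - 1 / 4"] by (simp add: power2_diff power2_eq_square algebra_simps)
  have "1 / (1 - e) \<le> (1 - a)\<^sup>2 / c"
    using assms by (simp add: field_simps)
  moreover have "1 / (1 - e) - 1 = e / (1 - e)" using assms by (simp add: field_simps)
  ultimately have "e / (1 - e) \<le> (1 - a)\<^sup>2 / c - 1" by linarith
  then have "7 / 8 * (e / (1 - e)) \<le> (2 * a\<^sup>2 - a + 1) * ((1 - a)\<^sup>2 / c - 1)"
    using g assms by (intro mult_mono) auto
  also have "\<dots> = (1 - a) * ((1 - a) * ((2 * a\<^sup>2 - a + 1) / c) - 1) - 2 * a\<^sup>2"
    using assms by (simp add: field_simps power2_eq_square)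
  finally show ?thesis .
qed

lemma inertia_coeff_ge_one:
  fixes a c :: real
  assumes "0 < c" "c \<le> (1 - a)\<^sup>2" "0 \<le> a"
  shows "1 \<le> (2 * a\<^sup>2 - a + 1) / c"
proof -
  have "(1 - a)\<^sup>2 \<le> 2 * a\<^sup>2 - a + 1" using assms by (simp add: power2_diff)
  then show ?thesis using assms by simp
qed

text \<open>After multiplication by c, the claim compares (a' - a) c with the decrease of the cubic
  (1 - a) (2 a^2 - a + 1) from a to a'. It allows the Lyapunov coefficient to be replaced by the
  next one although the inertia grows.\<close>

lemma inertia_coeff_antimono:
  fixes a a' c :: real
  assumes "0 < c" "c \<le> (1 - a')\<^sup>2" "0 \<le> a" "a \<le> a'" "a' \<le> 1"
  shows "(1 - a') * ((2 * a'\<^sup>2 - a' + 1) / c - 1) \<le> (1 - a) * ((2 * a\<^sup>2 - a + 1) / c - 1)"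
proof -
  define d where "d = a' - a"
  have d: "0 \<le> d" using assms by (simp add: d_def)
  \<comment> \<open>The difference quotient of the cubic minus (1 - a')^2, written with a' = a + d.
    For a up to 1/2, completing the square in d leaves (1/2 - a) (3/2 - a); for larger a every
    summand is nonnegative.\<close>
  have nn: "0 \<le> 5 * a\<^sup>2 - 4 * a + 1 + d * (4 * a - 1) + d\<^sup>2"
  proof (cases "a \<le> 1 / 2")
    case True
    then have "0 \<le> (1 / 2 - a) * (3 / 2 - a)" by simp
    moreover have "0 \<le> (d + (4 * a - 1) / 2)\<^sup>2" by simp
    ultimately show ?thesis by (simp add: power2_eq_square field_simps)
  next
    case False
    then have "0 \<le> d * (4 * a - 1)" using d by simp
    moreover have "0 \<le> 5 * (a - 2 / 5)\<^sup>2" by simp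
    then have "0 \<le> 5 * a\<^sup>2 - 4 * a + 1" by (simp add: power2_eq_square field_simps)
    ultimately show ?thesis by simp
  qed
  have "c \<le> 2 * (a'\<^sup>2 + a * a' + a\<^sup>2) - 3 * (a + a') + 2"
    using assms(2) nn by (simp add: d_def power2_eq_square algebra_simps)
  then have "d * c \<le> d * (2 * (a'\<^sup>2 + a * a' + a\<^sup>2) - 3 * (a + a') + 2)"
    using d by (rule mult_left_mono)
  then have "(1 - a') * (2 * a'\<^sup>2 - a' + 1) - (1 - a') * c \<le> (1 - a) * (2 * a\<^sup>2 - a + 1) - (1 - a) * c"
    by (simp add: d_def power2_eq_square algebra_simps)
  then have "((1 - a') * (2 * a'\<^sup>2 - a' + 1) - (1 - a') * c) / c \<le> ((1 - a) * (2 * a\<^sup>2 - a + 1) - (1 - a) * c) / c"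
    using assms by (simp add: divide_right_mono)
  then show ?thesis using assms by (simp add: diff_divide_distrib right_diff_distrib)
qed

text \<open>The negative term is bounded through the triangle inequality by X + D. What remains is a
  quadratic form in X and D, and the condition on \<open>A\<close> lets it dominate a perfect
  square.\<close>

lemma lyapunov_lower:
  fixes x x' p :: "'a::real_inner"
  assumes a: "0 \<le> a" "a < 1" and A: "a * (1 + a) \<le> (1 - a) * A"
  shows "(1 - a) / 2 * (norm (x - p))\<^sup>2 \<le>
    (norm (x - p))\<^sup>2 - a * (norm (x' - p))\<^sup>2 + A * (norm (x - x'))\<^sup>2"
proof -
  define X D where "X = norm (x - p)" and "D = norm (x - x')"
  have "norm (x' - p) \<le> X + D"
    using norm_triangle_ineq[of "x - p" "x' - x"] by (simp add: X_def D_def norm_minus_commute)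
  then have "(norm (x' - p))\<^sup>2 \<le> (X + D)\<^sup>2" by (rule power_mono) simp
  from mult_left_mono[OF this a(1)] have 1: "a * (norm (x' - p))\<^sup>2 \<le> a * (X + D)\<^sup>2" .
  \<comment> \<open>The square arises on multiplying the desired inequality by 1 - a with
    \<open>A\<close> at its smallest admissible value.\<close>
  have "0 \<le> 1 / 2 * ((1 - a) * X - 2 * a * D)\<^sup>2" by simp
  also have "\<dots> = (1 - a) * (X\<^sup>2 - a * (X + D)\<^sup>2 - (1 - a) / 2 * X\<^sup>2) + a * (1 + a) * D\<^sup>2"
    by (simp add: power2_eq_square field_simps)
  also have "\<dots> \<le> (1 - a) * (X\<^sup>2 - a * (X + D)\<^sup>2 - (1 - a) / 2 * X\<^sup>2) + (1 - a) * A * D\<^sup>2"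
    using A by (intro add_left_mono mult_right_mono) auto
  also have "\<dots> = (1 - a) * (X\<^sup>2 - a * (X + D)\<^sup>2 - (1 - a) / 2 * X\<^sup>2 + A * D\<^sup>2)"
    by (simp add: algebra_simps)
  finally have "0 \<le> X\<^sup>2 - a * (X + D)\<^sup>2 - (1 - a) / 2 * X\<^sup>2 + A * D\<^sup>2"
    using a by (simp add: zero_le_mult_iff)
  with 1 show ?thesis unfolding X_def[symmetric] D_def[symmetric] by linarith
qed

text \<open>\<open>a'\<close> and \<open>c'\<close> stand for the parameters of the next iteration;
  their monotonicity lets the left side be the same Lyapunov function one index later.\<close>

lemma risfbf_lyapunov_step:
  fixes T :: "'a::{real_inner, complete_space} \<Rightarrow> 'a set"
  assumes T: "maximally_monotone T" and V: "maximally_monotone (single_op V)"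
    and L: "L-lipschitz_on UNIV V" and lam: "0 < lam" "4 * (L * lam) < 1" "0 \<le> L" and \<rho>: "0 < \<rho>"
    and p: "- V p \<in> T p"
    and z: "z = x + a *\<^sub>R (x - x0)"
    and y: "y = resolvent lam T (z - lam *\<^sub>R A)"
    and x': "x' = (1 - \<rho>) *\<^sub>R z + \<rho> *\<^sub>R (y + lam *\<^sub>R (A - B))"
    and \<kappa>: "\<kappa> = 5 / (4 * \<rho> * (1 + L * lam))" "1 \<le> \<kappa>"
    and a: "0 \<le> a" "a \<le> a'" and c: "c' \<le> (1 - a) * (\<kappa> - 1)"
  shows "(norm (x' - p))\<^sup>2 - a' * (norm (x - p))\<^sup>2 + c' * (norm (x' - x))\<^sup>2
    \<le> (norm (x - p))\<^sup>2 - a * (norm (x0 - p))\<^sup>2 + (1 - a) * (\<kappa> - 1) * (norm (x - x0))\<^sup>2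
    - ((1 - a) * ((1 - a) * \<kappa> - 1) - 2 * a\<^sup>2) * (norm (x - x0))\<^sup>2
    - 3 / 32 * \<rho> * (norm (z - y))\<^sup>2
    + 5 / 2 * \<rho> * lam\<^sup>2 * (norm ((A - V z) - (B - V y)))\<^sup>2 - 2 * \<rho> * lam * inner (B - V y) (y - p)"
proof -
  have diff_alg: "(\<kappa> - 1) * ((1 - a) * u - a * (1 - a) * v)
      = (1 - a) * (\<kappa> - 1) * u - (\<kappa> - 1) * a * (1 - a) * v" for u v :: real
    by (simp add: algebra_simps)
  note step = fbf_step[OF T V L lam \<rho> p y x', folded \<kappa>(1)]
  have "(\<kappa> - 1) * ((1 - a) * (norm (x' - x))\<^sup>2 - a * (1 - a) * (norm (x - x0))\<^sup>2)
      \<le> (\<kappa> - 1) * (norm (x' - z))\<^sup>2"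
    unfolding z using \<kappa>(2) by (intro mult_left_mono inertial_step_lower a) auto
  moreover have "a * (norm (x - p))\<^sup>2 \<le> a' * (norm (x - p))\<^sup>2"
    using a by (intro mult_right_mono) auto
  moreover have "c' * (norm (x' - x))\<^sup>2 \<le> (1 - a) * (\<kappa> - 1) * (norm (x' - x))\<^sup>2"
    using c by (intro mult_right_mono) auto
  moreover have "(norm (z - p))\<^sup>2 =
      (1 + a) * (norm (x - p))\<^sup>2 - a * (norm (x0 - p))\<^sup>2 + a * (1 + a) * (norm (x - x0))\<^sup>2"
    unfolding z by (rule inertial_norm_sq)
  moreover have "(\<kappa> - 1) * ((1 - a) * (norm (x' - x))\<^sup>2 - a * (1 - a) * (norm (x - x0))\<^sup>2)
      = (1 - a) * (\<kappa> - 1) * (norm (x' - x))\<^sup>2 - (\<kappa> - 1) * a * (1 - a) * (norm (x - x0))\<^sup>2"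
    using diff_alg .
  \<comment> \<open>All contributions in |x - x0|^2 add up to (\<kappa> a (1 - a) + 2 a^2) |x -
    x0|^2, which splits into the old Lyapunov coefficient minus the coefficient of (iii).\<close>
  moreover have "a * (1 + a) * (norm (x - x0))\<^sup>2 + (\<kappa> - 1) * a * (1 - a) * (norm (x - x0))\<^sup>2
      = (1 - a) * (\<kappa> - 1) * (norm (x - x0))\<^sup>2
        - ((1 - a) * ((1 - a) * \<kappa> - 1) - 2 * a\<^sup>2) * (norm (x - x0))\<^sup>2"
    by (simp add: algebra_simps power2_eq_square)
  moreover have "(1 + a) * (norm (x - p))\<^sup>2 = (norm (x - p))\<^sup>2 + a * (norm (x - p))\<^sup>2"
    by (simp only: distrib_right mult_1)
  ultimately show ?thesis using step by linarith
qed

section \<open>Almost sure convergence of square-summable martingale differences\<close>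

text \<open>Kolmogorov's inequality, by stopping the sum when it first leaves \<open>(- \<epsilon>, \<epsilon>)\<close>: testing the
  increments against bounded adapted factors is enough, and no conditional expectation is needed.\<close>

lemma (in prob_space) kolmogorov_maximal:
  fixes D :: "nat \<Rightarrow> 'a \<Rightarrow> real" and F :: "nat \<Rightarrow> 'a measure"
  assumes sub: "\<And>n. subalgebra M (F n)" and mono: "\<And>n. subalgebra (F (Suc n)) (F n)"
    and D: "\<And>n. D n \<in> borel_measurable (F (Suc n))" "\<And>n. integrable M (\<lambda>\<omega>. (D n \<omega>)\<^sup>2)"
    and orth: "\<And>n h B. h \<in> borel_measurable (F n) \<Longrightarrow> (\<And>\<omega>. \<bar>h \<omega>\<bar> \<le> B) \<Longrightarrow>
      expectation (\<lambda>\<omega>. h \<omega> * D n \<omega>) = 0"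
    and \<epsilon>: "0 < \<epsilon>"
  shows "prob {\<omega>\<in>space M. \<exists>j\<le>N. \<epsilon> \<le> \<bar>\<Sum>i<j. D i \<omega>\<bar>} \<le> (\<Sum>i<N. expectation (\<lambda>\<omega>. (D i \<omega>)\<^sup>2)) / \<epsilon>\<^sup>2"
proof -
  define St where "St j \<omega> = (\<Sum>i<j. D i \<omega>)" for j \<omega>
  \<comment> \<open>The indicator that no exit has occurred up to time k. The partial sum at time k
    involves only D i with i < k, so this is known before D k.\<close>
  define I where "I k \<omega> = (if \<forall>j\<le>k. \<bar>St j \<omega>\<bar> < \<epsilon> then 1 else 0 :: real)" for k \<omega>
  define S where "S k \<omega> = (\<Sum>i<k. I i \<omega> * D i \<omega>)" for k \<omega>
  have D_M[measurable]: "D n \<in> borel_measurable M" for n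
    by (rule measurable_from_subalg[OF sub D(1)])
  have mono': "f \<in> borel_measurable (F n)" if "f \<in> borel_measurable (F m)" "m \<le> n" for f :: "'a \<Rightarrow> real" and m n
    using that(2,1) by (induction rule: dec_induct) (auto intro: measurable_from_subalg[OF mono])
  have St_F: "St j \<in> borel_measurable (F k)" if "j \<le> k" for j k
    unfolding St_def[abs_def] using that by (intro borel_measurable_sum mono'[OF D(1)]) auto
  have I_F: "I k \<in> borel_measurable (F k)" for k
  proof -
    have "{\<omega> \<in> space (F k). \<forall>j\<in>{..k}. \<bar>St j \<omega>\<bar> < \<epsilon>} \<in> sets (F k)"
    proof (rule sets.sets_Collect_finite_All[OF _ finite_atMost])
      fix j assume "j \<in> {..k}"
      then have [measurable]: "St j \<in> borel_measurable (F k)" by (intro St_F) simp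
      show "{\<omega> \<in> space (F k). \<bar>St j \<omega>\<bar> < \<epsilon>} \<in> sets (F k)" by measurable
    qed
    then have *: "{\<omega> \<in> space (F k). \<forall>j\<le>k. \<bar>St j \<omega>\<bar> < \<epsilon>} \<in> sets (F k)"
      by (simp only: Ball_def atMost_iff)
    show ?thesis
      unfolding I_def[abs_def] by (rule measurable_If[OF borel_measurable_const borel_measurable_const *])
  qed
  have S_F: "S k \<in> borel_measurable (F k)" for k
    unfolding S_def[abs_def] by (intro borel_measurable_sum borel_measurable_times mono'[OF D(1)] mono'[OF I_F]) auto
  have S_M[measurable]: "S k \<in> borel_measurable M" for k by (rule measurable_from_subalg[OF sub S_F])
  have I_M[measurable]: "I k \<in> borel_measurable M" for k by (rule measurable_from_subalg[OF sub I_F])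
  have St_M[measurable]: "St k \<in> borel_measurable M" for k by (rule measurable_from_subalg[OF sub St_F[OF order_refl]])
  have S_eq: "S k \<omega> = St k \<omega>" if "\<And>j. j < k \<Longrightarrow> \<bar>St j \<omega>\<bar> < \<epsilon>" for k \<omega>
    unfolding S_def St_def
  proof (rule sum.cong)
    fix i assume "i \<in> {..<k}"
    then have "I i \<omega> = 1" using that by (auto simp: I_def)
    then show "I i \<omega> * D i \<omega> = D i \<omega>" by simp
  qed simp
  have I_eq: "I k \<omega> = 0" if "\<epsilon> \<le> \<bar>St j \<omega>\<bar>" "j \<le> k" for j k \<omega>
    using that by (auto simp: I_def not_less)
  \<comment> \<open>After the first exit all further increments are switched off, so the stopped sum
    keeps its value from that time.\<close>
  have exit_le: "\<epsilon> \<le> \<bar>S N \<omega>\<bar>" if ex: "\<exists>j\<le>N. \<epsilon> \<le> \<bar>St j \<omega>\<bar>" for \<omega>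
  proof -
    define j where "j = (LEAST j. \<epsilon> \<le> \<bar>St j \<omega>\<bar>)"
    obtain j' where j': "j' \<le> N" "\<epsilon> \<le> \<bar>St j' \<omega>\<bar>" using ex by blast
    have j: "\<epsilon> \<le> \<bar>St j \<omega>\<bar>" unfolding j_def by (rule LeastI) (rule j')
    have jN: "j \<le> N" using Least_le[of "\<lambda>j. \<epsilon> \<le> \<bar>St j \<omega>\<bar>", OF j'(2)] j'(1) by (simp add: j_def)
    have "S N \<omega> = S j \<omega>"
      unfolding S_def using jN I_eq[OF j] by (intro sum.mono_neutral_right) auto
    also have "S j \<omega> = St j \<omega>"
      using not_less_Least[of _ "\<lambda>j. \<epsilon> \<le> \<bar>St j \<omega>\<bar>"] by (intro S_eq) (auto simp: j_def not_le)
    finally show ?thesis using j by simp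
  qed
  \<comment> \<open>While the indicator is 1, the stopped sum equals the running sum and is still
    inside (- \<epsilon>, \<epsilon>). Thus the cross term has a bounded adapted factor and
    \<open>orth\<close> applies to it.\<close>
  have SI_bound: "\<bar>2 * (S k \<omega> * I k \<omega>)\<bar> \<le> 2 * \<epsilon>" for k \<omega>
  proof (cases "\<forall>j\<le>k. \<bar>St j \<omega>\<bar> < \<epsilon>")
    case True
    then have "S k \<omega> = St k \<omega>" by (intro S_eq) auto
    with True show ?thesis by (auto simp: I_def abs_mult)
  next
    case False
    then show ?thesis using \<epsilon> by (auto simp: I_def)
  qed
  have D_int: "integrable M (D n)" for n
    by (rule square_integrable_imp_integrable) (use D(2) in auto)
  have I01: "0 \<le> I k \<omega>" "I k \<omega> \<le> 1" "I k \<omega> * I k \<omega> = I k \<omega>" for k \<omega> by (auto simp: I_def)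
  have ID_int: "integrable M (\<lambda>\<omega>. I k \<omega> * (D k \<omega>)\<^sup>2)" for k
    by (rule Bochner_Integration.integrable_bound[OF D(2)[of k]])
      (auto simp: abs_mult I01 intro!: mult_left_le_one_le)
  have SID_int: "integrable M (\<lambda>\<omega>. 2 * (S k \<omega> * I k \<omega>) * D k \<omega>)" for k
  proof (rule Bochner_Integration.integrable_bound[OF integrable_mult_right[OF D_int[of k], of "2 * \<epsilon>"]])
    show "AE \<omega> in M. norm (2 * (S k \<omega> * I k \<omega>) * D k \<omega>) \<le> norm (2 * \<epsilon> * D k \<omega>)"
    proof (rule AE_I2)
      fix \<omega>
      have "\<bar>2 * (S k \<omega> * I k \<omega>)\<bar> * \<bar>D k \<omega>\<bar> \<le> 2 * \<epsilon> * \<bar>D k \<omega>\<bar>"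
        by (intro mult_right_mono SI_bound) auto
      then show "norm (2 * (S k \<omega> * I k \<omega>) * D k \<omega>) \<le> norm (2 * \<epsilon> * D k \<omega>)"
        using \<epsilon> by (simp add: abs_mult)
    qed
  qed measurable
  have S2: "integrable M (\<lambda>\<omega>. (S k \<omega>)\<^sup>2) \<and>
      expectation (\<lambda>\<omega>. (S k \<omega>)\<^sup>2) \<le> (\<Sum>i<k. expectation (\<lambda>\<omega>. (D i \<omega>)\<^sup>2))" for k
  proof (induction k)
    case 0
    then show ?case by (simp add: S_def)
  next
    case (Suc k)
    have eq: "(S (Suc k) \<omega>)\<^sup>2 = (S k \<omega>)\<^sup>2 + 2 * (S k \<omega> * I k \<omega>) * D k \<omega> + I k \<omega> * (D k \<omega>)\<^sup>2" for \<omega>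
    proof -
      have "(I k \<omega> * D k \<omega>)\<^sup>2 = I k \<omega> * (D k \<omega>)\<^sup>2"
        using I01(3)[of k \<omega>] by (auto simp add: power_mult_distrib power2_eq_square)
      then show ?thesis by (simp add: S_def power2_sum)
    qed
    have "expectation (\<lambda>\<omega>. 2 * (S k \<omega> * I k \<omega>) * D k \<omega>) = 0"
      by (rule orth[OF _ SI_bound]) (intro borel_measurable_times borel_measurable_const S_F I_F)
    moreover have "expectation (\<lambda>\<omega>. I k \<omega> * (D k \<omega>)\<^sup>2) \<le> expectation (\<lambda>\<omega>. (D k \<omega>)\<^sup>2)"
      by (intro integral_mono ID_int D(2) mult_left_le_one_le) (auto simp: I01)
    ultimately show ?case
      using Suc ID_int[of k] SID_int[of k] by (simp add: eq)
  qed
  have "prob {\<omega>\<in>space M. \<exists>j\<le>N. \<epsilon> \<le> \<bar>\<Sum>i<j. D i \<omega>\<bar>} \<le> prob {\<omega>\<in>space M. \<epsilon> \<le> \<bar>S N \<omega>\<bar>}"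
  proof (rule finite_measure_mono)
    show "{\<omega>\<in>space M. \<exists>j\<le>N. \<epsilon> \<le> \<bar>\<Sum>i<j. D i \<omega>\<bar>} \<subseteq> {\<omega>\<in>space M. \<epsilon> \<le> \<bar>S N \<omega>\<bar>}"
      using exit_le unfolding St_def by blast
  qed measurable
  also have "\<dots> \<le> expectation (\<lambda>\<omega>. (S N \<omega>)\<^sup>2) / \<epsilon>\<^sup>2"
    using S2[of N] \<epsilon> by (intro second_moment_method S_M) auto
  also have "\<dots> \<le> (\<Sum>i<N. expectation (\<lambda>\<omega>. (D i \<omega>)\<^sup>2)) / \<epsilon>\<^sup>2"
    using S2[of N] by (intro divide_right_mono) auto
  finally show ?thesis .
qed

text \<open>Kolmogorov's inequality on the tail from n bounds the probability of ever leaving (-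
  \<epsilon>, \<epsilon>) by the tail of the variance series over \<epsilon>^2. Letting n grow,
  almost every path has a tail whose partial sums all stay small, which is the Cauchy
  criterion.\<close>

lemma (in prob_space) martingale_differences_AE_summable:
  fixes D :: "nat \<Rightarrow> 'a \<Rightarrow> real" and F :: "nat \<Rightarrow> 'a measure"
  assumes sub: "\<And>n. subalgebra M (F n)" and mono: "\<And>n. subalgebra (F (Suc n)) (F n)"
    and D: "\<And>n. D n \<in> borel_measurable (F (Suc n))" "\<And>n. integrable M (\<lambda>\<omega>. (D n \<omega>)\<^sup>2)"
    and orth: "\<And>n h B. h \<in> borel_measurable (F n) \<Longrightarrow> (\<And>\<omega>. \<bar>h \<omega>\<bar> \<le> B) \<Longrightarrow>
      expectation (\<lambda>\<omega>. h \<omega> * D n \<omega>) = 0"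
    and summ: "summable (\<lambda>n. expectation (\<lambda>\<omega>. (D n \<omega>)\<^sup>2))"
  shows "AE \<omega> in M. summable (\<lambda>n. D n \<omega>)"
proof -
  define E where "E n = expectation (\<lambda>\<omega>. (D n \<omega>)\<^sup>2)" for n
  have D_M[measurable]: "D n \<in> borel_measurable M" for n
    by (rule measurable_from_subalg[OF sub D(1)])
  have E: "summable E" "\<And>n. 0 \<le> E n" using summ by (auto simp: E_def[abs_def])
  have small: "AE \<omega> in M. \<exists>n. \<forall>j. \<bar>\<Sum>i<j. D (i + n) \<omega>\<bar> < \<epsilon>" if \<epsilon>: "0 < \<epsilon>" for \<epsilon>
  proof -
    define A where "A n N = {\<omega>\<in>space M. \<exists>j\<le>N. \<epsilon> \<le> \<bar>\<Sum>i<j. D (i + n) \<omega>\<bar>}" for n N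
    have A_sets: "A n N \<in> sets M" for n N unfolding A_def by measurable
    have le: "prob (A n N) \<le> (\<Sum>i. E (i + n)) / \<epsilon>\<^sup>2" for n N
    proof -
      have "prob (A n N) \<le> (\<Sum>i<N. expectation (\<lambda>\<omega>. (D (i + n) \<omega>)\<^sup>2)) / \<epsilon>\<^sup>2"
        unfolding A_def using D(1)[of "_ + n"] mono[of "_ + n"]
        by (intro kolmogorov_maximal[where F = "\<lambda>i. F (i + n)"] sub D(2) orth \<epsilon>) auto
      also have "\<dots> \<le> (\<Sum>i. E (i + n)) / \<epsilon>\<^sup>2"
        unfolding E_def[symmetric] using E
        by (intro divide_right_mono sum_le_suminf) (auto simp: summable_iff_shift)
      finally show ?thesis .
    qed
    have U: "prob (\<Union>N. A n N) \<le> (\<Sum>i. E (i + n)) / \<epsilon>\<^sup>2" for n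
    proof (rule LIMSEQ_le_const2)
      show "(\<lambda>N. prob (A n N)) \<longlonglongrightarrow> prob (\<Union>N. A n N)"
        using A_sets by (intro finite_Lim_measure_incseq) (auto simp: incseq_def A_def intro: order_trans)
    qed (use le in auto)
    \<comment> \<open>The paths on which no tail keeps all its partial sums below
      \<epsilon>.\<close>
    define B where "B = (\<Inter>n. \<Union>N. A n N)"
    have B_sets: "B \<in> sets M" unfolding B_def using A_sets by auto
    have "prob B \<le> (\<Sum>i. E (i + n)) / \<epsilon>\<^sup>2" for n
      by (rule order_trans[OF finite_measure_mono U[of n]]) (use A_sets in \<open>auto simp: B_def\<close>)
    moreover have "(\<lambda>n. (\<Sum>i. E (i + n)) / \<epsilon>\<^sup>2) \<longlonglongrightarrow> 0 / \<epsilon>\<^sup>2"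
      using \<epsilon> by (intro tendsto_divide suminf_exist_split2 E tendsto_const) auto
    ultimately have "prob B \<le> 0"
      by (intro LIMSEQ_le_const[of "\<lambda>n. (\<Sum>i. E (i + n)) / \<epsilon>\<^sup>2"]) auto
    then have "prob B = 0" by (simp add: measure_le_0_iff)
    then have "B \<in> null_sets M" using B_sets by (auto simp: emeasure_eq_measure)
    moreover have "{\<omega> \<in> space M. \<not> (\<exists>n. \<forall>j. \<bar>\<Sum>i<j. D (i + n) \<omega>\<bar> < \<epsilon>)} \<subseteq> B"
      unfolding B_def A_def not_ex not_all not_less by (blast intro: order_refl)
    ultimately show ?thesis by (rule AE_I')
  qed
  have "AE \<omega> in M. \<forall>m. \<exists>n. \<forall>j. \<bar>\<Sum>i<j. D (i + n) \<omega>\<bar> < inverse (real (Suc m))"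
    unfolding AE_all_countable by (intro allI small) simp
  then show ?thesis
  proof eventually_elim
    fix \<omega> assume *: "\<forall>m. \<exists>n. \<forall>j. \<bar>\<Sum>i<j. D (i + n) \<omega>\<bar> < inverse (real (Suc m))"
    show "summable (\<lambda>n. D n \<omega>)"
      unfolding summable_Cauchy
    proof (intro allI impI)
      fix e :: real assume "0 < e"
      then obtain m where m: "inverse (real (Suc m)) < e / 2" using reals_Archimedean[of "e / 2"] by auto
      obtain n where n: "\<And>j. \<bar>\<Sum>i<j. D (i + n) \<omega>\<bar> < inverse (real (Suc m))" using * by blast
      have shift: "(\<Sum>i<j. D (i + n) \<omega>) = (\<Sum>i=n..<n + j. D i \<omega>)" for j
        using sum.shift_bounds_nat_ivl[of "\<lambda>i. D i \<omega>" 0 n j] by (simp add: lessThan_atLeast0 add.commute)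
      \<comment> \<open>The block is a difference of two partial sums started at n, each below e /
        2.\<close>
      have "norm (\<Sum>i=a..<b. D i \<omega>) < e" if "n \<le> a" for a b
      proof (cases "a \<le> b")
        case True
        have "(\<Sum>i=n..<a. D i \<omega>) + (\<Sum>i=a..<b. D i \<omega>) = (\<Sum>i=n..<b. D i \<omega>)"
          using that True by (rule sum.atLeastLessThan_concat)
        moreover have "\<bar>\<Sum>i=n..<c. D i \<omega>\<bar> < e / 2" if "n \<le> c" for c
          using n[of "c - n"] m that unfolding shift by simp
        from this[of a] this[of b] have "\<bar>\<Sum>i=n..<a. D i \<omega>\<bar> < e / 2" "\<bar>\<Sum>i=n..<b. D i \<omega>\<bar> < e / 2"
          using that True by auto
        ultimately show ?thesis unfolding real_norm_def by argo
      qed (use \<open>0 < e\<close> in simp)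
      then show "\<exists>N. \<forall>m\<ge>N. \<forall>n. norm (\<Sum>i=m..<n. D i \<omega>) < e" by blast
    qed
  qed
qed

section \<open>Independent samples and mini-batch errors\<close>

lemma integrable_inner_of_sq:
  fixes f g :: "'w \<Rightarrow> 'h::{real_inner, second_countable_topology}"
  assumes [measurable]: "f \<in> borel_measurable M" "g \<in> borel_measurable M"
    and f: "integrable M (\<lambda>x. (norm (f x))\<^sup>2)" and g: "integrable M (\<lambda>x. (norm (g x))\<^sup>2)"
  shows "integrable M (\<lambda>x. inner (f x) (g x))"
proof (rule Bochner_Integration.integrable_bound[OF Bochner_Integration.integrable_add[OF f g]])
  show "AE x in M. norm (inner (f x) (g x)) \<le> norm ((norm (f x))\<^sup>2 + (norm (g x))\<^sup>2)"
  proof (rule AE_I2)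
    fix x
    have "\<bar>inner (f x) (g x)\<bar> \<le> norm (f x) * norm (g x)" by (rule Cauchy_Schwarz_ineq2)
    also have "\<dots> \<le> (norm (f x))\<^sup>2 + (norm (g x))\<^sup>2"
      using sum_squares_bound[of "norm (f x)" "norm (g x)"]
        mult_nonneg_nonneg[OF norm_ge_zero[of "f x"] norm_ge_zero[of "g x"]] by linarith
    finally show "norm (inner (f x) (g x)) \<le> norm ((norm (f x))\<^sup>2 + (norm (g x))\<^sup>2)" by simp
  qed
qed measurable

lemma integral_norm_sq_sum_orthogonal:
  fixes E :: "'i \<Rightarrow> 'w \<Rightarrow> 'h::{real_inner, second_countable_topology}"
  assumes "finite A"
    and E: "\<And>t. t \<in> A \<Longrightarrow> E t \<in> borel_measurable M" "\<And>t. t \<in> A \<Longrightarrow> integrable M (\<lambda>x. (norm (E t x))\<^sup>2)"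
    and orth: "\<And>s t. s \<in> A \<Longrightarrow> t \<in> A \<Longrightarrow> s \<noteq> t \<Longrightarrow> (\<integral>x. inner (E s x) (E t x) \<partial>M) = 0"
  shows "integrable M (\<lambda>x. (norm (\<Sum>t\<in>A. E t x))\<^sup>2)"
    and "(\<integral>x. (norm (\<Sum>t\<in>A. E t x))\<^sup>2 \<partial>M) = (\<Sum>t\<in>A. \<integral>x. (norm (E t x))\<^sup>2 \<partial>M)"
proof -
  have eq: "(norm (\<Sum>t\<in>A. E t x))\<^sup>2 = (\<Sum>s\<in>A. \<Sum>t\<in>A. inner (E s x) (E t x))" for x
    by (simp only: power2_norm_eq_inner inner_sum_left inner_sum_right) (rule sum.swap)
  have int: "integrable M (\<lambda>x. inner (E s x) (E t x))" if "s \<in> A" "t \<in> A" for s t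
    using that by (intro integrable_inner_of_sq E)
  show "integrable M (\<lambda>x. (norm (\<Sum>t\<in>A. E t x))\<^sup>2)"
    unfolding eq by (intro Bochner_Integration.integrable_sum int)
  have "(\<integral>x. (norm (\<Sum>t\<in>A. E t x))\<^sup>2 \<partial>M) = (\<Sum>s\<in>A. \<integral>x. (\<Sum>t\<in>A. inner (E s x) (E t x)) \<partial>M)"
    unfolding eq by (intro Bochner_Integration.integral_sum Bochner_Integration.integrable_sum int)
  also have "\<dots> = (\<Sum>s\<in>A. \<Sum>t\<in>A. \<integral>x. inner (E s x) (E t x) \<partial>M)"
    by (intro sum.cong refl Bochner_Integration.integral_sum int)
  also have "\<dots> = (\<Sum>s\<in>A. \<Sum>t\<in>A. if t = s then (\<integral>x. (norm (E s x))\<^sup>2 \<partial>M) else 0)"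
    by (intro sum.cong refl) (auto simp: orth power2_norm_eq_inner)
  also have "\<dots> = (\<Sum>t\<in>A. \<integral>x. (norm (E t x))\<^sup>2 \<partial>M)"
    using \<open>finite A\<close> by (simp add: sum.delta)
  finally show "(\<integral>x. (norm (\<Sum>t\<in>A. E t x))\<^sup>2 \<partial>M) = (\<Sum>t\<in>A. \<integral>x. (norm (E t x))\<^sup>2 \<partial>M)" .
qed

text \<open>One index type covers both sample families, so that a single independent family
  describes the whole randomness. Mean and variance of the oracle are stated for the common law
  \<open>P\<close>.\<close>

locale oracle_samples = prob_space M for M :: "'w measure" +
  fixes P :: "'d measure" and S :: "'i \<Rightarrow> 'w \<Rightarrow> 'd" and I :: "'i set"
    and Vhat :: "'h::{real_inner, banach, second_countable_topology} \<Rightarrow> 'd \<Rightarrow> 'h"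
    and V :: "'h \<Rightarrow> 'h" and \<sigma> :: real
  assumes indep: "indep_vars (\<lambda>_. P) S I"
    and law: "\<And>i. i \<in> I \<Longrightarrow> distr M P (S i) = P"
    and prob_P: "prob_space P"
    and Vhat_meas: "(\<lambda>(x, z). Vhat x z) \<in> borel_measurable (borel \<Otimes>\<^sub>M P)"
    and V_meas: "V \<in> borel_measurable borel"
    and unbiased: "\<And>x. has_bochner_integral P (Vhat x) (V x)"
    and variance_int: "\<And>x. integrable P (\<lambda>z. (norm (Vhat x z - V x))\<^sup>2)"
    and variance_le: "\<And>x. (\<integral>z. (norm (Vhat x z - V x))\<^sup>2 \<partial>P) \<le> \<sigma>\<^sup>2"
begin

text \<open>The sigma-algebra generated by the samples with index in J. Presenting it by one map
  into a product space fits the independence of disjoint blocks of an independent family.\<close>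

definition past :: "'i set \<Rightarrow> 'w measure" where
  "past J = vimage_algebra (space M) (\<lambda>\<omega>. \<lambda>i\<in>J. S i \<omega>) (PiM J (\<lambda>_. P))"

lemma sample_measurable: "i \<in> I \<Longrightarrow> S i \<in> M \<rightarrow>\<^sub>M P"
  using indep by (simp add: indep_vars_def2)

lemma samples_measurable: "J \<subseteq> I \<Longrightarrow> (\<lambda>\<omega>. \<lambda>i\<in>J. S i \<omega>) \<in> M \<rightarrow>\<^sub>M PiM J (\<lambda>_. P)"
  by (intro measurable_restrict sample_measurable) blast

lemma space_past[simp]: "space (past J) = space M"
  by (simp add: past_def)

lemma samples_past: "J \<subseteq> I \<Longrightarrow> (\<lambda>\<omega>. \<lambda>i\<in>J. S i \<omega>) \<in> past J \<rightarrow>\<^sub>M PiM J (\<lambda>_. P)"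
  unfolding past_def by (intro measurable_vimage_algebra1 measurable_space[OF samples_measurable] Pi_I)

lemma subalgebra_past: "J \<subseteq> I \<Longrightarrow> subalgebra M (past J)"
  unfolding subalgebra_def
proof (intro conjI)
  assume J: "J \<subseteq> I"
  have "id \<in> M \<rightarrow>\<^sub>M past J"
    unfolding past_def by (rule measurable_vimage_algebra2) (simp_all add: samples_measurable[OF J])
  then show "sets (past J) \<subseteq> sets M"
    using measurable_sets[of id M "past J"] sets.sets_into_space[of _ "past J"]
    by (auto simp: Int_absorb2)
qed simp

lemma sample_past:
  assumes "i \<in> J" "J \<subseteq> I"
  shows "S i \<in> past J \<rightarrow>\<^sub>M P"
  using measurable_compose[OF samples_past[OF assms(2)] measurable_component_singleton[OF assms(1)]] assms
  by simp

lemma subalgebra_past_mono: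
  assumes "J \<subseteq> K" "K \<subseteq> I"
  shows "subalgebra (past K) (past J)"
  unfolding subalgebra_def
proof (intro conjI)
  have "(\<lambda>\<omega>. \<lambda>i\<in>J. S i \<omega>) \<in> past K \<rightarrow>\<^sub>M PiM J (\<lambda>_. P)"
    using assms by (intro measurable_restrict sample_past) auto
  then have "id \<in> past K \<rightarrow>\<^sub>M past J"
    unfolding past_def[of J] by (intro measurable_vimage_algebra2) simp_all
  then show "sets (past J) \<subseteq> sets (past K)"
    using measurable_sets[of id "past K" "past J"] sets.sets_into_space[of _ "past J"]
    by (auto simp: Int_absorb2)
qed simp

lemma past_mono: "f \<in> past J \<rightarrow>\<^sub>M N \<Longrightarrow> J \<subseteq> K \<Longrightarrow> K \<subseteq> I \<Longrightarrow> f \<in> past K \<rightarrow>\<^sub>M N"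
  by (rule measurable_from_subalg[OF subalgebra_past_mono])

lemma past_M: "f \<in> past J \<rightarrow>\<^sub>M N \<Longrightarrow> J \<subseteq> I \<Longrightarrow> f \<in> M \<rightarrow>\<^sub>M N"
  by (rule measurable_from_subalg[OF subalgebra_past])

lemma prob_past_sample:
  assumes J: "J \<subseteq> I" and i: "i \<in> I - J" and A: "A \<in> sets (past J)" and B: "B \<in> sets P"
  shows "prob (A \<inter> (S i -` B \<inter> space M)) = prob A * prob (S i -` B \<inter> space M)"
proof -
  let ?Y = "\<lambda>\<omega>. \<lambda>i\<in>{i}. S i \<omega>"
  have "indep_var (PiM J (\<lambda>_. P)) (\<lambda>\<omega>. \<lambda>i\<in>J. S i \<omega>) (PiM {i} (\<lambda>_. P)) ?Y"
    using J i by (intro indep_var_restrict[OF indep]) auto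
  then have ind: "indep_set (sets (past J))
      (sigma_sets (space M) {?Y -` C \<inter> space M | C. C \<in> sets (PiM {i} (\<lambda>_. P))})"
    by (simp add: indep_var_eq past_def sets_vimage_algebra)
  \<comment> \<open>Block independence speaks of maps into product spaces, so the event for the
    single sample is rewritten as a cylinder over the one-element block.\<close>
  define C where "C = (\<lambda>f. f i) -` B \<inter> space (PiM {i} (\<lambda>_. P))"
  have C: "C \<in> sets (PiM {i} (\<lambda>_. P))"
  proof -
    have "(\<lambda>f. f i) \<in> PiM {i} (\<lambda>_. P) \<rightarrow>\<^sub>M P"
      by (rule measurable_component_singleton) simp
    from measurable_sets[OF this B] show ?thesis by (simp add: C_def)
  qed
  have "?Y \<omega> \<in> space (PiM {i} (\<lambda>_. P))" if "\<omega> \<in> space M" for \<omega>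
    using measurable_space[OF samples_measurable[of "{i}"] that] i by simp
  then have "S i -` B \<inter> space M = ?Y -` C \<inter> space M"
    by (auto simp: C_def)
  then have "S i -` B \<inter> space M \<in> sigma_sets (space M) {?Y -` C \<inter> space M | C. C \<in> sets (PiM {i} (\<lambda>_. P))}"
    using C by blast
  with ind A show ?thesis unfolding indep_sets2_eq by blast
qed

text \<open>Independence enters the later computations through this product law: conditioning on the
  past becomes Fubini's theorem with the past variable held fixed.\<close>

lemma distr_past_sample:
  assumes J: "J \<subseteq> I" and i: "i \<in> I - J" and Q: "Q \<in> past J \<rightarrow>\<^sub>M N"
  shows "distr M (N \<Otimes>\<^sub>M P) (\<lambda>\<omega>. (Q \<omega>, S i \<omega>)) = distr M N Q \<Otimes>\<^sub>M P"
proof (rule pair_measure_eqI[symmetric])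
  have Q_M[measurable]: "Q \<in> M \<rightarrow>\<^sub>M N" by (rule past_M[OF Q J])
  have S_M[measurable]: "S i \<in> M \<rightarrow>\<^sub>M P" using i by (intro sample_measurable) auto
  interpret P: prob_space P by (rule prob_P)
  interpret D: prob_space "distr M N Q" by (rule prob_space_distr) (rule Q_M)
  show "sigma_finite_measure (distr M N Q)" "sigma_finite_measure P" by unfold_locales
  show "sets (distr M N Q \<Otimes>\<^sub>M P) = sets (distr M (N \<Otimes>\<^sub>M P) (\<lambda>\<omega>. (Q \<omega>, S i \<omega>)))"
    by (simp cong: sets_pair_measure_cong)
  fix A B assume A: "A \<in> sets (distr M N Q)" and B: "B \<in> sets P"
  then have A': "A \<in> sets N" by simp
  have QA: "Q -` A \<inter> space M \<in> sets (past J)"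
    using measurable_sets[OF Q A'] by simp
  have "emeasure (distr M (N \<Otimes>\<^sub>M P) (\<lambda>\<omega>. (Q \<omega>, S i \<omega>))) (A \<times> B)
      = emeasure M ((\<lambda>\<omega>. (Q \<omega>, S i \<omega>)) -` (A \<times> B) \<inter> space M)"
    using A' B by (intro emeasure_distr) auto
  also have "(\<lambda>\<omega>. (Q \<omega>, S i \<omega>)) -` (A \<times> B) \<inter> space M = (Q -` A \<inter> space M) \<inter> (S i -` B \<inter> space M)"
    by auto
  also have "emeasure M \<dots> = emeasure M (Q -` A \<inter> space M) * emeasure M (S i -` B \<inter> space M)"
    unfolding emeasure_eq_measure prob_past_sample[OF J i QA B] by (simp add: ennreal_mult)
  also have "emeasure M (Q -` A \<inter> space M) = emeasure (distr M N Q) A"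
    using A' by (simp add: emeasure_distr)
  also have "emeasure M (S i -` B \<inter> space M) = emeasure (distr M P (S i)) B"
    using B by (simp add: emeasure_distr)
  finally show "emeasure (distr M N Q) A * emeasure P B =
      emeasure (distr M (N \<Otimes>\<^sub>M P) (\<lambda>\<omega>. (Q \<omega>, S i \<omega>))) (A \<times> B)"
    using law[of i] i by simp
qed

lemma expectation_past_sample:
  fixes f :: "_ \<Rightarrow> real"
  assumes J: "J \<subseteq> I" and i: "i \<in> I - J" and Q: "Q \<in> past J \<rightarrow>\<^sub>M N"
    and f[measurable]: "f \<in> borel_measurable (N \<Otimes>\<^sub>M P)" and int: "integrable M (\<lambda>\<omega>. f (Q \<omega>, S i \<omega>))"
  shows "expectation (\<lambda>\<omega>. f (Q \<omega>, S i \<omega>)) = expectation (\<lambda>\<omega>. \<integral>z. f (Q \<omega>, z) \<partial>P)"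
proof -
  have Q_M[measurable]: "Q \<in> M \<rightarrow>\<^sub>M N" by (rule past_M[OF Q J])
  have S_M[measurable]: "S i \<in> M \<rightarrow>\<^sub>M P" using i by (intro sample_measurable) auto
  interpret P: prob_space P by (rule prob_P)
  interpret D: prob_space "distr M N Q" by (rule prob_space_distr) (rule Q_M)
  interpret PP: pair_sigma_finite "distr M N Q" P ..
  have "integrable (distr M (N \<Otimes>\<^sub>M P) (\<lambda>\<omega>. (Q \<omega>, S i \<omega>))) f"
    using int by (subst integrable_distr_eq) auto
  then have int': "integrable (distr M N Q \<Otimes>\<^sub>M P) f"
    by (simp add: distr_past_sample[OF J i Q])
  have "expectation (\<lambda>\<omega>. f (Q \<omega>, S i \<omega>)) = integral\<^sup>L (distr M (N \<Otimes>\<^sub>M P) (\<lambda>\<omega>. (Q \<omega>, S i \<omega>))) f"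
    by (subst integral_distr) auto
  also have "\<dots> = integral\<^sup>L (distr M N Q \<Otimes>\<^sub>M P) f"
    by (simp add: distr_past_sample[OF J i Q])
  also have "\<dots> = (\<integral>x. \<integral>z. f (x, z) \<partial>P \<partial>distr M N Q)"
    by (rule PP.integral_fst'[OF int', symmetric])
  also have "\<dots> = expectation (\<lambda>\<omega>. \<integral>z. f (Q \<omega>, z) \<partial>P)"
    by (subst integral_distr) auto
  finally show ?thesis .
qed

text \<open>The variant without integrability premise; it is what proves integrability of the error
  terms in the first place.\<close>

lemma nn_integral_past_sample:
  fixes f :: "_ \<Rightarrow> ennreal"
  assumes J: "J \<subseteq> I" and i: "i \<in> I - J" and Q: "Q \<in> past J \<rightarrow>\<^sub>M N"
    and f[measurable]: "f \<in> borel_measurable (N \<Otimes>\<^sub>M P)"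
  shows "(\<integral>\<^sup>+\<omega>. f (Q \<omega>, S i \<omega>) \<partial>M) = (\<integral>\<^sup>+\<omega>. \<integral>\<^sup>+z. f (Q \<omega>, z) \<partial>P \<partial>M)"
proof -
  have Q_M[measurable]: "Q \<in> M \<rightarrow>\<^sub>M N" by (rule past_M[OF Q J])
  have S_M[measurable]: "S i \<in> M \<rightarrow>\<^sub>M P" using i by (intro sample_measurable) auto
  interpret P: prob_space P by (rule prob_P)
  have f': "f \<in> borel_measurable (distr M N Q \<Otimes>\<^sub>M P)"
    using f by (simp cong: measurable_cong_sets sets_pair_measure_cong)
  have "(\<integral>\<^sup>+\<omega>. f (Q \<omega>, S i \<omega>) \<partial>M) = integral\<^sup>N (distr M (N \<Otimes>\<^sub>M P) (\<lambda>\<omega>. (Q \<omega>, S i \<omega>))) f"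
    by (subst nn_integral_distr) auto
  also have "\<dots> = integral\<^sup>N (distr M N Q \<Otimes>\<^sub>M P) f"
    by (simp add: distr_past_sample[OF J i Q])
  also have "\<dots> = (\<integral>\<^sup>+x. \<integral>\<^sup>+z. f (x, z) \<partial>P \<partial>distr M N Q)"
    by (rule P.nn_integral_fst[OF f', symmetric])
  also have "\<dots> = (\<integral>\<^sup>+\<omega>. \<integral>\<^sup>+z. f (Q \<omega>, z) \<partial>P \<partial>M)"
    by (subst nn_integral_distr) auto
  finally show ?thesis .
qed

definition err :: "('w \<Rightarrow> 'h) \<Rightarrow> 'i \<Rightarrow> 'w \<Rightarrow> 'h" where
  "err Q i \<omega> = Vhat (Q \<omega>) (S i \<omega>) - V (Q \<omega>)"

lemma Vhat_compose:
  assumes "Q \<in> borel_measurable N" "Z \<in> N \<rightarrow>\<^sub>M P"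
  shows "(\<lambda>x. Vhat (Q x) (Z x)) \<in> borel_measurable N"
  using measurable_compose[OF measurable_Pair[OF assms] Vhat_meas] by simp

lemma err_past:
  assumes "Q \<in> borel_measurable (past J)" "J \<subseteq> I" "i \<in> I"
  shows "err Q i \<in> borel_measurable (past (insert i J))"
proof -
  have Q: "Q \<in> borel_measurable (past (insert i J))" using assms by (intro past_mono[OF assms(1)]) auto
  have "(\<lambda>\<omega>. V (Q \<omega>)) \<in> borel_measurable (past (insert i J))"
    by (rule measurable_compose[OF Q V_meas])
  then show ?thesis
    unfolding err_def[abs_def] using assms Q by (intro borel_measurable_diff Vhat_compose sample_past) auto
qed

text \<open>With the pair (G, Q) frozen, unbiasedness makes the inner integral vanish for each of
  its values.\<close>

lemma expectation_inner_err:
  assumes J: "J \<subseteq> I" and i: "i \<in> I - J" and Q: "Q \<in> borel_measurable (past J)"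
    and G: "G \<in> borel_measurable (past J)" and int: "integrable M (\<lambda>\<omega>. inner (G \<omega>) (err Q i \<omega>))"
  shows "expectation (\<lambda>\<omega>. inner (G \<omega>) (err Q i \<omega>)) = 0"
proof -
  define f where "f = (\<lambda>((g, q), z). inner g (Vhat q z - V q))"
  have [measurable]: "(\<lambda>x. Vhat (snd (fst x)) (snd x)) \<in> borel_measurable ((borel \<Otimes>\<^sub>M borel) \<Otimes>\<^sub>M P)"
    by (intro Vhat_compose measurable_compose[OF measurable_fst measurable_snd] measurable_snd)
  note V_meas[measurable]
  have f: "f \<in> borel_measurable ((borel \<Otimes>\<^sub>M borel) \<Otimes>\<^sub>M P)"
    unfolding f_def split_beta' by measurable
  have GQ: "(\<lambda>\<omega>. (G \<omega>, Q \<omega>)) \<in> past J \<rightarrow>\<^sub>M borel \<Otimes>\<^sub>M borel"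
    by (rule measurable_Pair[OF G Q])
  interpret P: prob_space P by (rule prob_P)
  have zero: "(\<integral>z. f ((g, q), z) \<partial>P) = 0" for g q
  proof -
    have "(\<integral>z. inner g (Vhat q z - V q) \<partial>P) = inner g (\<integral>z. (Vhat q z - V q) \<partial>P)"
      using unbiased[of q] by (intro integral_inner_right) (auto simp: has_bochner_integral_iff)
    also have "(\<integral>z. (Vhat q z - V q) \<partial>P) = 0"
      using unbiased[of q] by (simp add: has_bochner_integral_iff P.prob_space)
    finally show ?thesis by (simp add: f_def)
  qed
  have "expectation (\<lambda>\<omega>. f ((G \<omega>, Q \<omega>), S i \<omega>)) = expectation (\<lambda>\<omega>. \<integral>z. f ((G \<omega>, Q \<omega>), z) \<partial>P)"
    using int by (intro expectation_past_sample[OF J i GQ f]) (simp add: f_def err_def)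
  then show ?thesis by (simp add: zero) (simp add: f_def err_def)
qed

text \<open>The factor \<open>h\<close> is square integrable but possibly unbounded: with h the norm
  of Y_k - p this yields the variance of the martingale differences, with h = 1 the plain error. The
  uniform variance bound makes the product square integrable.\<close>

lemma norm_sq_err:
  assumes J: "J \<subseteq> I" and i: "i \<in> I - J" and Q: "Q \<in> borel_measurable (past J)"
    and h: "h \<in> borel_measurable (past J)" and int: "integrable M (\<lambda>\<omega>. (h \<omega>)\<^sup>2)"
  shows "integrable M (\<lambda>\<omega>. (norm (h \<omega> *\<^sub>R err Q i \<omega>))\<^sup>2)"
    and "expectation (\<lambda>\<omega>. (norm (h \<omega> *\<^sub>R err Q i \<omega>))\<^sup>2) \<le> \<sigma>\<^sup>2 * expectation (\<lambda>\<omega>. (h \<omega>)\<^sup>2)"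
proof -
  define f where "f = (\<lambda>((g :: real, q), z). ennreal (g\<^sup>2 * (norm (Vhat q z - V q))\<^sup>2))"
  have [measurable]: "(\<lambda>x. Vhat (snd (fst x)) (snd x)) \<in> borel_measurable ((borel \<Otimes>\<^sub>M borel) \<Otimes>\<^sub>M P)"
    by (intro Vhat_compose measurable_compose[OF measurable_fst measurable_snd] measurable_snd)
  note V_meas[measurable]
  have f: "f \<in> borel_measurable ((borel \<Otimes>\<^sub>M borel) \<Otimes>\<^sub>M P)"
    unfolding f_def split_beta' by measurable
  have hQ: "(\<lambda>\<omega>. (h \<omega>, Q \<omega>)) \<in> past J \<rightarrow>\<^sub>M borel \<Otimes>\<^sub>M borel"
    by (rule measurable_Pair[OF h Q])
  have h_M[measurable]: "h \<in> borel_measurable M" by (rule past_M[OF h J])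
  have err_M[measurable]: "err Q i \<in> borel_measurable M"
    by (rule past_M[OF err_past[OF Q J]]) (use i J in auto)
  interpret P: prob_space P by (rule prob_P)
  have inner_le: "(\<integral>\<^sup>+z. f ((g, q), z) \<partial>P) \<le> ennreal (\<sigma>\<^sup>2 * g\<^sup>2)" for g q
  proof -
    have "(\<integral>\<^sup>+z. f ((g, q), z) \<partial>P) = ennreal (\<integral>z. g\<^sup>2 * (norm (Vhat q z - V q))\<^sup>2 \<partial>P)"
      unfolding f_def prod.case using variance_int[of q] by (intro nn_integral_eq_integral) auto
    also have "(\<integral>z. g\<^sup>2 * (norm (Vhat q z - V q))\<^sup>2 \<partial>P) = g\<^sup>2 * (\<integral>z. (norm (Vhat q z - V q))\<^sup>2 \<partial>P)"
      by simp
    also have "\<dots> \<le> g\<^sup>2 * \<sigma>\<^sup>2" by (intro mult_left_mono variance_le) simp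
    finally show ?thesis by (simp add: mult.commute ennreal_leI)
  qed
  have eq: "(norm (h \<omega> *\<^sub>R err Q i \<omega>))\<^sup>2 = (h \<omega>)\<^sup>2 * (norm (Vhat (Q \<omega>) (S i \<omega>) - V (Q \<omega>)))\<^sup>2" for \<omega>
    by (simp add: err_def power_mult_distrib)
  have "(\<integral>\<^sup>+\<omega>. ennreal ((norm (h \<omega> *\<^sub>R err Q i \<omega>))\<^sup>2) \<partial>M) = (\<integral>\<^sup>+\<omega>. f ((h \<omega>, Q \<omega>), S i \<omega>) \<partial>M)"
    unfolding eq by (simp add: f_def)
  also have "\<dots> = (\<integral>\<^sup>+\<omega>. \<integral>\<^sup>+z. f ((h \<omega>, Q \<omega>), z) \<partial>P \<partial>M)"
    by (rule nn_integral_past_sample[OF J i hQ f])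
  also have "\<dots> \<le> (\<integral>\<^sup>+\<omega>. ennreal (\<sigma>\<^sup>2 * (h \<omega>)\<^sup>2) \<partial>M)"
    by (intro nn_integral_mono inner_le)
  also have "\<dots> = ennreal (\<sigma>\<^sup>2 * expectation (\<lambda>\<omega>. (h \<omega>)\<^sup>2))"
    using int by (subst nn_integral_eq_integral) auto
  finally have le: "(\<integral>\<^sup>+\<omega>. ennreal ((norm (h \<omega> *\<^sub>R err Q i \<omega>))\<^sup>2) \<partial>M) \<le> ennreal (\<sigma>\<^sup>2 * expectation (\<lambda>\<omega>. (h \<omega>)\<^sup>2))" .
  show *: "integrable M (\<lambda>\<omega>. (norm (h \<omega> *\<^sub>R err Q i \<omega>))\<^sup>2)"
  proof (rule integrableI_bounded)
    show "(\<integral>\<^sup>+\<omega>. ennreal (norm ((norm (h \<omega> *\<^sub>R err Q i \<omega>))\<^sup>2)) \<partial>M) < \<infinity>"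
      unfolding real_norm_def abs_power2 by (rule le_less_trans[OF le]) simp
  qed measurable
  have "ennreal (expectation (\<lambda>\<omega>. (norm (h \<omega> *\<^sub>R err Q i \<omega>))\<^sup>2)) \<le> ennreal (\<sigma>\<^sup>2 * expectation (\<lambda>\<omega>. (h \<omega>)\<^sup>2))"
    using le by (subst nn_integral_eq_integral[OF *, symmetric]) auto
  then show "expectation (\<lambda>\<omega>. (norm (h \<omega> *\<^sub>R err Q i \<omega>))\<^sup>2) \<le> \<sigma>\<^sup>2 * expectation (\<lambda>\<omega>. (h \<omega>)\<^sup>2)"
    by (subst (asm) ennreal_le_iff) (auto intro!: mult_nonneg_nonneg integral_nonneg_AE)
qed

definition batch_err :: "nat \<Rightarrow> (nat \<Rightarrow> 'i) \<Rightarrow> ('w \<Rightarrow> 'h) \<Rightarrow> 'w \<Rightarrow> 'h" where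
  "batch_err n ix Q \<omega> = minibatch Vhat n (\<lambda>t. S (ix t) \<omega>) (Q \<omega>) - V (Q \<omega>)"

lemma batch_err_eq:
  assumes "1 \<le> n"
  shows "batch_err n ix Q \<omega> = (1 / real n) *\<^sub>R (\<Sum>t=1..n. err Q (ix t) \<omega>)"
proof -
  have "(1 / real n) *\<^sub>R (\<Sum>t=1..n. V (Q \<omega>)) = V (Q \<omega>)"
    using assms by (simp add: sum_constant_scaleR)
  then show ?thesis
    by (simp add: batch_err_def minibatch_def err_def sum_subtractf scaleR_diff_right)
qed

lemma batch_err_past:
  assumes Q: "Q \<in> borel_measurable (past J)" and J: "J \<subseteq> I" and ix: "ix ` {1..n} \<subseteq> I" and n: "1 \<le> n"
  shows "batch_err n ix Q \<in> borel_measurable (past (J \<union> ix ` {1..n}))"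
proof -
  have "err Q (ix t) \<in> borel_measurable (past (J \<union> ix ` {1..n}))" if "t \<in> {1..n}" for t
    using that ix J by (intro past_mono[OF err_past[OF Q J]]) auto
  then have "(\<lambda>\<omega>. (1 / real n) *\<^sub>R (\<Sum>t=1..n. err Q (ix t) \<omega>)) \<in> borel_measurable (past (J \<union> ix ` {1..n}))"
    by (intro borel_measurable_scaleR borel_measurable_const borel_measurable_sum)
  then show ?thesis by (simp add: batch_err_eq[OF n, abs_def])
qed

text \<open>Errors of different samples at the same random point are orthogonal, so n variances are
  added and divided by n^2.\<close>

lemma norm_sq_batch_err:
  assumes J: "J \<subseteq> I" and ix: "ix ` {1..n} \<subseteq> I - J" "inj_on ix {1..n}" and n: "1 \<le> n"
    and Q: "Q \<in> borel_measurable (past J)"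
    and h: "h \<in> borel_measurable (past J)" and int: "integrable M (\<lambda>\<omega>. (h \<omega>)\<^sup>2)"
  shows "integrable M (\<lambda>\<omega>. (norm (h \<omega> *\<^sub>R batch_err n ix Q \<omega>))\<^sup>2)"
    and "expectation (\<lambda>\<omega>. (norm (h \<omega> *\<^sub>R batch_err n ix Q \<omega>))\<^sup>2)
      \<le> \<sigma>\<^sup>2 / real n * expectation (\<lambda>\<omega>. (h \<omega>)\<^sup>2)"
proof -
  define E where "E t \<omega> = h \<omega> *\<^sub>R err Q (ix t) \<omega>" for t \<omega>
  have i: "ix t \<in> I - J" if "t \<in> {1..n}" for t using ix(1) that by blast
  have h_M[measurable]: "h \<in> borel_measurable M" by (rule past_M[OF h J])
  have err_M: "err Q (ix t) \<in> borel_measurable M" if "t \<in> {1..n}" for t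
    by (rule past_M[OF err_past[OF Q J]]) (use i[OF that] J in auto)
  have E_M: "E t \<in> borel_measurable M" if "t \<in> {1..n}" for t
    unfolding E_def[abs_def] by (intro borel_measurable_scaleR h_M err_M that)
  have E_int: "integrable M (\<lambda>\<omega>. (norm (E t \<omega>))\<^sup>2)" if "t \<in> {1..n}" for t
    unfolding E_def using norm_sq_err(1)[OF J i[OF that] Q h int] .
  have orth: "expectation (\<lambda>\<omega>. inner (E s \<omega>) (E t \<omega>)) = 0" if st: "s \<in> {1..n}" "t \<in> {1..n}" "s \<noteq> t" for s t
  proof -
    \<comment> \<open>With sample \<open>ix s\<close> moved into the past, its error counts as known
      while \<open>ix t\<close> is still fresh.\<close>
    define K where "K = insert (ix s) J"
    have K: "K \<subseteq> I" "ix t \<in> I - K"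
      using i[OF st(1)] i[OF st(2)] J inj_onD[OF ix(2) _ st(1,2)] st(3) by (auto simp: K_def)
    have hK: "h \<in> borel_measurable (past K)" and QK: "Q \<in> borel_measurable (past K)"
      using h Q K by (auto intro: past_mono simp: K_def)
    have errK: "err Q (ix s) \<in> borel_measurable (past K)"
      unfolding K_def using i[OF st(1)] J by (intro err_past[OF Q]) auto
    have eq: "inner (E s \<omega>) (E t \<omega>) = inner ((h \<omega> * h \<omega>) *\<^sub>R err Q (ix s) \<omega>) (err Q (ix t) \<omega>)" for \<omega>
      by (simp add: E_def)
    have "integrable M (\<lambda>\<omega>. inner (E s \<omega>) (E t \<omega>))"
      using st by (intro integrable_inner_of_sq E_M E_int)
    then show ?thesis
      unfolding eq by (intro expectation_inner_err[OF K QK] borel_measurable_scaleR borel_measurable_times hK errK)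
  qed
  have sums: "integrable M (\<lambda>\<omega>. (norm (\<Sum>t=1..n. E t \<omega>))\<^sup>2)"
    "expectation (\<lambda>\<omega>. (norm (\<Sum>t=1..n. E t \<omega>))\<^sup>2) = (\<Sum>t=1..n. expectation (\<lambda>\<omega>. (norm (E t \<omega>))\<^sup>2))"
    by (rule integral_norm_sq_sum_orthogonal; (rule finite_atLeastAtMost E_M E_int orth; assumption)?)+
  have eq: "(norm (h \<omega> *\<^sub>R batch_err n ix Q \<omega>))\<^sup>2 = (1 / (real n)\<^sup>2) * (norm (\<Sum>t=1..n. E t \<omega>))\<^sup>2" for \<omega>
  proof -
    have "h \<omega> *\<^sub>R batch_err n ix Q \<omega> = (1 / real n) *\<^sub>R (\<Sum>t=1..n. E t \<omega>)"
      by (simp add: batch_err_eq[OF n] E_def mult.commute flip: scaleR_sum_right)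
    then show ?thesis by (simp add: power_divide)
  qed
  show "integrable M (\<lambda>\<omega>. (norm (h \<omega> *\<^sub>R batch_err n ix Q \<omega>))\<^sup>2)"
    unfolding eq by (intro integrable_mult_right sums)
  have "expectation (\<lambda>\<omega>. (norm (h \<omega> *\<^sub>R batch_err n ix Q \<omega>))\<^sup>2) =
      (1 / (real n)\<^sup>2) * (\<Sum>t=1..n. expectation (\<lambda>\<omega>. (norm (E t \<omega>))\<^sup>2))"
    unfolding eq by (simp only: integral_mult_right_zero sums(2))
  also have "\<dots> \<le> (1 / (real n)\<^sup>2) * (\<Sum>t=1..n. \<sigma>\<^sup>2 * expectation (\<lambda>\<omega>. (h \<omega>)\<^sup>2))"
    unfolding E_def using norm_sq_err(2)[OF J i Q h int] by (intro mult_left_mono sum_mono) auto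
  also have "\<dots> = \<sigma>\<^sup>2 / real n * expectation (\<lambda>\<omega>. (h \<omega>)\<^sup>2)"
    using n by (simp add: power2_eq_square)
  finally show "expectation (\<lambda>\<omega>. (norm (h \<omega> *\<^sub>R batch_err n ix Q \<omega>))\<^sup>2)
      \<le> \<sigma>\<^sup>2 / real n * expectation (\<lambda>\<omega>. (h \<omega>)\<^sup>2)" .
qed

lemma expectation_inner_batch_err:
  assumes J: "J \<subseteq> I" and ix: "ix ` {1..n} \<subseteq> I - J" and n: "1 \<le> n"
    and Q: "Q \<in> borel_measurable (past J)"
    and G: "G \<in> borel_measurable (past J)" "integrable M (\<lambda>\<omega>. (norm (G \<omega>))\<^sup>2)"
  shows "expectation (\<lambda>\<omega>. inner (batch_err n ix Q \<omega>) (G \<omega>)) = 0"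
proof -
  have i: "ix t \<in> I - J" if "t \<in> {1..n}" for t using ix that by blast
  have err_M: "err Q (ix t) \<in> borel_measurable M" if "t \<in> {1..n}" for t
    by (rule past_M[OF err_past[OF Q J]]) (use i[OF that] J in auto)
  have int: "integrable M (\<lambda>\<omega>. inner (G \<omega>) (err Q (ix t) \<omega>))" if "t \<in> {1..n}" for t
    using norm_sq_err(1)[OF J i[OF that] Q borel_measurable_const[of 1]] that
    by (intro integrable_inner_of_sq past_M[OF G(1) J] G(2) err_M) auto
  have "inner (batch_err n ix Q \<omega>) (G \<omega>) = (1 / real n) * (\<Sum>t=1..n. inner (G \<omega>) (err Q (ix t) \<omega>))" for \<omega>
    by (simp add: batch_err_eq[OF n] inner_commute[of _ "G \<omega>"] inner_sum_right)
  then have "expectation (\<lambda>\<omega>. inner (batch_err n ix Q \<omega>) (G \<omega>)) =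
      (1 / real n) * (\<Sum>t=1..n. expectation (\<lambda>\<omega>. inner (G \<omega>) (err Q (ix t) \<omega>)))"
    using int by (simp add: Bochner_Integration.integral_sum)
  also have "\<dots> = 0"
    using expectation_inner_err[OF J i Q G(1) int] by simp
  finally show ?thesis .
qed

end

section \<open>Cluster points, dense sets of reference points, almost sure summability\<close>

text \<open>The exact forward-backward point y n is asymptotically z n, hence has the same weak
  limit as x n. Its inclusion gives an element of (T + V)(y n) equal to (z n - y n) / lam n - (V (z
  n) - V (y n)), which tends to 0 because the step sizes have a positive limit.\<close>

lemma weak_cluster_zero:
  fixes T :: "'a::{real_inner, complete_space} \<Rightarrow> 'a set"
  assumes T: "maximally_monotone T" and V: "maximally_monotone (single_op V)"
    and L: "L > 0" "L-lipschitz_on UNIV V"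
    and lam: "\<And>n. 0 < lam n" "lam \<longlonglongrightarrow> c" "0 < c"
    and res: "(\<lambda>n. residual T V (lam n) (z n)) \<longlonglongrightarrow> 0"
    and xz: "(\<lambda>n. x n - z n) \<longlonglongrightarrow> 0" and B: "\<And>n. norm (x n) \<le> B"
    and weak: "weakly_converges x l"
  shows "- V l \<in> T l"
proof -
  define y where "y n = resolvent (lam n) T (z n - lam n *\<^sub>R V (z n))" for n
  define u where "u n = (1 / lam n) *\<^sub>R (z n - lam n *\<^sub>R V (z n) - y n)" for n
  have zy: "(\<lambda>n. z n - y n) \<longlonglongrightarrow> 0"
    using res by (simp add: residual_def y_def tendsto_norm_zero_iff)
  have xy: "(\<lambda>n. x n - y n) \<longlonglongrightarrow> 0"
    using tendsto_add[OF xz zy] by simp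
  have u_T: "u n \<in> T (y n)" for n
    unfolding u_def y_def by (rule resolvent_in[OF T lam(1)])
  have "(\<lambda>n. V (z n) - V (y n)) \<longlonglongrightarrow> 0"
  proof (rule Lim_null_comparison)
    show "\<forall>\<^sub>F n in sequentially. norm (V (z n) - V (y n)) \<le> L * norm (z n - y n)"
      using lipschitz_onD[OF L(2)] by (intro always_eventually allI) (simp add: dist_norm)
    show "(\<lambda>n. L * norm (z n - y n)) \<longlonglongrightarrow> 0"
      using tendsto_mult[OF tendsto_const[of L] tendsto_norm_zero[OF zy]] by simp
  qed
  moreover have "(\<lambda>n. (1 / lam n) *\<^sub>R (z n - y n)) \<longlonglongrightarrow> (1 / c) *\<^sub>R 0"
    using lam by (intro tendsto_scaleR zy tendsto_divide tendsto_const) auto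
  ultimately have "(\<lambda>n. (1 / lam n) *\<^sub>R (z n - y n) - (V (z n) - V (y n))) \<longlonglongrightarrow> (1 / c) *\<^sub>R 0 - 0"
    by (intro tendsto_diff)
  moreover have "(1 / lam n) *\<^sub>R (z n - y n) - (V (z n) - V (y n)) = u n + V (y n)" for n
    using lam(1)[of n] by (simp add: u_def algebra_simps)
  ultimately have uV: "(\<lambda>n. u n + V (y n)) \<longlonglongrightarrow> 0" by simp
  have weak_y: "weakly_converges y l"
    unfolding weakly_converges_def
  proof
    fix h
    have "(\<lambda>n. inner (x n) h - inner (x n - y n) h) \<longlonglongrightarrow> inner l h - inner 0 h"
      using weak unfolding weakly_converges_def by (intro tendsto_diff tendsto_inner[OF xy tendsto_const]) blast
    then show "(\<lambda>n. inner (y n) h) \<longlonglongrightarrow> inner l h" by (simp add: inner_diff_left)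
  qed
  obtain K where K: "\<And>n. norm (x n - y n) \<le> K"
    using convergent_imp_Bseq[OF convergentI[OF xy]] by (auto simp: Bseq_def)
  have "norm (y n) \<le> B + K" for n
    using norm_triangle_ineq4[of "x n" "x n - y n"] B[of n] K[of n] by simp
  with demiclosed_sum[OF T V L u_T uV weak_y] show ?thesis by blast
qed

text \<open>Distances to q and to a nearby p differ by at most dist p q, uniformly in n, so the
  Cauchy property survives. This carries an almost sure statement from countably many solutions to
  all of them.\<close>

lemma convergent_norm_dense:
  fixes x :: "nat \<Rightarrow> 'a::real_normed_vector"
  assumes D: "\<And>p. p \<in> D \<Longrightarrow> convergent (\<lambda>n. norm (x n - p))" and q: "q \<in> closure D"
  shows "convergent (\<lambda>n. norm (x n - q))"
proof -
  have "Cauchy (\<lambda>n. norm (x n - q))"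
  proof (rule metric_CauchyI)
    fix e :: real assume e: "0 < e"
    then obtain p where p: "p \<in> D" "dist p q < e / 3"
      using q unfolding closure_approachable by (meson divide_pos_pos zero_less_numeral)
    obtain N where N: "\<And>m n. N \<le> m \<Longrightarrow> N \<le> n \<Longrightarrow> dist (norm (x m - p)) (norm (x n - p)) < e / 3"
      using metric_CauchyD[OF convergent_Cauchy[OF D[OF p(1)]], of "e / 3"] e by auto
    have close: "\<bar>norm (x n - q) - norm (x n - p)\<bar> < e / 3" for n
      using norm_triangle_ineq3[of "x n - q" "x n - p"] p(2) by (simp add: dist_norm)
    have "dist (norm (x m - q)) (norm (x n - q)) < e" if "N \<le> m" "N \<le> n" for m n
      using N[OF that] close[of m] close[of n] unfolding dist_real_def by argo
    then show "\<exists>N. \<forall>m\<ge>N. \<forall>n\<ge>N. dist (norm (x m - q)) (norm (x n - q)) < e" by blast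
  qed
  then show ?thesis by (rule Cauchy_convergent)
qed

text \<open>Monotone convergence: the sum has a finite integral, hence is finite almost
  everywhere.\<close>

lemma AE_summable_of_integrals:
  fixes f :: "nat \<Rightarrow> 'w \<Rightarrow> real"
  assumes f: "\<And>n. integrable M (f n)" "\<And>n \<omega>. 0 \<le> f n \<omega>"
    and summ: "summable (\<lambda>n. \<integral>\<omega>. f n \<omega> \<partial>M)"
  shows "AE \<omega> in M. summable (\<lambda>n. f n \<omega>)"
proof -
  have [measurable]: "f n \<in> borel_measurable M" for n using f(1) by auto
  have "(\<integral>\<^sup>+\<omega>. (\<Sum>n. ennreal (f n \<omega>)) \<partial>M) = (\<Sum>n. \<integral>\<^sup>+\<omega>. ennreal (f n \<omega>) \<partial>M)"
    by (intro nn_integral_suminf) measurable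
  also have "\<dots> = (\<Sum>n. ennreal (\<integral>\<omega>. f n \<omega> \<partial>M))"
    using f by (intro suminf_cong nn_integral_eq_integral) auto
  also have "\<dots> \<noteq> \<infinity>"
    using f summ by (simp add: suminf_ennreal2)
  finally have "AE \<omega> in M. (\<Sum>n. ennreal (f n \<omega>)) \<noteq> \<infinity>"
    by (intro nn_integral_PInf_AE) measurable
  then show ?thesis
  proof eventually_elim
    fix \<omega> assume "(\<Sum>n. ennreal (f n \<omega>)) \<noteq> \<infinity>"
    then show "summable (\<lambda>n. f n \<omega>)"
      using f(2) by (intro summable_suminf_not_top) auto
  qed
qed

lemma norm_add_sq_le: "(norm (a + b))\<^sup>2 \<le> 2 * (norm a)\<^sup>2 + 2 * (norm (b :: 'a::real_normed_vector))\<^sup>2"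
proof -
  have "(norm (a + b))\<^sup>2 \<le> (norm a + norm b)\<^sup>2"
    by (intro power_mono norm_triangle_ineq) simp
  also have "\<dots> \<le> 2 * (norm a)\<^sup>2 + 2 * (norm b)\<^sup>2"
    using zero_le_power2[of "norm a - norm b"] by (simp add: power2_sum power2_diff)
  finally show ?thesis .
qed

lemma norm_diff_sq_le: "(norm (a - b))\<^sup>2 \<le> 2 * (norm a)\<^sup>2 + 2 * (norm (b :: 'a::real_normed_vector))\<^sup>2"
  using norm_add_sq_le[of a "- b"] by simp

section \<open>Square-integrable variables determined by a set of samples\<close>

context oracle_samples
begin

text \<open>Adaptedness and square integrability are bundled, since both have to be propagated
  together along the iteration.\<close>

definition adm :: "'i set \<Rightarrow> ('w \<Rightarrow> 'h) \<Rightarrow> bool" where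
  "adm J f \<longleftrightarrow> f \<in> borel_measurable (past J) \<and> integrable M (\<lambda>\<omega>. (norm (f \<omega>))\<^sup>2)"

text \<open>Equality on the sample space is enough; the recursion of the process is prescribed only
  there.\<close>

lemma adm_cong: "adm J f \<Longrightarrow> (\<And>\<omega>. \<omega> \<in> space M \<Longrightarrow> f \<omega> = g \<omega>) \<Longrightarrow> adm J g"
  unfolding adm_def
  using measurable_cong[of "past J" f g borel]
    Bochner_Integration.integrable_cong[of M M "\<lambda>\<omega>. (norm (f \<omega>))\<^sup>2" "\<lambda>\<omega>. (norm (g \<omega>))\<^sup>2"]
  by simp

lemma adm_const: "adm J (\<lambda>_. c)"
  by (simp add: adm_def)

lemma adm_mono: "adm J f \<Longrightarrow> J \<subseteq> K \<Longrightarrow> K \<subseteq> I \<Longrightarrow> adm K f"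
  unfolding adm_def by (auto intro: past_mono)

lemma adm_M: "adm J f \<Longrightarrow> J \<subseteq> I \<Longrightarrow> f \<in> borel_measurable M"
  unfolding adm_def by (auto intro: past_M)

lemma adm_int: "adm J f \<Longrightarrow> integrable M (\<lambda>\<omega>. (norm (f \<omega>))\<^sup>2)"
  by (simp add: adm_def)

lemma adm_add:
  assumes J: "J \<subseteq> I" and f: "adm J f" and g: "adm J g"
  shows "adm J (\<lambda>\<omega>. f \<omega> + g \<omega>)"
  unfolding adm_def
proof
  show "(\<lambda>\<omega>. f \<omega> + g \<omega>) \<in> borel_measurable (past J)"
    using f g by (auto simp: adm_def)
  have [measurable]: "f \<in> borel_measurable M" "g \<in> borel_measurable M"
    using f g adm_M J by auto
  show "integrable M (\<lambda>\<omega>. (norm (f \<omega> + g \<omega>))\<^sup>2)"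
  proof (rule Bochner_Integration.integrable_bound)
    show "integrable M (\<lambda>\<omega>. 2 * (norm (f \<omega>))\<^sup>2 + 2 * (norm (g \<omega>))\<^sup>2)"
      using adm_int[OF f] adm_int[OF g] by simp
  qed (use norm_add_sq_le[of "f _" "g _"] in simp_all)
qed

lemma adm_scaleR:
  assumes "adm J f"
  shows "adm J (\<lambda>\<omega>. c *\<^sub>R f \<omega>)"
  using assms by (auto simp: adm_def power_mult_distrib)

lemma adm_diff:
  assumes "J \<subseteq> I" "adm J f" "adm J g"
  shows "adm J (\<lambda>\<omega>. f \<omega> - g \<omega>)"
  using adm_add[OF assms(1,2) adm_scaleR[OF assms(3), of "- 1"]] by simp

lemma adm_lipschitz:
  assumes J: "J \<subseteq> I" and f: "adm J f" and g: "C-lipschitz_on UNIV g"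
  shows "adm J (\<lambda>\<omega>. g (f \<omega>))"
proof -
  have g_meas[measurable]: "g \<in> borel_measurable borel"
    using lipschitz_on_continuous_on[OF g] by (rule borel_measurable_continuous_onI)
  have [measurable]: "f \<in> borel_measurable M" by (rule adm_M[OF f J])
  \<comment> \<open>Lipschitz continuity bounds only the increment from 0; the constant g 0 is
    square integrable on a probability space and is added back at the end.\<close>
  have "adm J (\<lambda>\<omega>. g (f \<omega>) - g 0)"
    unfolding adm_def
  proof
    have "(\<lambda>\<omega>. g (f \<omega>)) \<in> borel_measurable (past J)"
      using f g_meas unfolding adm_def by (auto intro: measurable_compose)
    then show "(\<lambda>\<omega>. g (f \<omega>) - g 0) \<in> borel_measurable (past J)" by simp
    show "integrable M (\<lambda>\<omega>. (norm (g (f \<omega>) - g 0))\<^sup>2)"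
    proof (rule Bochner_Integration.integrable_bound)
      show "integrable M (\<lambda>\<omega>. C\<^sup>2 * (norm (f \<omega>))\<^sup>2)" using adm_int[OF f] by simp
      have "(norm (g (f \<omega>) - g 0))\<^sup>2 \<le> (C * norm (f \<omega>))\<^sup>2" for \<omega>
        using lipschitz_onD[OF g, of "f \<omega>" 0] by (intro power_mono) (auto simp: dist_norm)
      then show "AE \<omega> in M. norm ((norm (g (f \<omega>) - g 0))\<^sup>2) \<le> norm (C\<^sup>2 * (norm (f \<omega>))\<^sup>2)"
        by (intro AE_I2) (simp add: power_mult_distrib)
    qed measurable
  qed
  from adm_add[OF J this adm_const[of J "g 0"]] show ?thesis by simp
qed

lemma adm_batch_err:
  assumes J: "J \<subseteq> I" and ix: "ix ` {1..n} \<subseteq> I - J" "inj_on ix {1..n}" and n: "1 \<le> n"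
    and Q: "adm J Q"
  shows "adm (J \<union> ix ` {1..n}) (batch_err n ix Q)"
    and "expectation (\<lambda>\<omega>. (norm (batch_err n ix Q \<omega>))\<^sup>2) \<le> \<sigma>\<^sup>2 / real n"
proof -
  have Q': "Q \<in> borel_measurable (past J)" using Q by (simp add: adm_def)
  note * = norm_sq_batch_err[OF J ix n Q' borel_measurable_const[of 1]]
  show "adm (J \<union> ix ` {1..n}) (batch_err n ix Q)"
    unfolding adm_def
  proof
    show "batch_err n ix Q \<in> borel_measurable (past (J \<union> ix ` {1..n}))"
      using ix(1) by (intro batch_err_past[OF Q' J _ n]) blast
    show "integrable M (\<lambda>\<omega>. (norm (batch_err n ix Q \<omega>))\<^sup>2)"
      using *(1) by simp
  qed
  show "expectation (\<lambda>\<omega>. (norm (batch_err n ix Q \<omega>))\<^sup>2) \<le> \<sigma>\<^sup>2 / real n"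
    using *(2) by (simp add: prob_space)
qed

text \<open>Cauchy-Schwarz moves the norm of G in front of the error, where it can serve as the
  adapted factor of \<open>norm_sq_batch_err\<close>.\<close>

lemma adm_norm_batch_err:
  assumes J: "J \<subseteq> I" and ix: "ix ` {1..n} \<subseteq> I - J" "inj_on ix {1..n}" and n: "1 \<le> n"
    and Q: "adm J Q" and G: "adm J G"
  shows "integrable M (\<lambda>\<omega>. (inner (batch_err n ix Q \<omega>) (G \<omega>))\<^sup>2)"
    and "expectation (\<lambda>\<omega>. (inner (batch_err n ix Q \<omega>) (G \<omega>))\<^sup>2)
      \<le> \<sigma>\<^sup>2 / real n * expectation (\<lambda>\<omega>. (norm (G \<omega>))\<^sup>2)"
proof -
  have Q': "Q \<in> borel_measurable (past J)" and G': "(\<lambda>\<omega>. norm (G \<omega>)) \<in> borel_measurable (past J)"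
    using Q G by (auto simp: adm_def)
  note * = norm_sq_batch_err[OF J ix n Q' G' adm_int[OF G]]
  have [measurable]: "G \<in> borel_measurable M" by (rule adm_M[OF G J])
  have [measurable]: "batch_err n ix Q \<in> borel_measurable M"
    using adm_M[OF adm_batch_err(1)[OF J ix n Q]] ix J by auto
  have le: "(inner (batch_err n ix Q \<omega>) (G \<omega>))\<^sup>2 \<le> (norm (norm (G \<omega>) *\<^sub>R batch_err n ix Q \<omega>))\<^sup>2" for \<omega>
    using Cauchy_Schwarz_ineq2[of "batch_err n ix Q \<omega>" "G \<omega>"]
    by (simp add: mult.commute flip: abs_le_square_iff)
  show int: "integrable M (\<lambda>\<omega>. (inner (batch_err n ix Q \<omega>) (G \<omega>))\<^sup>2)"
    by (rule Bochner_Integration.integrable_bound[OF *(1)]) (use le in \<open>auto simp: AE_I2\<close>)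
  show "expectation (\<lambda>\<omega>. (inner (batch_err n ix Q \<omega>) (G \<omega>))\<^sup>2)
      \<le> \<sigma>\<^sup>2 / real n * expectation (\<lambda>\<omega>. (norm (G \<omega>))\<^sup>2)"
    by (rule order_trans[OF integral_mono[OF int *(1) le] *(2)])
qed

end

section \<open>Analysis of the stochastic iteration\<close>

locale risfbf =
  oracle_samples M P "case_sum (\<lambda>(k, t). xi k t) (\<lambda>(k, t). eta k t)"
    "sample_indices m <+> sample_indices m" Vhat V \<sigma>
  for M :: "'w measure" and P :: "'d measure" and xi eta :: "nat \<Rightarrow> nat \<Rightarrow> 'w \<Rightarrow> 'd" and m :: "nat \<Rightarrow> nat"
    and Vhat :: "'h::{real_inner, banach, second_countable_topology} \<Rightarrow> 'd \<Rightarrow> 'h"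
    and V :: "'h \<Rightarrow> 'h" and \<sigma> :: real +
  fixes T :: "'h \<Rightarrow> 'h set" and L \<alpha>bar \<epsilon>bar lam_lim :: real
    and \<alpha> \<rho> lam :: "nat \<Rightarrow> real" and x0 x1 :: 'h and Z Y X :: "nat \<Rightarrow> 'w \<Rightarrow> 'h"
  assumes T: "maximally_monotone T"
    and V: "maximally_monotone (single_op V)" and L: "L > 0" "L-lipschitz_on UNIV V"
    and process: "risfbf_process M T Vhat \<alpha> \<rho> lam m xi eta x0 x1 Z Y X"
    and solvable: "zeros_op (sum_op T (single_op V)) \<noteq> {}"
    and batch: "\<And>k. k \<ge> 1 \<Longrightarrow> m k \<ge> 1" "summable (\<lambda>n. 1 / real (m (Suc n)))"
    and bars: "0 < \<alpha>bar" "\<alpha>bar < 1" "0 < \<epsilon>bar" "\<epsilon>bar < 1"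
    and \<alpha>: "\<And>k. k \<ge> 1 \<Longrightarrow> 0 \<le> \<alpha> k" "mono_on {1..} \<alpha>" "\<alpha> \<longlonglongrightarrow> \<alpha>bar"
    and lam: "\<And>k. k \<ge> 1 \<Longrightarrow> lam k \<in> {0<..<1 / (4 * L)}" "lam_lim \<in> {0<..<1 / (4 * L)}"
      "lam \<longlonglongrightarrow> lam_lim"
    and \<rho>: "\<And>k. k \<ge> 1 \<Longrightarrow> \<rho> k = 5 * (1 - \<epsilon>bar) * (1 - \<alpha>bar)\<^sup>2 /
      (4 * (2 * (\<alpha> k)\<^sup>2 - \<alpha> k + 1) * (1 + L * lam k))"
begin

section \<open>Parameters of the iteration\<close>

definition c0 :: real where "c0 = (1 - \<epsilon>bar) * (1 - \<alpha>bar)\<^sup>2"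

text \<open>This equals 5 / (4 \<rho> (1 + L lam)) by the choice of the relaxation. In this form the
  step size has cancelled, and \<kappa> depends on k only through the inertia.\<close>

definition \<kappa> :: "nat \<Rightarrow> real" where "\<kappa> k = (2 * (\<alpha> k)\<^sup>2 - \<alpha> k + 1) / c0"

text \<open>The coefficient of statement (iii), expressed through \<kappa>.\<close>

definition gain :: "nat \<Rightarrow> real" where "gain k = (1 - \<alpha> k) * ((1 - \<alpha> k) * \<kappa> k - 1) - 2 * (\<alpha> k)\<^sup>2"

text \<open>A positive lower bound for \<open>gain\<close>, uniform in k.\<close>

definition \<beta> :: real where "\<beta> = 7 / 8 * (\<epsilon>bar / (1 - \<epsilon>bar))"

lemma c0_pos: "0 < c0"
  using bars by (simp add: c0_def)

lemma \<beta>_pos: "0 < \<beta>"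
  using bars by (simp add: \<beta>_def)

lemma \<alpha>_le: "k \<ge> 1 \<Longrightarrow> \<alpha> k \<le> \<alpha>bar"
proof -
  assume k: "k \<ge> 1"
  have "\<alpha> k \<le> \<alpha> n" if "n \<ge> k" for n
    using mono_onD[OF \<alpha>(2), of k n] k that by simp
  then show ?thesis
    by (intro LIMSEQ_le_const[OF \<alpha>(3)]) blast
qed

lemma c0_le: "k \<ge> 1 \<Longrightarrow> c0 \<le> (1 - \<epsilon>bar) * (1 - \<alpha> k)\<^sup>2"
  unfolding c0_def using \<alpha>_le[of k] bars by (intro mult_left_mono power_mono) auto

lemma c0_le': assumes "k \<ge> 1" shows "c0 \<le> (1 - \<alpha> k)\<^sup>2"
proof -
  have "(1 - \<epsilon>bar) * (1 - \<alpha> k)\<^sup>2 \<le> 1 * (1 - \<alpha> k)\<^sup>2"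
    using bars by (intro mult_right_mono) auto
  with c0_le[OF assms] show ?thesis by simp
qed

lemma g_pos: "0 < 2 * (\<alpha> k)\<^sup>2 - \<alpha> k + 1"
  using zero_le_power2[of "\<alpha> k - 1 / 4"] by (simp add: power2_diff power2_eq_square algebra_simps)

lemma lam_pos: "k \<ge> 1 \<Longrightarrow> 0 < lam k" and lam_small: "k \<ge> 1 \<Longrightarrow> 4 * (L * lam k) < 1"
  using lam(1)[of k] L by (auto simp: field_simps)

lemma \<rho>_eq: "k \<ge> 1 \<Longrightarrow> \<rho> k = 5 * c0 / (4 * (2 * (\<alpha> k)\<^sup>2 - \<alpha> k + 1) * (1 + L * lam k))"
  using \<rho>[of k] by (simp add: c0_def mult.assoc)

lemma Llam_pos: "k \<ge> 1 \<Longrightarrow> 0 < 1 + L * lam k"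
  using lam_pos[of k] L by (simp add: add_pos_pos)

lemma \<rho>_pos: "k \<ge> 1 \<Longrightarrow> 0 < \<rho> k"
  using g_pos[of k] Llam_pos[of k] c0_pos by (simp add: \<rho>_eq)

lemma \<kappa>_eq: assumes "k \<ge> 1" shows "\<kappa> k = 5 / (4 * \<rho> k * (1 + L * lam k))"
proof -
  have "4 * (5 * c / (4 * g * l)) * l = 5 * c / g" if "0 < g" "0 < l" for c g l :: real
    using that by (simp add: field_simps)
  from this[OF g_pos[of k] Llam_pos[OF assms]]
  have "4 * \<rho> k * (1 + L * lam k) = 5 * c0 / (2 * (\<alpha> k)\<^sup>2 - \<alpha> k + 1)"
    by (simp only: \<rho>_eq[OF assms])
  moreover have "5 / (5 * c / g) = g / c" for c g :: real by simp
  ultimately show ?thesis by (simp only: \<kappa>_def)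
qed

lemma \<kappa>_ge_1: "k \<ge> 1 \<Longrightarrow> 1 \<le> \<kappa> k"
  unfolding \<kappa>_def using c0_pos c0_le' \<alpha>(1) by (rule inertia_coeff_ge_one)

lemma gain_ge: "k \<ge> 1 \<Longrightarrow> \<beta> \<le> gain k"
  unfolding gain_def \<beta>_def \<kappa>_def
  using c0_pos c0_le bars(3,4) by (rule inertia_coeff_lower)

lemma gain_eq: assumes "k \<ge> 1"
  shows "gain k = (1 - \<alpha> k) * (5 * (1 - \<alpha> k) / (4 * \<rho> k * (1 + L * lam k)) - 1) - 2 * (\<alpha> k)\<^sup>2"
  by (simp add: gain_def \<kappa>_eq[OF assms])

text \<open>The weight of |X_k - X_(k-1)|^2 in the Lyapunov function.\<close>

definition ac :: "nat \<Rightarrow> real" where "ac k = (1 - \<alpha> k) * (\<kappa> k - 1)"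

lemma ac_antimono: assumes "k \<ge> 1" shows "ac (Suc k) \<le> ac k"
  unfolding ac_def \<kappa>_def
  using c0_pos c0_le'[of "Suc k"] \<alpha>(1)[OF assms] mono_onD[OF \<alpha>(2), of k "Suc k"] assms \<alpha>_le[of "Suc k"] bars
  by (intro inertia_coeff_antimono) auto

lemma ac_nonneg: "k \<ge> 1 \<Longrightarrow> 0 \<le> ac k"
  unfolding ac_def using \<alpha>_le[of k] \<kappa>_ge_1[of k] bars by simp

lemma ac_le: assumes "k \<ge> 1" shows "ac k \<le> ac 1"
  using assms by (induction k rule: dec_induct) (auto intro: order_trans[OF ac_antimono])

text \<open>The premise of \<open>lyapunov_lower\<close> says exactly that \<open>gain\<close> is
  nonnegative: the two sides differ by it.\<close>

lemma \<alpha>_ac: assumes "k \<ge> 1" shows "\<alpha> k * (1 + \<alpha> k) \<le> (1 - \<alpha> k) * ac k"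
proof -
  have "(1 - \<alpha> k) * ac k - \<alpha> k * (1 + \<alpha> k) = gain k"
    by (simp add: ac_def gain_def power2_eq_square algebra_simps)
  with gain_ge[OF assms] \<beta>_pos show ?thesis by simp
qed

text \<open>The quadratic is at most 2 on [0, 1] and 1 + L lam is at most 5/4, so the denominator is
  at most 10. A positive lower bound turns summability of the decay into summability of |Z -
  Y|^2.\<close>

lemma \<rho>_ge: assumes "k \<ge> 1" shows "c0 / 2 \<le> \<rho> k"
proof -
  have "(\<alpha> k)\<^sup>2 \<le> \<alpha> k"
    using \<alpha>(1)[OF assms] \<alpha>_le[OF assms] bars mult_right_mono[of "\<alpha> k" 1 "\<alpha> k"] by (simp add: power2_eq_square)
  then have "2 * (\<alpha> k)\<^sup>2 - \<alpha> k + 1 \<le> 2"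
    using \<alpha>_le[OF assms] bars by linarith
  then have "4 * (2 * (\<alpha> k)\<^sup>2 - \<alpha> k + 1) * (1 + L * lam k) \<le> 4 * 2 * (5 / 4)"
    using lam_small[OF assms] Llam_pos[OF assms] g_pos[of k] by (intro mult_mono) auto
  then have "5 * c0 / (4 * 2 * (5 / 4)) \<le> \<rho> k"
    unfolding \<rho>_eq[OF assms] using g_pos[of k] Llam_pos[OF assms] c0_pos
    by (intro divide_left_mono) auto
  then show ?thesis by simp
qed

lemma \<rho>_le: assumes "k \<ge> 1" shows "\<rho> k \<le> 2"
proof -
  have "1 \<le> 5 / (4 * \<rho> k * (1 + L * lam k))" using \<kappa>_ge_1[OF assms] by (simp add: \<kappa>_eq[OF assms])
  moreover have "0 < 4 * \<rho> k * (1 + L * lam k)"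
    using \<rho>_pos[OF assms] Llam_pos[OF assms] by simp
  ultimately have "4 * \<rho> k * (1 + L * lam k) \<le> 5"
    by (simp only: le_divide_eq_1_pos)
  moreover have "4 * \<rho> k * 1 \<le> 4 * \<rho> k * (1 + L * lam k)"
    using \<rho>_pos[OF assms] lam_pos[OF assms] L by (intro mult_left_mono) auto
  ultimately show ?thesis by simp
qed

lemma lam_le: "k \<ge> 1 \<Longrightarrow> lam k \<le> 1 / (4 * L)"
  using lam(1)[of k] by auto

section \<open>The filtration of half-steps and the adaptedness of the process\<close>

definition prior :: "nat \<Rightarrow> (nat \<times> nat) set" where
  "prior k = {(j, t) \<in> sample_indices m. j < k}"

text \<open>Indices of the samples that determine \<open>X k\<close>, \<open>X (k - 1)\<close>, \<open>Z k\<close> (for \<open>JZ\<close>) and \<open>Y k\<close> (for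
  \<open>JY\<close>); \<open>Inl\<close> tags the samples \<open>xi\<close> and \<open>Inr\<close> the samples \<open>eta\<close>.\<close>

definition JZ :: "nat \<Rightarrow> (nat \<times> nat + nat \<times> nat) set" where
  "JZ k = prior k <+> prior k"

definition JY :: "nat \<Rightarrow> (nat \<times> nat + nat \<times> nat) set" where
  "JY k = prior (Suc k) <+> prior k"

lemma JZ_subset: "JZ k \<subseteq> sample_indices m <+> sample_indices m"
  and JY_subset: "JY k \<subseteq> sample_indices m <+> sample_indices m"
  by (auto simp: JZ_def JY_def prior_def)

lemma JY_eq: "k \<ge> 1 \<Longrightarrow> JY k = JZ k \<union> (\<lambda>t. Inl (k, t)) ` {1..m k}"
  and JZ_Suc: "k \<ge> 1 \<Longrightarrow> JZ (Suc k) = JY k \<union> (\<lambda>t. Inr (k, t)) ` {1..m k}"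
  by (auto simp: JY_def JZ_def prior_def sample_indices_def less_Suc_eq)

lemma JZ_JY: "JZ k \<subseteq> JY k" and JY_JZ: "JY k \<subseteq> JZ (Suc k)"
  by (auto simp: JY_def JZ_def prior_def)

lemma Inl_new: "k \<ge> 1 \<Longrightarrow> (\<lambda>t. Inl (k, t)) ` {1..m k} \<subseteq> (sample_indices m <+> sample_indices m) - JZ k"
  and Inr_new: "k \<ge> 1 \<Longrightarrow> (\<lambda>t. Inr (k, t)) ` {1..m k} \<subseteq> (sample_indices m <+> sample_indices m) - JY k"
  by (auto simp: JY_def JZ_def prior_def sample_indices_def)

text \<open>The error of the forward evaluation at Z, drawn before Y is formed; \<open>U\<close> is
  the error of the correction at Y, drawn afterwards.\<close>

definition W :: "nat \<Rightarrow> 'w \<Rightarrow> 'h" where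
  "W k = batch_err (m k) (\<lambda>t. Inl (k, t)) (Z k)"

definition U :: "nat \<Rightarrow> 'w \<Rightarrow> 'h" where
  "U k = batch_err (m k) (\<lambda>t. Inr (k, t)) (Y k)"

lemma X_0: "\<omega> \<in> space M \<Longrightarrow> X 0 \<omega> = x0" and X_1: "\<omega> \<in> space M \<Longrightarrow> X (Suc 0) \<omega> = x1"
  using process by (auto simp: risfbf_process_def)

lemma Z_eq: "\<omega> \<in> space M \<Longrightarrow> k \<ge> 1 \<Longrightarrow> Z k \<omega> = X k \<omega> + \<alpha> k *\<^sub>R (X k \<omega> - X (k - 1) \<omega>)"
  using process by (auto simp: risfbf_process_def Let_def)

lemma Y_eq: "\<omega> \<in> space M \<Longrightarrow> k \<ge> 1 \<Longrightarrow>
    Y k \<omega> = resolvent (lam k) T (Z k \<omega> - lam k *\<^sub>R (W k \<omega> + V (Z k \<omega>)))"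
  using process by (auto simp: risfbf_process_def Let_def W_def batch_err_def)

lemma X_eq: "\<omega> \<in> space M \<Longrightarrow> k \<ge> 1 \<Longrightarrow> X (Suc k) \<omega> = (1 - \<rho> k) *\<^sub>R Z k \<omega> +
    \<rho> k *\<^sub>R (Y k \<omega> + lam k *\<^sub>R ((W k \<omega> + V (Z k \<omega>)) - (U k \<omega> + V (Y k \<omega>))))"
  using process by (auto simp: risfbf_process_def Let_def W_def U_def batch_err_def)

lemma inj_Inl_pair: "inj_on (\<lambda>t. Inl (k, t)) A" and inj_Inr_pair: "inj_on (\<lambda>t. Inr (k, t)) A"
  by (auto simp: inj_on_def)

text \<open>The lemmas ending in \<open>_if\<close> treat the half-steps of one iteration under the
  assumption that its input is admissible; the induction in \<open>adm_X\<close> discharges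
  it.\<close>

lemma adm_Z_if:
  assumes k: "k \<ge> 1" and X: "adm (JZ k) (X k)" "adm (JZ k) (X (k - 1))"
  shows "adm (JZ k) (Z k)"
proof (rule adm_cong)
  show "adm (JZ k) (\<lambda>\<omega>. X k \<omega> + \<alpha> k *\<^sub>R (X k \<omega> - X (k - 1) \<omega>))"
    by (intro adm_add adm_scaleR adm_diff JZ_subset X)
qed (rule Z_eq[OF _ k, symmetric])

lemma adm_W_if:
  assumes k: "k \<ge> 1" and Z: "adm (JZ k) (Z k)"
  shows "adm (JY k) (W k)" "expectation (\<lambda>\<omega>. (norm (W k \<omega>))\<^sup>2) \<le> \<sigma>\<^sup>2 / real (m k)"
  using adm_batch_err[OF JZ_subset Inl_new[OF k] inj_Inl_pair batch(1)[OF k] Z]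
  by (simp_all add: W_def JY_eq[OF k])

lemma adm_Y_if:
  assumes k: "k \<ge> 1" and Z: "adm (JZ k) (Z k)"
  shows "adm (JY k) (Y k)"
proof (rule adm_cong)
  have ZY: "adm (JY k) (Z k)" by (rule adm_mono[OF Z JZ_JY JY_subset])
  have lip: "1-lipschitz_on UNIV (resolvent (lam k) T)"
    using resolvent_nonexpansive[OF T lam_pos[OF k]] by (intro lipschitz_onI) (auto simp: dist_norm)
  have "adm (JY k) (\<lambda>\<omega>. Z k \<omega> - lam k *\<^sub>R (W k \<omega> + V (Z k \<omega>)))"
    by (intro adm_add adm_scaleR adm_diff JY_subset ZY adm_W_if[OF k Z] adm_lipschitz[OF JY_subset ZY L(2)])
  from adm_lipschitz[OF JY_subset this lip]
  show "adm (JY k) (\<lambda>\<omega>. resolvent (lam k) T (Z k \<omega> - lam k *\<^sub>R (W k \<omega> + V (Z k \<omega>))))"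
    .
qed (rule Y_eq[OF _ k, symmetric])

lemma adm_U_if:
  assumes k: "k \<ge> 1" and Y: "adm (JY k) (Y k)"
  shows "adm (JZ (Suc k)) (U k)" "expectation (\<lambda>\<omega>. (norm (U k \<omega>))\<^sup>2) \<le> \<sigma>\<^sup>2 / real (m k)"
  using adm_batch_err[OF JY_subset Inr_new[OF k] inj_Inr_pair batch(1)[OF k] Y]
  by (simp_all add: U_def JZ_Suc[OF k])

lemma adm_X_Suc_if:
  assumes k: "k \<ge> 1" and Z: "adm (JZ k) (Z k)"
  shows "adm (JZ (Suc k)) (X (Suc k))"
proof (rule adm_cong)
  note sub = JZ_subset[of "Suc k"]
  have Y: "adm (JY k) (Y k)" by (rule adm_Y_if[OF k Z])
  have Z': "adm (JZ (Suc k)) (Z k)"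
    by (rule adm_mono[OF Z order_trans[OF JZ_JY JY_JZ] sub])
  have Y': "adm (JZ (Suc k)) (Y k)" by (rule adm_mono[OF Y JY_JZ sub])
  have W': "adm (JZ (Suc k)) (W k)" by (rule adm_mono[OF adm_W_if(1)[OF k Z] JY_JZ sub])
  show "adm (JZ (Suc k)) (\<lambda>\<omega>. (1 - \<rho> k) *\<^sub>R Z k \<omega> +
      \<rho> k *\<^sub>R (Y k \<omega> + lam k *\<^sub>R ((W k \<omega> + V (Z k \<omega>)) - (U k \<omega> + V (Y k \<omega>)))))"
    by (intro adm_add adm_scaleR adm_diff sub Z' Y' W' adm_U_if(1)[OF k Y]
        adm_lipschitz[OF sub Z' L(2)] adm_lipschitz[OF sub Y' L(2)])
qed (rule X_eq[OF _ k, symmetric])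

text \<open>The induction carries two consecutive iterates, because inertia makes Z k depend on
  both.\<close>

lemma adm_X: assumes "k \<ge> 1" shows "adm (JZ k) (X k) \<and> adm (JZ k) (X (k - 1))"
  using assms
proof (induction k rule: dec_induct)
  case base
  have "adm (JZ 1) (X 1)" by (rule adm_cong[OF adm_const[of _ x1]]) (simp add: X_1)
  moreover have "adm (JZ 1) (X 0)" by (rule adm_cong[OF adm_const[of _ x0]]) (simp add: X_0)
  ultimately show ?case by simp
next
  case (step k)
  have "adm (JZ k) (Z k)" using step by (intro adm_Z_if) auto
  with step.hyps have "adm (JZ (Suc k)) (X (Suc k))" by (intro adm_X_Suc_if)
  moreover have "adm (JZ (Suc k)) (X k)"
    using step.IH by (intro adm_mono[OF _ order_trans[OF JZ_JY JY_JZ] JZ_subset]) auto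
  ultimately show ?case by simp
qed

lemma adm_Z: "k \<ge> 1 \<Longrightarrow> adm (JZ k) (Z k)"
  using adm_X adm_Z_if by blast

lemma adm_Y: "k \<ge> 1 \<Longrightarrow> adm (JY k) (Y k)"
  using adm_Z adm_Y_if by blast

lemmas adm_W = adm_W_if(1)[OF _ adm_Z] and W_sq = adm_W_if(2)[OF _ adm_Z]
lemmas adm_U = adm_U_if(1)[OF _ adm_Y] and U_sq = adm_U_if(2)[OF _ adm_Y]

section \<open>Lyapunov function, decay and noise along the process\<close>

abbreviation solutions :: "'h set" where
  "solutions \<equiv> zeros_op (sum_op T (single_op V))"

definition H :: "'h \<Rightarrow> nat \<Rightarrow> 'w \<Rightarrow> real" where
  "H p k \<omega> = (norm (X k \<omega> - p))\<^sup>2 - \<alpha> k * (norm (X (k - 1) \<omega> - p))\<^sup>2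
    + ac k * (norm (X k \<omega> - X (k - 1) \<omega>))\<^sup>2"

definition decay :: "nat \<Rightarrow> 'w \<Rightarrow> real" where
  "decay k \<omega> = gain k * (norm (X k \<omega> - X (k - 1) \<omega>))\<^sup>2 + 3 / 32 * \<rho> k * (norm (Z k \<omega> - Y k \<omega>))\<^sup>2"

definition bias :: "nat \<Rightarrow> 'w \<Rightarrow> real" where
  "bias k \<omega> = 5 / 2 * \<rho> k * (lam k)\<^sup>2 * (norm (W k \<omega> - U k \<omega>))\<^sup>2"

text \<open>The weight stands on the second argument so that it is part of the vector known before
  the samples of U k are drawn, as the lemmas on batch errors require.\<close>

definition mart :: "'h \<Rightarrow> nat \<Rightarrow> 'w \<Rightarrow> real" where
  "mart p k \<omega> = inner (U k \<omega>) ((2 * \<rho> k * lam k) *\<^sub>R (Y k \<omega> - p))"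

lemma H_step:
  assumes p: "p \<in> solutions" and \<omega>: "\<omega> \<in> space M" and k: "k \<ge> 1"
  shows "H p (Suc k) \<omega> \<le> H p k \<omega> - decay k \<omega> + (bias k \<omega> - mart p k \<omega>)"
proof -
  have p': "- V p \<in> T p" using p by (simp add: zeros_op_sum_iff)
  have mono: "\<alpha> k \<le> \<alpha> (Suc k)" using mono_onD[OF \<alpha>(2), of k "Suc k"] k by simp
  have "ac (Suc k) \<le> (1 - \<alpha> k) * (\<kappa> k - 1)" using ac_antimono[OF k] by (simp add: ac_def)
  from risfbf_lyapunov_step[OF T V L(2) lam_pos[OF k] lam_small[OF k] less_imp_le[OF L(1)] \<rho>_pos[OF k] p'
    Z_eq[OF \<omega> k] Y_eq[OF \<omega> k] X_eq[OF \<omega> k] \<kappa>_eq[OF k] \<kappa>_ge_1[OF k] \<alpha>(1)[OF k] mono this]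
  show ?thesis
    unfolding H_def decay_def bias_def mart_def gain_def[of k] ac_def[of k]
    by (simp add: mult.assoc)
qed

lemma H_lower:
  assumes k: "k \<ge> 1"
  shows "(1 - \<alpha>bar) / 2 * (norm (X k \<omega> - p))\<^sup>2 \<le> H p k \<omega>"
proof -
  have "(1 - \<alpha>bar) / 2 * (norm (X k \<omega> - p))\<^sup>2 \<le> (1 - \<alpha> k) / 2 * (norm (X k \<omega> - p))\<^sup>2"
    using \<alpha>_le[OF k] by (intro mult_right_mono) auto
  also have "\<dots> \<le> H p k \<omega>"
    unfolding H_def using \<alpha>_le[OF k] \<alpha>(1)[OF k] \<alpha>_ac[OF k] bars by (intro lyapunov_lower) auto
  finally show ?thesis .
qed

lemma H_nonneg: assumes "k \<ge> 1" shows "0 \<le> H p k \<omega>"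
proof -
  have "0 \<le> (1 - \<alpha>bar) / 2 * (norm (X k \<omega> - p))\<^sup>2" using bars by simp
  also note H_lower[OF assms]
  finally show ?thesis .
qed

lemma decay_ge:
  assumes "k \<ge> 1"
  shows "\<beta> * (norm (X k \<omega> - X (k - 1) \<omega>))\<^sup>2 \<le> decay k \<omega>"
    and "3 / 64 * c0 * (norm (Z k \<omega> - Y k \<omega>))\<^sup>2 \<le> decay k \<omega>"
    and "gain k * (norm (X k \<omega> - X (k - 1) \<omega>))\<^sup>2 \<le> decay k \<omega>"
    and "0 \<le> decay k \<omega>"
proof -
  have 1: "\<beta> * (norm (X k \<omega> - X (k - 1) \<omega>))\<^sup>2 \<le> gain k * (norm (X k \<omega> - X (k - 1) \<omega>))\<^sup>2"
    using gain_ge[OF assms] by (intro mult_right_mono) auto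
  have 2: "3 / 64 * c0 * (norm (Z k \<omega> - Y k \<omega>))\<^sup>2 \<le> 3 / 32 * \<rho> k * (norm (Z k \<omega> - Y k \<omega>))\<^sup>2"
    using \<rho>_ge[OF assms] by (intro mult_right_mono) auto
  have 3: "0 \<le> \<beta> * (norm (X k \<omega> - X (k - 1) \<omega>))\<^sup>2" "0 \<le> 3 / 64 * c0 * (norm (Z k \<omega> - Y k \<omega>))\<^sup>2"
    using \<beta>_pos c0_pos by auto
  show "\<beta> * (norm (X k \<omega> - X (k - 1) \<omega>))\<^sup>2 \<le> decay k \<omega>"
    "3 / 64 * c0 * (norm (Z k \<omega> - Y k \<omega>))\<^sup>2 \<le> decay k \<omega>"
    "gain k * (norm (X k \<omega> - X (k - 1) \<omega>))\<^sup>2 \<le> decay k \<omega>" "0 \<le> decay k \<omega>"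
    using 1 2 3 unfolding decay_def by linarith+
qed

lemma noise_coeff_le: assumes "k \<ge> 1" shows "5 / 2 * \<rho> k * (lam k)\<^sup>2 \<le> 5 * (1 / (4 * L))\<^sup>2"
proof -
  have "(lam k)\<^sup>2 \<le> (1 / (4 * L))\<^sup>2"
    using lam_le[OF assms] lam_pos[OF assms] by (intro power_mono) auto
  then have "\<rho> k * (lam k)\<^sup>2 \<le> 2 * (1 / (4 * L))\<^sup>2"
    using \<rho>_le[OF assms] by (intro mult_mono) auto
  then show ?thesis by simp
qed

lemma bias_le:
  assumes "k \<ge> 1"
  shows "bias k \<omega> \<le> 5 * (1 / (4 * L))\<^sup>2 * (2 * (norm (W k \<omega>))\<^sup>2 + 2 * (norm (U k \<omega>))\<^sup>2)"
  unfolding bias_def by (rule mult_mono[OF noise_coeff_le[OF assms] norm_diff_sq_le]) auto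

lemma bias_nonneg: "k \<ge> 1 \<Longrightarrow> 0 \<le> bias k \<omega>"
  unfolding bias_def using \<rho>_pos[of k] by simp

lemma adm_next:
  assumes "k \<ge> 1"
  shows "adm (JZ (Suc k)) (X k)" "adm (JZ (Suc k)) (X (k - 1))" "adm (JZ (Suc k)) (X (Suc k))"
    "adm (JZ (Suc k)) (Z k)" "adm (JZ (Suc k)) (Y k)" "adm (JZ (Suc k)) (W k)" "adm (JZ (Suc k)) (U k)"
proof -
  note sub = JZ_subset[of "Suc k"] and le = order_trans[OF JZ_JY JY_JZ, of k]
  show "adm (JZ (Suc k)) (X k)" "adm (JZ (Suc k)) (X (k - 1))"
    using adm_X[OF assms] adm_mono[OF _ le sub] by blast+
  show "adm (JZ (Suc k)) (X (Suc k))" using adm_X[of "Suc k"] by simp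
  show "adm (JZ (Suc k)) (Z k)" by (rule adm_mono[OF adm_Z[OF assms] le sub])
  show "adm (JZ (Suc k)) (Y k)" by (rule adm_mono[OF adm_Y[OF assms] JY_JZ sub])
  show "adm (JZ (Suc k)) (W k)" by (rule adm_mono[OF adm_W[OF assms assms] JY_JZ sub])
  show "adm (JZ (Suc k)) (U k)" by (rule adm_U[OF assms assms])
qed

lemma int_diff:
  assumes "adm (JZ k) f" "adm (JZ k) g"
  shows "integrable M (\<lambda>\<omega>. (norm (f \<omega> - g \<omega>))\<^sup>2)"
  by (rule adm_int[OF adm_diff[OF JZ_subset assms]])

lemma int_X: "integrable M (\<lambda>\<omega>. (norm (X k \<omega> - p))\<^sup>2)"
proof (cases k)
  case 0
  have "adm (JZ 1) (\<lambda>\<omega>. X 0 \<omega> - p)"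
    using adm_X[of 1] by (intro adm_diff JZ_subset adm_const) auto
  then show ?thesis using 0 adm_int by blast
next
  case (Suc j)
  then have "adm (JZ k) (\<lambda>\<omega>. X k \<omega> - p)"
    using adm_X[of k] by (intro adm_diff JZ_subset adm_const) auto
  then show ?thesis by (rule adm_int)
qed

lemma int_dX: "k \<ge> 1 \<Longrightarrow> integrable M (\<lambda>\<omega>. (norm (X k \<omega> - X (k - 1) \<omega>))\<^sup>2)"
  and int_ZY: "k \<ge> 1 \<Longrightarrow> integrable M (\<lambda>\<omega>. (norm (Z k \<omega> - Y k \<omega>))\<^sup>2)"
  and int_WU: "k \<ge> 1 \<Longrightarrow> integrable M (\<lambda>\<omega>. (norm (W k \<omega> - U k \<omega>))\<^sup>2)"
  using adm_next[of k] int_diff[of "Suc k"] by auto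

lemma int_W: "k \<ge> 1 \<Longrightarrow> integrable M (\<lambda>\<omega>. (norm (W k \<omega>))\<^sup>2)"
  and int_U: "k \<ge> 1 \<Longrightarrow> integrable M (\<lambda>\<omega>. (norm (U k \<omega>))\<^sup>2)"
  using adm_int adm_W adm_U by blast+

lemma adm_Yp: "k \<ge> 1 \<Longrightarrow> adm (JY k) (\<lambda>\<omega>. Y k \<omega> - p)"
  by (intro adm_diff JY_subset adm_Y adm_const)

lemma int_Y: "k \<ge> 1 \<Longrightarrow> integrable M (\<lambda>\<omega>. (norm (Y k \<omega> - p))\<^sup>2)"
  by (rule adm_int[OF adm_Yp])

lemma int_H: "k \<ge> 1 \<Longrightarrow> integrable M (H p k)"
  unfolding H_def[abs_def] using int_X[of k p] int_X[of "k - 1" p] int_dX[of k] by simp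

lemma int_decay: "k \<ge> 1 \<Longrightarrow> integrable M (decay k)"
  unfolding decay_def[abs_def] using int_dX[of k] int_ZY[of k] by simp

lemma int_bias: "k \<ge> 1 \<Longrightarrow> integrable M (bias k)"
  unfolding bias_def[abs_def] using int_WU[of k] by simp

lemma adm_G: "k \<ge> 1 \<Longrightarrow> adm (JY k) (\<lambda>\<omega>. c *\<^sub>R (Y k \<omega> - p))"
  by (intro adm_scaleR adm_Yp)

lemma int_mart_sq:
  assumes k: "k \<ge> 1"
  shows "integrable M (\<lambda>\<omega>. (mart p k \<omega>)\<^sup>2)"
    and "expectation (\<lambda>\<omega>. (mart p k \<omega>)\<^sup>2) \<le> \<sigma>\<^sup>2 / real (m k) * ((1 / L)\<^sup>2 * expectation (\<lambda>\<omega>. (norm (Y k \<omega> - p))\<^sup>2))"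
proof -
  note * = adm_norm_batch_err[OF JY_subset Inr_new[OF k] inj_Inr_pair batch(1)[OF k] adm_Y[OF k] adm_G[OF k, of "2 * \<rho> k * lam k" p]]
  show "integrable M (\<lambda>\<omega>. (mart p k \<omega>)\<^sup>2)"
    using *(1) by (simp add: mart_def U_def)
  \<comment> \<open>The relaxation is at most 2 and the step size at most 1 / (4 L), so the weight
    is at most 1 / L.\<close>
  have "2 * \<rho> k * lam k \<le> 2 * 2 * (1 / (4 * L))"
    using \<rho>_le[OF k] \<rho>_pos[OF k] lam_le[OF k] lam_pos[OF k] L by (intro mult_mono) auto
  then have "(2 * \<rho> k * lam k)\<^sup>2 \<le> (1 / L)\<^sup>2"
    using \<rho>_pos[OF k] lam_pos[OF k] by (intro power_mono) auto
  then have le: "(2 * \<rho> k * lam k)\<^sup>2 * expectation (\<lambda>\<omega>. (norm (Y k \<omega> - p))\<^sup>2)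
      \<le> (1 / L)\<^sup>2 * expectation (\<lambda>\<omega>. (norm (Y k \<omega> - p))\<^sup>2)"
    by (intro mult_right_mono) auto
  have sc: "(norm (c *\<^sub>R v))\<^sup>2 = c\<^sup>2 * (norm v)\<^sup>2" for c and v :: 'h
    by (simp add: power_mult_distrib)
  have "expectation (\<lambda>\<omega>. (mart p k \<omega>)\<^sup>2)
      \<le> \<sigma>\<^sup>2 / real (m k) * expectation (\<lambda>\<omega>. (norm ((2 * \<rho> k * lam k) *\<^sub>R (Y k \<omega> - p)))\<^sup>2)"
    using *(2) by (simp only: mart_def U_def)
  also have "expectation (\<lambda>\<omega>. (norm ((2 * \<rho> k * lam k) *\<^sub>R (Y k \<omega> - p)))\<^sup>2)
      = (2 * \<rho> k * lam k)\<^sup>2 * expectation (\<lambda>\<omega>. (norm (Y k \<omega> - p))\<^sup>2)"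
    by (simp only: sc integral_mult_right_zero)
  also have "\<sigma>\<^sup>2 / real (m k) * \<dots> \<le> \<sigma>\<^sup>2 / real (m k) * ((1 / L)\<^sup>2 * expectation (\<lambda>\<omega>. (norm (Y k \<omega> - p))\<^sup>2))"
    using le by (intro mult_left_mono) auto
  finally show "expectation (\<lambda>\<omega>. (mart p k \<omega>)\<^sup>2) \<le> \<sigma>\<^sup>2 / real (m k) * ((1 / L)\<^sup>2 * expectation (\<lambda>\<omega>. (norm (Y k \<omega> - p))\<^sup>2))" .
qed

lemma mart_past: "k \<ge> 1 \<Longrightarrow> mart p k \<in> borel_measurable (past (JZ (Suc k)))"
  unfolding mart_def[abs_def]
  using adm_U[of k] adm_mono[OF adm_G[of k "2 * \<rho> k * lam k" p] JY_JZ JZ_subset]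
  by (intro borel_measurable_inner) (auto simp: adm_def)

lemma int_mart: assumes "k \<ge> 1" shows "integrable M (mart p k)"
  using past_M[OF mart_past[OF assms] JZ_subset] int_mart_sq(1)[OF assms]
  by (rule square_integrable_imp_integrable)

text \<open>A multiplier known together with Y k is absorbed into the tested vector, and its
  boundedness keeps that vector square integrable. The case h = 1 gives mean zero; the general case
  is the orthogonality needed for Kolmogorov's inequality.\<close>

lemma expectation_mart:
  assumes k: "k \<ge> 1" and h: "h \<in> borel_measurable (past (JY k))" "\<And>\<omega>. \<bar>h \<omega>\<bar> \<le> B"
  shows "expectation (\<lambda>\<omega>. h \<omega> * mart p k \<omega>) = 0"
proof -
  let ?G = "\<lambda>\<omega>. h \<omega> *\<^sub>R ((2 * \<rho> k * lam k) *\<^sub>R (Y k \<omega> - p))"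
  have G: "adm (JY k) (\<lambda>\<omega>. (2 * \<rho> k * lam k) *\<^sub>R (Y k \<omega> - p))" by (rule adm_G[OF k])
  have meas: "?G \<in> borel_measurable (past (JY k))"
    by (rule borel_measurable_scaleR[OF h(1) conjunct1[OF G[unfolded adm_def]]])
  have "integrable M (\<lambda>\<omega>. (norm (?G \<omega>))\<^sup>2)"
  proof (rule Bochner_Integration.integrable_bound)
    show "integrable M (\<lambda>\<omega>. B\<^sup>2 * (norm ((2 * \<rho> k * lam k) *\<^sub>R (Y k \<omega> - p)))\<^sup>2)"
      using adm_int[OF G] by (rule integrable_mult_right)
    show "(\<lambda>\<omega>. (norm (?G \<omega>))\<^sup>2) \<in> borel_measurable M"
      by (rule measurable_compose[OF past_M[OF meas JY_subset]]) measurable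
    have "(norm (?G \<omega>))\<^sup>2 \<le> B\<^sup>2 * (norm ((2 * \<rho> k * lam k) *\<^sub>R (Y k \<omega> - p)))\<^sup>2" for \<omega>
    proof -
      have "\<bar>h \<omega>\<bar>\<^sup>2 \<le> B\<^sup>2" by (rule power_mono[OF h(2)]) simp
      then have "(h \<omega>)\<^sup>2 \<le> B\<^sup>2" by simp
      then have "(h \<omega>)\<^sup>2 * (norm ((2 * \<rho> k * lam k) *\<^sub>R (Y k \<omega> - p)))\<^sup>2
          \<le> B\<^sup>2 * (norm ((2 * \<rho> k * lam k) *\<^sub>R (Y k \<omega> - p)))\<^sup>2"
        by (rule mult_right_mono) simp
      moreover have "(norm (c *\<^sub>R v))\<^sup>2 = c\<^sup>2 * (norm v)\<^sup>2" for c and v :: 'h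
        by (simp add: power_mult_distrib)
      ultimately show ?thesis by metis
    qed
    then show "AE \<omega> in M. norm ((norm (?G \<omega>))\<^sup>2) \<le> norm (B\<^sup>2 * (norm ((2 * \<rho> k * lam k) *\<^sub>R (Y k \<omega> - p)))\<^sup>2)"
      by (intro AE_I2) (metis abs_ge_self abs_power2 order_trans real_norm_def)
  qed
  from expectation_inner_batch_err[OF JY_subset Inr_new[OF k] batch(1)[OF k] _ meas this, of "Y k"] adm_Y[OF k]
  have "expectation (\<lambda>\<omega>. inner (U k \<omega>) (?G \<omega>)) = 0"
    by (simp add: adm_def U_def)
  then show ?thesis by (simp only: mart_def inner_scaleR_right)
qed

section \<open>Bounds in expectation and almost sure summability of the noise\<close>

text \<open>The first factor bounds the weight in \<open>bias\<close>; 4 \<sigma>^2 comes from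
  splitting |W - U|^2 into twice each square, each of mean at most \<sigma>^2 / m k.\<close>

definition B0 :: real where "B0 = 5 * (1 / (4 * L))\<^sup>2 * (4 * \<sigma>\<^sup>2)"

lemma expectation_bias_le:
  assumes k: "k \<ge> 1"
  shows "expectation (bias k) \<le> B0 * (1 / real (m k))"
proof -
  have "expectation (bias k) \<le> expectation (\<lambda>\<omega>. 5 * (1 / (4 * L))\<^sup>2 * (2 * (norm (W k \<omega>))\<^sup>2 + 2 * (norm (U k \<omega>))\<^sup>2))"
    using int_W[OF k] int_U[OF k] by (intro integral_mono int_bias k bias_le) auto
  also have "\<dots> = 5 * (1 / (4 * L))\<^sup>2 * (2 * expectation (\<lambda>\<omega>. (norm (W k \<omega>))\<^sup>2) + 2 * expectation (\<lambda>\<omega>. (norm (U k \<omega>))\<^sup>2))"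
    using int_W[OF k] int_U[OF k] by simp
  also have "\<dots> \<le> 5 * (1 / (4 * L))\<^sup>2 * (2 * (\<sigma>\<^sup>2 / real (m k)) + 2 * (\<sigma>\<^sup>2 / real (m k)))"
    using W_sq[OF k k] U_sq[OF k k] by (intro mult_left_mono add_mono) auto
  also have "\<dots> = B0 * (1 / real (m k))" by (simp add: B0_def)
  finally show ?thesis .
qed

lemma expectation_H_step:
  assumes p: "p \<in> solutions" and k: "k \<ge> 1"
  shows "expectation (H p (Suc k)) \<le> expectation (H p k) - expectation (decay k) + expectation (bias k)"
proof -
  have "expectation (mart p k) = 0"
    using expectation_mart[OF k borel_measurable_const[of 1], of 1 p] by simp
  moreover have "expectation (H p (Suc k)) \<le> expectation (\<lambda>\<omega>. H p k \<omega> - decay k \<omega> + (bias k \<omega> - mart p k \<omega>))"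
    using int_H[of k p] int_H[of "Suc k" p] int_decay[OF k] int_bias[OF k] int_mart[OF k, of p] k H_step[OF p]
    by (intro integral_mono_AE AE_I2) auto
  ultimately show ?thesis
    using int_H[OF k, of p] int_decay[OF k] int_bias[OF k] int_mart[OF k, of p] by simp
qed

text \<open>In the mean the martingale term disappears, so the deterministic lemma applies with the
  summable bias alone.\<close>

lemma expectation_bounds:
  assumes p: "p \<in> solutions"
  shows "convergent (\<lambda>n. expectation (H p (Suc n)))" "summable (\<lambda>n. expectation (decay (Suc n)))"
proof -
  have summ: "summable (\<lambda>n. expectation (bias (Suc n)))"
  proof (rule summable_comparison_test')
    show "summable (\<lambda>n. B0 * (1 / real (m (Suc n))))"
      using batch(2) by (rule summable_mult)
    show "norm (expectation (bias (Suc n))) \<le> B0 * (1 / real (m (Suc n)))" if "n \<ge> 0" for n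
      using expectation_bias_le[of "Suc n"] bias_nonneg[of "Suc n"] by (simp add: integral_nonneg_AE)
  qed
  note * = almost_decreasing_convergent[of "\<lambda>n. expectation (H p (Suc n))" "\<lambda>n. expectation (decay (Suc n))"
      "\<lambda>n. expectation (bias (Suc n))", OF expectation_H_step[OF p] _ _ summ]
  have nn: "0 \<le> expectation (H p (Suc n))" "0 \<le> expectation (decay (Suc n))" for n
    by (intro integral_nonneg_AE AE_I2 H_nonneg decay_ge(4); simp)+
  show "convergent (\<lambda>n. expectation (H p (Suc n)))" "summable (\<lambda>n. expectation (decay (Suc n)))"
    by (rule *; simp add: nn)+
qed

lemma expectation_X_bounded:
  assumes p: "p \<in> solutions"
  obtains C where "\<And>k. expectation (\<lambda>\<omega>. (norm (X k \<omega> - p))\<^sup>2) \<le> C" "0 \<le> C"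
proof -
  obtain B where B: "\<And>n. \<bar>expectation (H p (Suc n))\<bar> \<le> B"
    using convergent_imp_Bseq[OF expectation_bounds(1)[OF p]] by (auto simp: Bseq_def)
  \<comment> \<open>The Lyapunov function controls the distance from index 1 on only, so X 0 is
    added by hand.\<close>
  define C where "C = max (B / ((1 - \<alpha>bar) / 2)) (expectation (\<lambda>\<omega>. (norm (X 0 \<omega> - p))\<^sup>2))"
  have "expectation (\<lambda>\<omega>. (norm (X k \<omega> - p))\<^sup>2) \<le> C" for k
  proof (cases k)
    case (Suc n)
    have "(1 - \<alpha>bar) / 2 * expectation (\<lambda>\<omega>. (norm (X k \<omega> - p))\<^sup>2) \<le> expectation (H p k)"
      using int_X[of k p] Suc H_lower[of k _ p]
      by (subst integral_mult_right_zero[symmetric], intro integral_mono int_H) auto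
    also have "\<dots> \<le> B" using B[of n] Suc by simp
    finally have "expectation (\<lambda>\<omega>. (norm (X k \<omega> - p))\<^sup>2) \<le> B / ((1 - \<alpha>bar) / 2)"
      using bars by (simp add: field_simps)
    then show ?thesis by (simp add: C_def)
  qed (simp add: C_def)
  moreover have "0 \<le> C" unfolding C_def by (rule max.coboundedI2) simp
  ultimately show thesis by (rule that)
qed

lemma summable_expectation_ZY: "summable (\<lambda>n. expectation (\<lambda>\<omega>. (norm (Z (Suc n) \<omega> - Y (Suc n) \<omega>))\<^sup>2))"
proof -
  obtain p where p: "p \<in> solutions" using solvable by blast
  show ?thesis
  proof (rule summable_comparison_test')
    show "summable (\<lambda>n. (1 / (3 / 64 * c0)) * expectation (decay (Suc n)))"
      by (intro summable_mult expectation_bounds(2)[OF p])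
    show "norm (expectation (\<lambda>\<omega>. (norm (Z (Suc n) \<omega> - Y (Suc n) \<omega>))\<^sup>2))
        \<le> (1 / (3 / 64 * c0)) * expectation (decay (Suc n))" if "n \<ge> 0" for n
    proof -
      have "expectation (\<lambda>\<omega>. 3 / 64 * c0 * (norm (Z (Suc n) \<omega> - Y (Suc n) \<omega>))\<^sup>2) \<le> expectation (decay (Suc n))"
        using int_ZY[of "Suc n"] by (intro integral_mono int_decay decay_ge) auto
      then have "3 / 64 * c0 * expectation (\<lambda>\<omega>. (norm (Z (Suc n) \<omega> - Y (Suc n) \<omega>))\<^sup>2) \<le> expectation (decay (Suc n))"
        by (simp only: integral_mult_right_zero)
      then show ?thesis using c0_pos by (simp add: field_simps)
    qed
  qed
qed

text \<open>Needed for the variances of the martingale differences. Y is reached from X by way of Z,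
  at the cost of E|Z - Y|^2, which is bounded because it is summable.\<close>

lemma expectation_Y_bounded:
  assumes p: "p \<in> solutions"
  obtains C where "\<And>n. expectation (\<lambda>\<omega>. (norm (Y (Suc n) \<omega> - p))\<^sup>2) \<le> C" "0 \<le> C"
proof -
  obtain CX where CX: "\<And>k. expectation (\<lambda>\<omega>. (norm (X k \<omega> - p))\<^sup>2) \<le> CX" "0 \<le> CX"
    using expectation_X_bounded[OF p] by blast
  define CZ where "CZ = (\<Sum>n. expectation (\<lambda>\<omega>. (norm (Z (Suc n) \<omega> - Y (Suc n) \<omega>))\<^sup>2))"
  have CZ: "expectation (\<lambda>\<omega>. (norm (Z (Suc n) \<omega> - Y (Suc n) \<omega>))\<^sup>2) \<le> CZ" for n
    unfolding CZ_def using sum_le_suminf[OF summable_expectation_ZY, of "{n}"] by simp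
  have CZ0: "0 \<le> CZ" unfolding CZ_def by (intro suminf_nonneg summable_expectation_ZY) simp
  \<comment> \<open>With inertia at most 1, |Z - p|^2 is at most 8 and 2 times the two squared
    distances of X; passing to Y doubles these to 16 and 4 and adds 2 |Z - Y|^2.\<close>
  have "expectation (\<lambda>\<omega>. (norm (Y (Suc n) \<omega> - p))\<^sup>2) \<le> 20 * CX + 2 * CZ" for n
  proof -
    let ?k = "Suc n"
    have pt: "(norm (Y ?k \<omega> - p))\<^sup>2 \<le> 16 * (norm (X ?k \<omega> - p))\<^sup>2 + 4 * (norm (X n \<omega> - p))\<^sup>2
        + 2 * (norm (Z ?k \<omega> - Y ?k \<omega>))\<^sup>2" if \<omega>: "\<omega> \<in> space M" for \<omega>
    proof -
      have a: "0 \<le> \<alpha> ?k" "\<alpha> ?k \<le> 1" using \<alpha>(1)[of ?k] \<alpha>_le[of ?k] bars by auto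
      have "Z ?k \<omega> - p = (1 + \<alpha> ?k) *\<^sub>R (X ?k \<omega> - p) - \<alpha> ?k *\<^sub>R (X n \<omega> - p)"
        using Z_eq[OF \<omega>, of ?k] by (simp add: algebra_simps)
      then have "(norm (Z ?k \<omega> - p))\<^sup>2 \<le> 2 * ((1 + \<alpha> ?k)\<^sup>2 * (norm (X ?k \<omega> - p))\<^sup>2) + 2 * ((\<alpha> ?k)\<^sup>2 * (norm (X n \<omega> - p))\<^sup>2)"
        using norm_diff_sq_le[of "(1 + \<alpha> ?k) *\<^sub>R (X ?k \<omega> - p)" "\<alpha> ?k *\<^sub>R (X n \<omega> - p)"]
        by (simp add: power_mult_distrib)
      also have "\<dots> \<le> 2 * (2\<^sup>2 * (norm (X ?k \<omega> - p))\<^sup>2) + 2 * (1\<^sup>2 * (norm (X n \<omega> - p))\<^sup>2)"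
        using a by (intro add_mono mult_left_mono mult_right_mono power_mono) auto
      finally have "(norm (Z ?k \<omega> - p))\<^sup>2 \<le> 8 * (norm (X ?k \<omega> - p))\<^sup>2 + 2 * (norm (X n \<omega> - p))\<^sup>2" by simp
      moreover have "(norm (Y ?k \<omega> - p))\<^sup>2 \<le> 2 * (norm (Z ?k \<omega> - p))\<^sup>2 + 2 * (norm (Z ?k \<omega> - Y ?k \<omega>))\<^sup>2"
        using norm_diff_sq_le[of "Z ?k \<omega> - p" "Z ?k \<omega> - Y ?k \<omega>"] by simp
      ultimately show ?thesis by linarith
    qed
    have "expectation (\<lambda>\<omega>. (norm (Y ?k \<omega> - p))\<^sup>2) \<le> expectation (\<lambda>\<omega>. 16 * (norm (X ?k \<omega> - p))\<^sup>2
        + 4 * (norm (X n \<omega> - p))\<^sup>2 + 2 * (norm (Z ?k \<omega> - Y ?k \<omega>))\<^sup>2)"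
      using int_X[of ?k p] int_X[of n p] int_ZY[of ?k] pt by (intro integral_mono int_Y) auto
    also have "\<dots> = 16 * expectation (\<lambda>\<omega>. (norm (X ?k \<omega> - p))\<^sup>2)
        + 4 * expectation (\<lambda>\<omega>. (norm (X n \<omega> - p))\<^sup>2) + 2 * expectation (\<lambda>\<omega>. (norm (Z ?k \<omega> - Y ?k \<omega>))\<^sup>2)"
      using int_X[of ?k p] int_X[of n p] int_ZY[of ?k] by simp
    finally show ?thesis using CX(1)[of ?k] CX(1)[of n] CZ[of n] by linarith
  qed
  moreover have "0 \<le> 20 * CX + 2 * CZ" using CX CZ0 by simp
  ultimately show thesis by (rule that)
qed

text \<open>The filtration is read just before the correction samples of each iteration, when Y is
  known and U is still fresh; the difference of one iteration is then known at the same stage of the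
  next.\<close>

lemma AE_summable_mart:
  assumes p: "p \<in> solutions"
  shows "AE \<omega> in M. summable (\<lambda>n. mart p (Suc n) \<omega>)"
proof -
  obtain C where C: "\<And>n. expectation (\<lambda>\<omega>. (norm (Y (Suc n) \<omega> - p))\<^sup>2) \<le> C" "0 \<le> C"
    using expectation_Y_bounded[OF p] by blast
  show ?thesis
  proof (rule martingale_differences_AE_summable[where F = "\<lambda>n. past (JY (Suc n))"])
    show "subalgebra M (past (JY (Suc n)))" for n by (rule subalgebra_past[OF JY_subset])
    show "subalgebra (past (JY (Suc (Suc n)))) (past (JY (Suc n)))" for n
      by (rule subalgebra_past_mono[OF order_trans[OF JY_JZ JZ_JY] JY_subset])
    show "mart p (Suc n) \<in> borel_measurable (past (JY (Suc (Suc n))))" for n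
      by (rule past_mono[OF mart_past JZ_JY JY_subset]) simp
    show "integrable M (\<lambda>\<omega>. (mart p (Suc n) \<omega>)\<^sup>2)" for n by (rule int_mart_sq) simp
    show "expectation (\<lambda>\<omega>. h \<omega> * mart p (Suc n) \<omega>) = 0"
      if "h \<in> borel_measurable (past (JY (Suc n)))" "\<And>\<omega>. \<bar>h \<omega>\<bar> \<le> B" for n h B
      using that by (intro expectation_mart) auto
    show "summable (\<lambda>n. expectation (\<lambda>\<omega>. (mart p (Suc n) \<omega>)\<^sup>2))"
    proof (rule summable_comparison_test')
      show "summable (\<lambda>n. (\<sigma>\<^sup>2 * ((1 / L)\<^sup>2 * C)) * (1 / real (m (Suc n))))"
        using batch(2) by (rule summable_mult)
      show "norm (expectation (\<lambda>\<omega>. (mart p (Suc n) \<omega>)\<^sup>2)) \<le> (\<sigma>\<^sup>2 * ((1 / L)\<^sup>2 * C)) * (1 / real (m (Suc n)))"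
        if "n \<ge> 0" for n
      proof -
        have "\<sigma>\<^sup>2 / real (m (Suc n)) * ((1 / L)\<^sup>2 * expectation (\<lambda>\<omega>. (norm (Y (Suc n) \<omega> - p))\<^sup>2))
            \<le> \<sigma>\<^sup>2 / real (m (Suc n)) * ((1 / L)\<^sup>2 * C)"
          using C by (intro mult_left_mono) auto
        with int_mart_sq(2)[of "Suc n" p] show ?thesis by simp
      qed
    qed
  qed
qed

lemma AE_summable_errors:
  "AE \<omega> in M. summable (\<lambda>n. (norm (W (Suc n) \<omega>))\<^sup>2)"
  "AE \<omega> in M. summable (\<lambda>n. (norm (U (Suc n) \<omega>))\<^sup>2)"
proof -
  have "summable (\<lambda>n. \<sigma>\<^sup>2 * (1 / real (m (Suc n))))" using batch(2) by (rule summable_mult)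
  then have "summable (\<lambda>n. expectation (\<lambda>\<omega>. (norm (W (Suc n) \<omega>))\<^sup>2))"
    "summable (\<lambda>n. expectation (\<lambda>\<omega>. (norm (U (Suc n) \<omega>))\<^sup>2))"
    using W_sq[of "Suc n" for n] U_sq[of "Suc n" for n]
    by (auto elim!: summable_comparison_test'[where N = 0])
  then show "AE \<omega> in M. summable (\<lambda>n. (norm (W (Suc n) \<omega>))\<^sup>2)"
    "AE \<omega> in M. summable (\<lambda>n. (norm (U (Suc n) \<omega>))\<^sup>2)"
    by (auto intro!: AE_summable_of_integrals int_W int_U)
qed

end

lemma summable_sq_tendsto_zero:
  fixes f :: "nat \<Rightarrow> 'a::real_normed_vector"
  assumes "summable (\<lambda>n. (norm (f n))\<^sup>2)"
  shows "f \<longlonglongrightarrow> 0"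
proof -
  have "(\<lambda>n. sqrt ((norm (f n))\<^sup>2)) \<longlonglongrightarrow> sqrt 0"
    by (intro tendsto_real_sqrt summable_LIMSEQ_zero assms)
  then show ?thesis by (simp add: tendsto_norm_zero_iff)
qed

lemma summable_on_atLeast_1_iff:
  fixes f :: "nat \<Rightarrow> real"
  assumes "\<And>k. k \<ge> 1 \<Longrightarrow> 0 \<le> f k"
  shows "f summable_on {1..} \<longleftrightarrow> summable (\<lambda>n. f (Suc n))"
proof -
  have "bij_betw Suc UNIV {1..}"
    by (rule bij_betwI[of _ _ _ "\<lambda>k. k - 1"]) auto
  then have "f summable_on {1..} \<longleftrightarrow> (\<lambda>n. f (Suc n)) summable_on UNIV"
    by (simp add: summable_on_reindex_bij_betw)
  also have "\<dots> \<longleftrightarrow> summable (\<lambda>n. f (Suc n))"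
    using assms by (intro summable_on_UNIV_nonneg_real_iff) simp
  finally show ?thesis .
qed

section \<open>Residuals, pathwise convergence and the weak limit\<close>

context risfbf
begin

text \<open>Y is the exact forward-backward point up to the forward error, and the resolvent is
  nonexpansive.\<close>

lemma residual_le:
  assumes \<omega>: "\<omega> \<in> space M" and k: "k \<ge> 1"
  shows "residual T V (lam k) (Z k \<omega>) \<le> norm (Z k \<omega> - Y k \<omega>) + lam k * norm (W k \<omega>)"
proof -
  define y where "y = resolvent (lam k) T (Z k \<omega> - lam k *\<^sub>R V (Z k \<omega>))"
  have "norm (Y k \<omega> - y) \<le> norm ((Z k \<omega> - lam k *\<^sub>R (W k \<omega> + V (Z k \<omega>))) - (Z k \<omega> - lam k *\<^sub>R V (Z k \<omega>)))"
    unfolding Y_eq[OF \<omega> k] y_def by (rule resolvent_nonexpansive[OF T lam_pos[OF k]])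
  also have "\<dots> = lam k * norm (W k \<omega>)"
    using lam_pos[OF k] by (simp add: scaleR_add_right)
  finally have "norm (Y k \<omega> - y) \<le> lam k * norm (W k \<omega>)" .
  moreover have "norm (Z k \<omega> - y) \<le> norm (Z k \<omega> - Y k \<omega>) + norm (Y k \<omega> - y)"
    using norm_triangle_ineq[of "Z k \<omega> - Y k \<omega>" "Y k \<omega> - y"] by simp
  ultimately show ?thesis by (simp add: residual_def y_def)
qed

lemma residual_nonneg: "0 \<le> residual T V c x"
  by (simp add: residual_def)

lemma adm_residual:
  assumes k: "k \<ge> 1"
  shows "adm (JZ k) (\<lambda>\<omega>. Z k \<omega> - resolvent (lam k) T (Z k \<omega> - lam k *\<^sub>R V (Z k \<omega>)))"
proof -
  have lip: "1-lipschitz_on UNIV (resolvent (lam k) T)"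
    using resolvent_nonexpansive[OF T lam_pos[OF k]] by (intro lipschitz_onI) (auto simp: dist_norm)
  have "adm (JZ k) (\<lambda>\<omega>. Z k \<omega> - lam k *\<^sub>R V (Z k \<omega>))"
    by (intro adm_diff adm_scaleR JZ_subset adm_Z k adm_lipschitz[OF JZ_subset adm_Z[OF k] L(2)])
  from adm_lipschitz[OF JZ_subset this lip] show ?thesis
    by (intro adm_diff JZ_subset adm_Z k)
qed

lemma residual_measurable: "k \<ge> 1 \<Longrightarrow> (\<lambda>\<omega>. residual T V (lam k) (Z k \<omega>)) \<in> borel_measurable M"
  unfolding residual_def by (rule measurable_compose[OF adm_M[OF adm_residual JZ_subset]]) auto

lemma residual_integrable: "k \<ge> 1 \<Longrightarrow> integrable M (\<lambda>\<omega>. (residual T V (lam k) (Z k \<omega>))\<^sup>2)"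
  unfolding residual_def by (rule adm_int[OF adm_residual])

lemma residual_L2: "(\<lambda>k. expectation (\<lambda>\<omega>. (residual T V (lam k) (Z k \<omega>))\<^sup>2)) \<longlonglongrightarrow> 0"
proof (rule LIMSEQ_imp_Suc, rule tendsto_sandwich[of "\<lambda>_. 0"])
  let ?b = "\<lambda>n. 2 * expectation (\<lambda>\<omega>. (norm (Z (Suc n) \<omega> - Y (Suc n) \<omega>))\<^sup>2)
    + 2 * (1 / (4 * L))\<^sup>2 * (\<sigma>\<^sup>2 * (1 / real (m (Suc n))))"
  have "?b \<longlonglongrightarrow> 2 * 0 + 2 * (1 / (4 * L))\<^sup>2 * (\<sigma>\<^sup>2 * 0)"
    by (intro tendsto_intros summable_LIMSEQ_zero summable_expectation_ZY batch(2))
  then show "?b \<longlonglongrightarrow> 0" by simp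
  have "expectation (\<lambda>\<omega>. (residual T V (lam k) (Z k \<omega>))\<^sup>2) \<le> 2 * expectation (\<lambda>\<omega>. (norm (Z k \<omega> - Y k \<omega>))\<^sup>2)
    + 2 * (1 / (4 * L))\<^sup>2 * (\<sigma>\<^sup>2 * (1 / real (m k)))" if k: "k \<ge> 1" for k
  proof -
    have pt: "(residual T V (lam k) (Z k \<omega>))\<^sup>2 \<le> 2 * (norm (Z k \<omega> - Y k \<omega>))\<^sup>2
        + 2 * (1 / (4 * L))\<^sup>2 * (norm (W k \<omega>))\<^sup>2" if \<omega>: "\<omega> \<in> space M" for \<omega>
    proof -
      have "(residual T V (lam k) (Z k \<omega>))\<^sup>2 \<le> (norm (Z k \<omega> - Y k \<omega>) + lam k * norm (W k \<omega>))\<^sup>2"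
        using residual_le[OF \<omega> k] residual_nonneg by (rule power_mono)
      also have "\<dots> \<le> 2 * (norm (Z k \<omega> - Y k \<omega>))\<^sup>2 + 2 * ((lam k)\<^sup>2 * (norm (W k \<omega>))\<^sup>2)"
        using zero_le_power2[of "norm (Z k \<omega> - Y k \<omega>) - lam k * norm (W k \<omega>)"]
        by (simp add: power2_sum power2_diff power_mult_distrib)
      also have "(lam k)\<^sup>2 * (norm (W k \<omega>))\<^sup>2 \<le> (1 / (4 * L))\<^sup>2 * (norm (W k \<omega>))\<^sup>2"
        using lam_le[OF k] lam_pos[OF k] by (intro mult_right_mono power_mono) auto
      finally show ?thesis by simp
    qed
    have "expectation (\<lambda>\<omega>. (residual T V (lam k) (Z k \<omega>))\<^sup>2) \<le> expectation (\<lambda>\<omega>. 2 * (norm (Z k \<omega> - Y k \<omega>))\<^sup>2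
        + 2 * (1 / (4 * L))\<^sup>2 * (norm (W k \<omega>))\<^sup>2)"
      using int_ZY[OF k] int_W[OF k] by (intro integral_mono residual_integrable k pt) auto
    also have "\<dots> = 2 * expectation (\<lambda>\<omega>. (norm (Z k \<omega> - Y k \<omega>))\<^sup>2)
        + 2 * (1 / (4 * L))\<^sup>2 * expectation (\<lambda>\<omega>. (norm (W k \<omega>))\<^sup>2)"
      using int_ZY[OF k] int_W[OF k] by simp
    also have "\<dots> \<le> 2 * expectation (\<lambda>\<omega>. (norm (Z k \<omega> - Y k \<omega>))\<^sup>2)
        + 2 * (1 / (4 * L))\<^sup>2 * (\<sigma>\<^sup>2 * (1 / real (m k)))"
      using W_sq[OF k k] by (intro add_left_mono mult_left_mono) auto
    finally show ?thesis .
  qed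
  then show "\<forall>\<^sub>F n in sequentially. expectation (\<lambda>\<omega>. (residual T V (lam (Suc n)) (Z (Suc n) \<omega>))\<^sup>2) \<le> ?b n"
    by (intro always_eventually allI) simp
  show "\<forall>\<^sub>F n in sequentially. 0 \<le> expectation (\<lambda>\<omega>. (residual T V (lam (Suc n)) (Z (Suc n) \<omega>))\<^sup>2)"
    by (intro always_eventually allI integral_nonneg_AE AE_I2) simp
qed (rule tendsto_const)

text \<open>Along a fixed path the argument is deterministic: three convergent series carry all that
  was proved by probability. The point p enters the hypotheses only through its martingale.\<close>

lemma pathwise_convergence:
  assumes \<omega>: "\<omega> \<in> space M" and p: "p \<in> solutions"
    and mart: "summable (\<lambda>n. mart p (Suc n) \<omega>)"
    and W: "summable (\<lambda>n. (norm (W (Suc n) \<omega>))\<^sup>2)" and U: "summable (\<lambda>n. (norm (U (Suc n) \<omega>))\<^sup>2)"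
  shows "summable (\<lambda>n. gain (Suc n) * (norm (X (Suc n) \<omega> - X n \<omega>))\<^sup>2)"
    and "(\<lambda>n. X (Suc n) \<omega> - X n \<omega>) \<longlonglongrightarrow> 0"
    and "(\<lambda>n. Z (Suc n) \<omega> - Y (Suc n) \<omega>) \<longlonglongrightarrow> 0"
    and "convergent (\<lambda>n. norm (X n \<omega> - p))"
proof -
  have bias: "summable (\<lambda>n. bias (Suc n) \<omega>)"
  proof (rule summable_comparison_test')
    show "summable (\<lambda>n. 5 * (1 / (4 * L))\<^sup>2 * (2 * (norm (W (Suc n) \<omega>))\<^sup>2 + 2 * (norm (U (Suc n) \<omega>))\<^sup>2))"
      by (intro summable_mult summable_add W U)
    show "norm (bias (Suc n) \<omega>) \<le> 5 * (1 / (4 * L))\<^sup>2 * (2 * (norm (W (Suc n) \<omega>))\<^sup>2 + 2 * (norm (U (Suc n) \<omega>))\<^sup>2)"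
      if "n \<ge> 0" for n
      using bias_le[of "Suc n" \<omega>] bias_nonneg[of "Suc n" \<omega>] by simp
  qed
  note * = almost_decreasing_convergent[where h = "\<lambda>n. H p (Suc n) \<omega>" and r = "\<lambda>n. decay (Suc n) \<omega>"
      and e = "\<lambda>n. bias (Suc n) \<omega> - mart p (Suc n) \<omega>"]
  have H: "convergent (\<lambda>n. H p (Suc n) \<omega>)" and D: "summable (\<lambda>n. decay (Suc n) \<omega>)"
    by (rule *; (rule H_step[OF p \<omega>] H_nonneg decay_ge(4) summable_diff[OF bias mart])?; simp)+
  show "summable (\<lambda>n. gain (Suc n) * (norm (X (Suc n) \<omega> - X n \<omega>))\<^sup>2)"
  proof (rule summable_comparison_test'[OF D])
    show "norm (gain (Suc n) * (norm (X (Suc n) \<omega> - X n \<omega>))\<^sup>2) \<le> decay (Suc n) \<omega>" if "n \<ge> 0" for n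
      using decay_ge(3)[of "Suc n" \<omega>] gain_ge[of "Suc n"] \<beta>_pos by (simp add: abs_mult)
  qed
  have "summable (\<lambda>n. \<beta> * (norm (X (Suc n) \<omega> - X n \<omega>))\<^sup>2)"
  proof (rule summable_comparison_test'[OF D])
    show "norm (\<beta> * (norm (X (Suc n) \<omega> - X n \<omega>))\<^sup>2) \<le> decay (Suc n) \<omega>" if "n \<ge> 0" for n
      using decay_ge(1)[of "Suc n" \<omega>] \<beta>_pos by (simp add: abs_mult)
  qed
  then have "summable (\<lambda>n. (norm (X (Suc n) \<omega> - X n \<omega>))\<^sup>2)"
    using \<beta>_pos by (simp add: summable_cmult_iff)
  then show dX: "(\<lambda>n. X (Suc n) \<omega> - X n \<omega>) \<longlonglongrightarrow> 0"
    by (rule summable_sq_tendsto_zero)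
  have "summable (\<lambda>n. 3 / 64 * c0 * (norm (Z (Suc n) \<omega> - Y (Suc n) \<omega>))\<^sup>2)"
  proof (rule summable_comparison_test'[OF D])
    show "norm (3 / 64 * c0 * (norm (Z (Suc n) \<omega> - Y (Suc n) \<omega>))\<^sup>2) \<le> decay (Suc n) \<omega>" if "n \<ge> 0" for n
      using decay_ge(2)[of "Suc n" \<omega>] c0_pos by (simp add: abs_mult)
  qed
  then have "summable (\<lambda>n. (norm (Z (Suc n) \<omega> - Y (Suc n) \<omega>))\<^sup>2)"
    using c0_pos by (simp add: summable_cmult_iff)
  then show "(\<lambda>n. Z (Suc n) \<omega> - Y (Suc n) \<omega>) \<longlonglongrightarrow> 0"
    by (rule summable_sq_tendsto_zero)
  show "convergent (\<lambda>n. norm (X n \<omega> - p))"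
  proof (rule inertial_lyapunov_convergent)
    show "(\<lambda>n. norm (X (Suc n) \<omega> - X n \<omega>)) \<longlonglongrightarrow> 0" using tendsto_norm_zero[OF dX] .
    show "(\<lambda>n. \<alpha> (Suc n)) \<longlonglongrightarrow> \<alpha>bar" using \<alpha>(3) by (rule LIMSEQ_Suc)
    show "\<alpha>bar < 1" by (rule bars)
    show "0 \<le> ac (Suc n)" "ac (Suc n) \<le> ac 1" for n
      by (rule ac_nonneg ac_le; simp)+
    show "(1 - \<alpha>bar) / 2 * (norm (X (Suc n) \<omega> - p))\<^sup>2 \<le> (norm (X (Suc n) \<omega> - p))\<^sup>2
        - \<alpha> (Suc n) * (norm (X n \<omega> - p))\<^sup>2 + ac (Suc n) * (norm (X (Suc n) \<omega> - X n \<omega>))\<^sup>2" for n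
      using H_lower[of "Suc n" \<omega> p] by (simp add: H_def)
    show "0 < (1 - \<alpha>bar) / 2" using bars by simp
    show "convergent (\<lambda>n. (norm (X (Suc n) \<omega> - p))\<^sup>2 - \<alpha> (Suc n) * (norm (X n \<omega> - p))\<^sup>2
        + ac (Suc n) * (norm (X (Suc n) \<omega> - X n \<omega>))\<^sup>2)"
      using H by (simp add: H_def)
  qed
qed

text \<open>Opial's lemma compares arbitrary weak cluster points, hence the distances to all
  solutions must converge along the same path.\<close>

lemma pathwise_weak_limit:
  assumes \<omega>: "\<omega> \<in> space M"
    and conv: "\<And>p. p \<in> solutions \<Longrightarrow> convergent (\<lambda>n. norm (X n \<omega> - p))"
    and dX: "(\<lambda>n. X (Suc n) \<omega> - X n \<omega>) \<longlonglongrightarrow> 0"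
    and ZY: "(\<lambda>n. Z (Suc n) \<omega> - Y (Suc n) \<omega>) \<longlonglongrightarrow> 0" and W: "(\<lambda>n. W (Suc n) \<omega>) \<longlonglongrightarrow> 0"
  shows "\<exists>l\<in>solutions. weakly_converges (\<lambda>k. X k \<omega>) l"
proof -
  have lam_Suc: "(\<lambda>n. lam (Suc n)) \<longlonglongrightarrow> lam_lim" using lam(3) by (rule LIMSEQ_Suc)
  have res: "(\<lambda>n. residual T V (lam (Suc n)) (Z (Suc n) \<omega>)) \<longlonglongrightarrow> 0"
  proof (rule tendsto_sandwich[of "\<lambda>_. 0"])
    have "(\<lambda>n. norm (Z (Suc n) \<omega> - Y (Suc n) \<omega>) + lam (Suc n) * norm (W (Suc n) \<omega>)) \<longlonglongrightarrow> norm (0::'h) + lam_lim * norm (0::'h)"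
      by (intro tendsto_add tendsto_mult tendsto_norm ZY W lam_Suc)
    then show "(\<lambda>n. norm (Z (Suc n) \<omega> - Y (Suc n) \<omega>) + lam (Suc n) * norm (W (Suc n) \<omega>)) \<longlonglongrightarrow> 0" by simp
    show "\<forall>\<^sub>F n in sequentially. residual T V (lam (Suc n)) (Z (Suc n) \<omega>)
        \<le> norm (Z (Suc n) \<omega> - Y (Suc n) \<omega>) + lam (Suc n) * norm (W (Suc n) \<omega>)"
      by (intro always_eventually allI residual_le \<omega>) simp
    show "\<forall>\<^sub>F n in sequentially. 0 \<le> residual T V (lam (Suc n)) (Z (Suc n) \<omega>)"
      by (intro always_eventually allI residual_nonneg)
  qed (rule tendsto_const)
  have "(\<lambda>n. - (\<alpha> (Suc n) *\<^sub>R (X (Suc n) \<omega> - X n \<omega>))) \<longlonglongrightarrow> - (\<alpha>bar *\<^sub>R 0)"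
    by (intro tendsto_minus tendsto_scaleR dX LIMSEQ_Suc \<alpha>(3))
  then have XZ: "(\<lambda>n. X (Suc n) \<omega> - Z (Suc n) \<omega>) \<longlonglongrightarrow> 0"
    using Z_eq[OF \<omega>] by simp
  have conv': "convergent (\<lambda>n. norm (X (Suc n) \<omega> - p))" if "p \<in> solutions" for p
    using conv[OF that] convergent_Suc_iff[of "\<lambda>n. norm (X n \<omega> - p)"] by simp
  obtain p where p: "p \<in> solutions" using solvable by blast
  obtain B where B: "\<And>n. norm (norm (X (Suc n) \<omega> - p)) \<le> B"
    using convergent_imp_Bseq[OF conv'[OF p]] by (auto simp: Bseq_def)
  have bd: "norm (X (Suc n) \<omega>) \<le> B + norm p" for n
    using norm_triangle_ineq[of "X (Suc n) \<omega> - p" p] B[of n] by simp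
  have "\<exists>l\<in>solutions. weakly_converges (\<lambda>n. X (Suc n) \<omega>) l"
  proof (rule opial[OF solvable conv'])
    fix r :: "nat \<Rightarrow> nat" and l
    assume r: "strict_mono r" and weak: "weakly_converges ((\<lambda>n. X (Suc n) \<omega>) \<circ> r) l"
    have sub: "(\<lambda>n. f (r n)) \<longlonglongrightarrow> a" if "f \<longlonglongrightarrow> a" for f :: "nat \<Rightarrow> 'b::topological_space" and a
      using LIMSEQ_subseq_LIMSEQ[OF that r] by (simp add: o_def)
    have "- V l \<in> T l"
    proof (rule weak_cluster_zero[OF T V L])
      show "0 < lam (Suc (r n))" for n by (rule lam_pos) simp
      show "(\<lambda>n. lam (Suc (r n))) \<longlonglongrightarrow> lam_lim" by (rule sub[OF lam_Suc])
      show "0 < lam_lim" using lam(2) by simp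
      show "(\<lambda>n. residual T V (lam (Suc (r n))) (Z (Suc (r n)) \<omega>)) \<longlonglongrightarrow> 0" by (rule sub[OF res])
      show "(\<lambda>n. X (Suc (r n)) \<omega> - Z (Suc (r n)) \<omega>) \<longlonglongrightarrow> 0" by (rule sub[OF XZ])
      show "norm (X (Suc (r n)) \<omega>) \<le> B + norm p" for n by (rule bd)
      show "weakly_converges (\<lambda>n. X (Suc (r n)) \<omega>) l" using weak by (simp add: o_def)
    qed
    then show "l \<in> solutions" by (simp add: zeros_op_sum_iff)
  qed
  then obtain l where l: "l \<in> solutions" "weakly_converges (\<lambda>n. X (Suc n) \<omega>) l" by blast
  have "weakly_converges (\<lambda>k. X k \<omega>) l"
    unfolding weakly_converges_def
  proof
    fix h
    show "(\<lambda>k. inner (X k \<omega>) h) \<longlonglongrightarrow> inner l h"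
      by (rule LIMSEQ_imp_Suc) (use l(2) in \<open>simp add: weakly_converges_def\<close>)
  qed
  with l(1) show ?thesis by blast
qed

lemma AE_convergence:
  "AE \<omega> in M. (\<exists>l\<in>solutions. weakly_converges (\<lambda>k. X k \<omega>) l) \<and>
    summable (\<lambda>n. gain (Suc n) * (norm (X (Suc n) \<omega> - X n \<omega>))\<^sup>2)"
proof -
  \<comment> \<open>The exceptional set of the martingale depends on p. A countable dense set of
    solutions leaves one null set, and \<open>convergent_norm_dense\<close> recovers the remaining
    solutions.\<close>
  obtain D where D: "countable D" "D \<subseteq> solutions" "solutions \<subseteq> closure D"
    by (rule separable)
  obtain p0 where "p0 \<in> solutions" using solvable by blast
  then have "D \<noteq> {}" using D(3) by auto
  then obtain p where p: "p \<in> D" by blast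
  have "AE \<omega> in M. \<forall>p\<in>D. summable (\<lambda>n. mart p (Suc n) \<omega>)"
    by (rule AE_ball_countable'[OF AE_summable_mart D(1)]) (use D(2) in blast)
  then show ?thesis
    using AE_summable_errors AE_space
  proof eventually_elim
    case (elim \<omega>)
    have path: "summable (\<lambda>n. gain (Suc n) * (norm (X (Suc n) \<omega> - X n \<omega>))\<^sup>2)"
      "(\<lambda>n. X (Suc n) \<omega> - X n \<omega>) \<longlonglongrightarrow> 0" "(\<lambda>n. Z (Suc n) \<omega> - Y (Suc n) \<omega>) \<longlonglongrightarrow> 0"
      "convergent (\<lambda>n. norm (X n \<omega> - q))" if "q \<in> D" for q
    proof -
      have q: "q \<in> solutions" using D(2) that by (rule subsetD)
      have mart: "summable (\<lambda>n. mart q (Suc n) \<omega>)" using elim(1) that by (rule bspec)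
      show "summable (\<lambda>n. gain (Suc n) * (norm (X (Suc n) \<omega> - X n \<omega>))\<^sup>2)"
        "(\<lambda>n. X (Suc n) \<omega> - X n \<omega>) \<longlonglongrightarrow> 0" "(\<lambda>n. Z (Suc n) \<omega> - Y (Suc n) \<omega>) \<longlonglongrightarrow> 0"
        "convergent (\<lambda>n. norm (X n \<omega> - q))"
        by (fact pathwise_convergence[OF elim(4) q mart elim(2,3)])+
    qed
    have conv: "convergent (\<lambda>n. norm (X n \<omega> - q))" if "q \<in> solutions" for q
      by (rule convergent_norm_dense[OF path(4) subsetD[OF D(3) that]])
    have "\<exists>l\<in>solutions. weakly_converges (\<lambda>k. X k \<omega>) l"
      by (rule pathwise_weak_limit[OF elim(4) conv path(2,3)[OF p] summable_sq_tendsto_zero[OF elim(2)]])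
    with path(1)[OF p] show ?case by blast
  qed
qed

text \<open>Choosing a limit path by path gives no measurability. It follows from the weak form: off
  a null set each inner product is a pointwise limit of measurable functions.\<close>

lemma weak_limit_measurable:
  "\<exists>Xlim \<in> borel_measurable M. (\<forall>\<omega>\<in>space M. Xlim \<omega> \<in> solutions) \<and>
    (AE \<omega> in M. weakly_converges (\<lambda>k. X k \<omega>) (Xlim \<omega>))"
proof -
  obtain p where p: "p \<in> solutions" using solvable by blast
  obtain N where N: "{\<omega> \<in> space M. \<not> (\<exists>l\<in>solutions. weakly_converges (\<lambda>k. X k \<omega>) l)} \<subseteq> N" "N \<in> null_sets M"
    using AE_convergence unfolding eventually_conj_iff by (auto simp: eventually_ae_filter)
  have "\<exists>l\<in>solutions. weakly_converges (\<lambda>k. X k \<omega>) l" if "\<omega> \<in> space M - N" for \<omega>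
    using N(1) that by blast
  then obtain l where l: "\<And>\<omega>. \<omega> \<in> space M - N \<Longrightarrow> l \<omega> \<in> solutions"
    "\<And>\<omega>. \<omega> \<in> space M - N \<Longrightarrow> weakly_converges (\<lambda>k. X k \<omega>) (l \<omega>)"
    by metis
  \<comment> \<open>On the null set a fixed solution is substituted, so that the values are
    solutions everywhere.\<close>
  define Xlim where "Xlim \<omega> = (if \<omega> \<in> space M - N then l \<omega> else p)" for \<omega>
  have N_sets[measurable]: "N \<in> sets M" using N(2) by auto
  have "Xlim \<in> borel_measurable M"
  proof (rule borel_measurable_weakly)
    fix h
    have X_M[measurable]: "X (Suc k) \<in> borel_measurable M" for k
      using adm_M[OF conjunct1[OF adm_X[of "Suc k"]] JZ_subset] by simp
    show "(\<lambda>\<omega>. inner (Xlim \<omega>) h) \<in> borel_measurable M"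
    proof (rule borel_measurable_LIMSEQ_real)
      show "(\<lambda>\<omega>. if \<omega> \<in> N then inner p h else inner (X (Suc k) \<omega>) h) \<in> borel_measurable M" for k
        by measurable
      fix \<omega> assume \<omega>: "\<omega> \<in> space M"
      show "(\<lambda>k. if \<omega> \<in> N then inner p h else inner (X (Suc k) \<omega>) h) \<longlonglongrightarrow> inner (Xlim \<omega>) h"
      proof (cases "\<omega> \<in> N")
        case False
        then have "(\<lambda>k. inner (X k \<omega>) h) \<longlonglongrightarrow> inner (l \<omega>) h"
          using l(2)[of \<omega>] \<omega> by (simp add: weakly_converges_def)
        from LIMSEQ_Suc[OF this] show ?thesis using False \<omega> by (simp add: Xlim_def)
      qed (simp add: Xlim_def)
    qed
  qed
  moreover have "\<forall>\<omega>\<in>space M. Xlim \<omega> \<in> solutions"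
    using l(1) p by (simp add: Xlim_def)
  moreover have "AE \<omega> in M. weakly_converges (\<lambda>k. X k \<omega>) (Xlim \<omega>)"
    using AE_not_in[OF N(2)] AE_space by eventually_elim (simp add: Xlim_def l(2))
  ultimately show ?thesis by blast
qed

lemma AE_summable_gain:
  "AE \<omega> in M. (\<lambda>k. ((1 - \<alpha> k) * (5 * (1 - \<alpha> k) / (4 * \<rho> k * (1 + L * lam k)) - 1) - 2 * (\<alpha> k)\<^sup>2) *
     (norm (X k \<omega> - X (k - 1) \<omega>))\<^sup>2) summable_on {1..}"
  using AE_convergence
proof eventually_elim
  case (elim \<omega>)
  let ?f = "\<lambda>k. gain k * (norm (X k \<omega> - X (k - 1) \<omega>))\<^sup>2"
  have "0 \<le> ?f k" if "k \<ge> 1" for k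
    using gain_ge[OF that] \<beta>_pos by simp
  then have "?f summable_on {1..}"
    using elim by (subst summable_on_atLeast_1_iff) auto
  then show ?case
    by (rule summable_on_cong[THEN iffD1, rotated]) (simp add: gain_eq)
qed

end

section \<open>From the random variable \<xi> to its law, and conclusion\<close>

theorem theorem4p1:
  fixes T :: "'h::{real_inner, banach, second_countable_topology} \<Rightarrow> 'h set"
    and V :: "'h \<Rightarrow> 'h" and L \<sigma> \<alpha>bar \<epsilon>bar lam_lim :: real
    and M :: "'w measure" and \<Xi> :: "(real ^ 'd) set" and P :: "(real ^ 'd) measure"
    and \<xi> :: "'w \<Rightarrow> real ^ 'd" and Vhat :: "'h \<Rightarrow> real ^ 'd \<Rightarrow> 'h"
    and xi eta :: "nat \<Rightarrow> nat \<Rightarrow> 'w \<Rightarrow> real ^ 'd"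
    and \<alpha> \<rho> lam :: "nat \<Rightarrow> real" and m :: "nat \<Rightarrow> nat"
    and x0 x1 :: 'h and Z Y X :: "nat \<Rightarrow> 'w \<Rightarrow> 'h"
  assumes T: "maximally_monotone T"
    and V: "maximally_monotone (single_op V)" "L > 0" "L-lipschitz_on UNIV V"
    and prob: "prob_space M" "complete_measure M"
    and \<Xi>: "\<Xi> \<in> sets borel"
    and \<xi>: "\<xi> \<in> M \<rightarrow>\<^sub>M restrict_space borel \<Xi>"
    and law: "P = distr M (restrict_space borel \<Xi>) \<xi>"
    and Vhat: "(\<lambda>(x, z). Vhat x z) \<in> borel_measurable (borel \<Otimes>\<^sub>M restrict_space borel \<Xi>)"
    and samples: "iid_samples M P m xi eta"
    and init: "x0 \<in> dom_op T" "x1 \<in> dom_op T"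
    and process: "risfbf_process M T Vhat \<alpha> \<rho> lam m xi eta x0 x1 Z Y X"
    and solvable: "zeros_op (sum_op T (single_op V)) \<noteq> {}"
    and unbiased: "\<And>x. has_bochner_integral M (\<lambda>\<omega>. Vhat x (\<xi> \<omega>)) (V x)"
    and variance: "\<sigma> > 0"
      "\<And>x. integrable M (\<lambda>\<omega>. (norm (Vhat x (\<xi> \<omega>) - V x))\<^sup>2)"
      "\<And>x. (\<integral>\<omega>. (norm (Vhat x (\<xi> \<omega>) - V x))\<^sup>2 \<partial>M) \<le> \<sigma>\<^sup>2"
    and batch: "\<And>k. k \<ge> 1 \<Longrightarrow> m k \<ge> 1" "mono_on {1..} m"
      "(\<lambda>k. 1 / real (m k)) summable_on {1..}"
    and bars: "0 < \<alpha>bar" "\<alpha>bar < 1" "0 < \<epsilon>bar" "\<epsilon>bar < 1"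
    and \<alpha>: "\<And>k. k \<ge> 1 \<Longrightarrow> 0 \<le> \<alpha> k" "mono_on {1..} \<alpha>" "\<alpha> \<longlonglongrightarrow> \<alpha>bar"
    and lam: "\<And>k. k \<ge> 1 \<Longrightarrow> lam k \<in> {0<..<1 / (4 * L)}" "lam_lim \<in> {0<..<1 / (4 * L)}"
      "lam \<longlonglongrightarrow> lam_lim"
    and \<rho>: "\<And>k. k \<ge> 1 \<Longrightarrow> \<rho> k = 5 * (1 - \<epsilon>bar) * (1 - \<alpha>bar)\<^sup>2 /
      (4 * (2 * (\<alpha> k)\<^sup>2 - \<alpha> k + 1) * (1 + L * lam k))"
  shows
    "((\<forall>k\<ge>1. (\<lambda>\<omega>. residual T V (lam k) (Z k \<omega>)) \<in> borel_measurable M \<and>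
              integrable M (\<lambda>\<omega>. (residual T V (lam k) (Z k \<omega>))\<^sup>2)) \<and>
      (\<lambda>k. \<integral>\<omega>. (residual T V (lam k) (Z k \<omega>))\<^sup>2 \<partial>M) \<longlonglongrightarrow> 0) \<and>
     (\<exists>Xlim \<in> borel_measurable M. (\<forall>\<omega>\<in>space M. Xlim \<omega> \<in> zeros_op (sum_op T (single_op V))) \<and>
        (AE \<omega> in M. weakly_converges (\<lambda>k. X k \<omega>) (Xlim \<omega>))) \<and>
     (AE \<omega> in M.
        (\<lambda>k. ((1 - \<alpha> k) * (5 * (1 - \<alpha> k) / (4 * \<rho> k * (1 + L * lam k)) - 1) - 2 * (\<alpha> k)\<^sup>2) *
             (norm (X k \<omega> - X (k - 1) \<omega>))\<^sup>2) summable_on {1..})"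
proof -
  interpret prob_space M by (rule prob)
  let ?S = "case_sum (\<lambda>(k, t). xi k t) (\<lambda>(k, t). eta k t)" and ?I = "sample_indices m <+> sample_indices m"
  have sets_P: "sets P = sets (restrict_space borel \<Xi>)" by (simp add: law)
  have Vhat_P: "(\<lambda>(x, z). Vhat x z) \<in> borel_measurable (borel \<Otimes>\<^sub>M P)"
    using Vhat by (simp cong: measurable_cong_sets sets_pair_measure_cong add: sets_P)
  have V_meas: "V \<in> borel_measurable borel"
    using lipschitz_on_continuous_on[OF V(3)] by (rule borel_measurable_continuous_onI)
  have Vhat_x[measurable]: "Vhat x \<in> borel_measurable (restrict_space borel \<Xi>)" for x
    using measurable_compose[OF measurable_Pair1'[of x borel "restrict_space borel \<Xi>"] Vhat] by simp
  \<comment> \<open>Change of variables along \<xi>: mean and variance assumptions on the base space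
    become integrals over the common law of the samples.\<close>
  have unb: "has_bochner_integral P (Vhat x) (V x)" for x
    using unbiased[of x] \<xi> unfolding law has_bochner_integral_iff
    by (simp add: integrable_distr_eq integral_distr)
  have var: "integrable P (\<lambda>z. (norm (Vhat x z - V x))\<^sup>2)" "(\<integral>z. (norm (Vhat x z - V x))\<^sup>2 \<partial>P) \<le> \<sigma>\<^sup>2" for x
    using variance(2,3)[of x] \<xi> unfolding law by (simp_all add: integrable_distr_eq integral_distr)
  interpret P: prob_space P unfolding law by (rule prob_space_distr[OF \<xi>])
  have law_S: "distr M P (?S i) = P" if "i \<in> ?I" for i
    using samples that by (auto simp: iid_samples_def)
  have ind: "indep_vars (\<lambda>_. P) ?S ?I"
    using samples by (simp add: iid_samples_def)
  have summ: "summable (\<lambda>n. 1 / real (m (Suc n)))"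
    using batch(3) by (subst (asm) summable_on_atLeast_1_iff) auto
  interpret risfbf M P xi eta m Vhat V \<sigma> T L \<alpha>bar \<epsilon>bar lam_lim \<alpha> \<rho> lam x0 x1 Z Y X
    by unfold_locales
      (fact ind law_S Vhat_P V_meas unb var T V process solvable batch summ bars \<alpha> lam \<rho>)+
  show ?thesis
    using residual_measurable residual_integrable residual_L2 weak_limit_measurable AE_summable_gain
    by blast
qed

end
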